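(* Assume that $K$ is invertible. Define $p:[0,1]\to[0,\infty)$ and $k:[0,1]\to[0,1]$ by $$p(\zeta):=\int_0^\zeta\lambda_0(\eta)^{-1}\,\mathrm{d}\eta,\qquad k(\zeta):=1-p(\zeta)p(1)^{-1},$$ and the matrices $$A_d:=-K^{-1}LP(1),\quad B_d:=-K^{-1}\left[\begin{smallmatrix}0\\ I\end{smallmatrix}\right],\quad C_d:=(K_yK^{-1}L-L_y)P(1),\quad D_d:=K_yK^{-1}\left[\begin{smallmatrix}0\\ I\end{smallmatrix}\right].$$ Then the continuous-time system $$\frac{\partial z}{\partial t}(\zeta,t)=-\frac{\partial}{\partial\zeta}(\lambda_0(\zeta)z(\zeta,t)),\quad z(\zeta,0)=z_0(\zeta),\quad \zeta\in(0,1),$$ $$\left[\begin{smallmatrix}0\\ I\end{smallmatrix}\right]u(t)=-\lambda_0(0)Kz(0,t)-\lambda_0(1)LP(1)z(1,t),$$ $$y(t)=-\lambda_0(0)K_yz(0,t)-\lambda_0(1)L_yP(1)z(1,t),\qquad t\ge0,$$ may be equivalently written as the discrete-time system $$z_d(j+1)(\zeta)=A_dz_d(j)(\zeta)+B_du_d(j)(\zeta),$$ $$z_d(0)(k(\zeta))=\lambda_0(\zeta)z_0(\zeta),$$ $$y_d(j)(\zeta)=C_dz_d(j)(\zeta)+D_du_d(j)(\zeta),$$ $j\in\mathbb{N}$, $\zeta\in[0,1]$, with state, input and output spaces $\mathfrak{X}=\mathrm{L}^2(0,1;\mathbb{C}^n)$, $\mathcal{U}=\mathrm{L}^2(0,1;\mathbb{C}^p)$,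 $\mathcal{Y}=\mathrm{L}^2(0,1;\mathbb{C}^m)$ (so $z_d(j)\in\mathfrak{X}$, $u_d(j)\in\mathcal{U}$, $y_d(j)\in\mathcal{Y}$). Precisely, given $z_0\in \mathrm{L}^2(0,1;\mathbb{C}^n)$, $u\in \mathrm{L}^2_{\mathrm{loc}}(0,\infty;\mathbb{C}^p)$, $y\in \mathrm{L}^2_{\mathrm{loc}}(0,\infty;\mathbb{C}^m)$ and $z$, the following are equivalent: (i) $z$ is a solution of the continuous-time system with initial state $z_0$, input $u$ and output $y$; (ii) there is $f\in \mathrm{L}^2_{\mathrm{loc}}([0,\infty);\mathbb{C}^n)$ with $z(\zeta,t)=\lambda_0(\zeta)^{-1}f(k(\zeta)+p(1)^{-1}t)$ and $\lambda_0(\zeta)z_0(\zeta)=f(k(\zeta))$ such that the sequences given by $$z_d(0)(k(\zeta))=\lambda_0(\zeta)z_0(\zeta),\qquad z_d(j)(\zeta)=f(j+\zeta)\ (j\ge1),$$ $$u_d(j)(\zeta)=u((j+\zeta)p(1)),\qquad y_d(j)(\zeta)=y((j+\zeta)p(1))\ (j\in\mathbb{N}),$$ satisfy the discrete-time system.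
   Context: $\mathbb{N}$ includes $0$. Let $n,p,m$ be positive integers with $p\le n$ (the integer $p$ is the input dimension, not to be confused with the function $p(\cdot)$). $\lambda_0\in \mathrm{L}^\infty(0,1;\mathbb{R}^+)$ is scalar with $\lambda_0(\zeta)\ge\epsilon>0$ a.e., $M\in \mathrm{L}^\infty(0,1;\mathbb{R}^{n\times n})$, $K,L\in\mathbb{C}^{n\times n}$, $K_y,L_y\in\mathbb{C}^{m\times n}$, and $\left[\begin{smallmatrix}0\\ I\end{smallmatrix}\right]\in\mathbb{C}^{n\times p}$ with $I$ the $p\times p$ identity. $P:[0,1]\to\mathbb{R}^{n\times n}$ is the unique absolutely continuous solution of $P'(\zeta)=\lambda_0(\zeta)^{-1}M(\zeta)P(\zeta)$ (a.e.), $P(0)=I$. Equalities between functions in $\mathrm{L}^2$ hold almost everywhere. Solutions of the continuous-time system are mild solutions: $z\in C([0,\infty);\mathrm{L}^2(0,1;\mathbb{C}^n))$ such that, with $Z(t)=\int_0^tz(\cdot,s)\,\mathrm{d}s$, for all $t\ge0$: $\lambda_0Z(t)\in \mathrm{H}^1(0,1;\mathbb{C}^n)$, $z(\cdot,t)-z_0=-\frac{\mathrm{d}}{\mathrm{d}\zeta}(\lambda_0Z(t))$, $\left[\begin{smallmatrix}0\\ I\end{smallmatrix}\right]\int_0^tu(s)\,\mathrm{d}s=-K(\lambda_0Z(t))(0)-LP(1)(\lambda_0Z(t))(1)$ and $\int_0^ty(s)\,\mathrm{d}s=-K_y(\lambda_0Z(t))(0)-L_yP(1)(\lambda_0Z(t))(1)$.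 *)

theory Defs
  imports "HOL-Analysis.Analysis"
begin

section \<open>Function spaces\<close>

text \<open>Elements of the spaces below are functions rather than equivalence classes; equality of
  elements is equality almost everywhere and is written out with \<open>AE\<close> where it is used.\<close>

definition L2_space :: "real set \<Rightarrow> (real \<Rightarrow> 'a::euclidean_space) set" where
  "L2_space S = {f \<in> borel_measurable (lebesgue_on S).
      integrable (lebesgue_on S) (\<lambda>x. (norm (f x))\<^sup>2)}"

definition L2_norm_on :: "real set \<Rightarrow> (real \<Rightarrow> 'a::euclidean_space) \<Rightarrow> real" where
  "L2_norm_on S f = sqrt (LINT x|lebesgue_on S. (norm (f x))\<^sup>2)"

text \<open>Square integrable on \<open>(0,T)\<close> for every \<open>T > 0\<close>, i.e. up to and including the left end
  point \<open>0\<close>.\<close>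

definition L2_loc :: "(real \<Rightarrow> 'a::euclidean_space) set" where
  "L2_loc = {f. \<forall>T>0. f \<in> L2_space {0<..<T}}"

definition Linf_space :: "real set \<Rightarrow> (real \<Rightarrow> 'a::euclidean_space) set" where
  "Linf_space S = {f \<in> borel_measurable (lebesgue_on S).
      \<exists>C. AE x in lebesgue_on S. norm (f x) \<le> C}"

text \<open>The usual epsilon-delta definition. A set \<open>D\<close> with \<open>D division_of S\<close> is a finite family of
  non-overlapping compact intervals \<open>k\<close> (with end points \<open>Inf k\<close> and \<open>Sup k\<close>) with union \<open>S\<close>.\<close>

definition abs_continuous_on :: "real set \<Rightarrow> (real \<Rightarrow> 'a::euclidean_space) \<Rightarrow> bool" where
  "abs_continuous_on I w \<longleftrightarrow>
    (\<forall>\<epsilon>>0. \<exists>\<delta>>0. \<forall>D S. D division_of S \<longrightarrow> S \<subseteq> I \<longrightarrow> (\<Sum>k\<in>D. measure lborel k) < \<delta> \<longrightarrow>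
      (\<Sum>k\<in>D. norm (w (Sup k) - w (Inf k))) < \<epsilon>)"

text \<open>\<open>w\<close> is (the continuous representative on \<open>[0,1]\<close> of) an element of \<open>H\<^sup>1(0,1)\<close>, with
  derivative \<open>d\<close> in \<open>L\<^sup>2(0,1)\<close>. The boundary traces of the element are \<open>w 0\<close> and \<open>w 1\<close>.\<close>

definition H1_with_derivative :: "(real \<Rightarrow> 'a::euclidean_space) \<Rightarrow> (real \<Rightarrow> 'a) \<Rightarrow> bool" where
  "H1_with_derivative w d \<longleftrightarrow>
    abs_continuous_on {0..1} w \<and> d \<in> L2_space {0<..<1} \<and>
    (AE \<zeta> in lebesgue_on {0<..<1}. (w has_vector_derivative d \<zeta>) (at \<zeta>))"

section \<open>Curves in \<open>L\<^sup>2(0,1)\<close>\<close>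

text \<open>A curve \<open>t \<mapsto> z(\<cdot>,t)\<close> is given by \<open>z :: real \<Rightarrow> real \<Rightarrow> 'a\<close> with the spatial variable as
  first argument.\<close>

definition continuous_L2_curve :: "(real \<Rightarrow> real \<Rightarrow> 'a::euclidean_space) \<Rightarrow> bool" where
  "continuous_L2_curve z \<longleftrightarrow>
    (\<forall>t\<ge>0. (\<lambda>\<zeta>. z \<zeta> t) \<in> L2_space {0<..<1}) \<and>
    (\<forall>t\<ge>0. ((\<lambda>s. L2_norm_on {0<..<1} (\<lambda>\<zeta>. z \<zeta> s - z \<zeta> t)) \<longlongrightarrow> 0) (at t within {0..}))"

text \<open>\<open>Zt\<close> is the \<open>L\<^sup>2(0,1)\<close>-valued integral of \<open>z(\<cdot>,s)\<close> over \<open>s \<in> [0,t]\<close>: the limit, in the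
  norm of \<open>L\<^sup>2(0,1)\<close>, of the Riemann sums as the mesh tends to zero. It is only used for continuous
  curves. A pointwise integral for fixed \<open>\<zeta>\<close> would not make sense, because each \<open>z(\<cdot>,s)\<close> is only
  determined almost everywhere, with an exceptional set that depends on \<open>s\<close>.\<close>

definition has_L2_integral ::
    "(real \<Rightarrow> real \<Rightarrow> 'a::euclidean_space) \<Rightarrow> real \<Rightarrow> (real \<Rightarrow> 'a) \<Rightarrow> bool" where
  "has_L2_integral z t Zt \<longleftrightarrow>
    Zt \<in> L2_space {0<..<1} \<and>
    (\<forall>\<epsilon>>0. \<exists>\<delta>>0. \<forall>D. D tagged_division_of {0..t} \<longrightarrow> (\<lambda>s. ball s \<delta>) fine D \<longrightarrow>
      L2_norm_on {0<..<1} (\<lambda>\<zeta>. (\<Sum>(s, k)\<in>D. measure lborel k *\<^sub>R z \<zeta> s) - Zt \<zeta>) < \<epsilon>)"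

section \<open>Matrices\<close>

text \<open>The block matrix with \<open>n - p\<close> zero rows above the \<open>p \<times> p\<close> identity. Rows and columns are
  ordered by the linear orders of the index types, so \<open>card {..<i}\<close> is the zero-based number of
  the row \<open>i\<close>.\<close>

definition lower_identity :: "complex ^ 'p::{finite,linorder} ^ 'n::{finite,linorder}" where
  "lower_identity = (\<chi> i j. if card {..<i} + CARD('p) = card {..<j} + CARD('n) then 1 else 0)"

text \<open>\<open>P\<close> is the absolutely continuous solution of \<open>P' = \<lambda>\<^sub>0\<^sup>-\<^sup>1 M P\<close>, \<open>P(0) = I\<close>, on \<open>[0,1]\<close>.\<close>

definition fundamental_solution ::
    "(real \<Rightarrow> real) \<Rightarrow> (real \<Rightarrow> real^'n^'n) \<Rightarrow> (real \<Rightarrow> real^'n^'n) \<Rightarrow> bool" where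
  "fundamental_solution lam M P \<longleftrightarrow>
    abs_continuous_on {0..1} P \<and> P 0 = mat 1 \<and>
    (AE \<zeta> in lebesgue_on {0<..<1}.
      (P has_vector_derivative (inverse (lam \<zeta>) *\<^sub>R (M \<zeta> ** P \<zeta>))) (at \<zeta>))"

section \<open>The two systems\<close>

text \<open>Mild solutions. In both definitions \<open>B0\<close> multiplies the input; the argument \<open>P1\<close> is \<open>P(1)\<close>.
  The function \<open>w\<close> is the continuous representative of \<open>\<lambda>\<^sub>0 Z(t)\<close> and \<open>d\<close> its derivative.\<close>

definition continuous_time_solution ::
    "(real \<Rightarrow> real) \<Rightarrow> complex^'n^'n \<Rightarrow> complex^'n^'n \<Rightarrow> complex^'n^'n \<Rightarrow>
     complex^'n^'m \<Rightarrow> complex^'n^'m \<Rightarrow> complex^'p^'n \<Rightarrow>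
     (real \<Rightarrow> complex^'n) \<Rightarrow> (real \<Rightarrow> complex^'p) \<Rightarrow> (real \<Rightarrow> complex^'m) \<Rightarrow>
     (real \<Rightarrow> real \<Rightarrow> complex^'n) \<Rightarrow> bool" where
  "continuous_time_solution lam P1 K L Ky Ly B0 z0 u y z \<longleftrightarrow>
    continuous_L2_curve z \<and>
    (\<forall>t\<ge>0. \<exists>Zt w d.
      has_L2_integral z t Zt \<and>
      (AE \<zeta> in lebesgue_on {0<..<1}. w \<zeta> = lam \<zeta> *\<^sub>R Zt \<zeta>) \<and>
      H1_with_derivative w d \<and>
      (AE \<zeta> in lebesgue_on {0<..<1}. z \<zeta> t - z0 \<zeta> = - d \<zeta>) \<and>
      B0 *v (LINT s:{0..t}|lebesgue. u s) = - (K *v w 0) - (L ** P1) *v w 1 \<and>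
      (LINT s:{0..t}|lebesgue. y s) = - (Ky *v w 0) - (Ly ** P1) *v w 1)"

definition discrete_time_solution ::
    "(real \<Rightarrow> real) \<Rightarrow> (real \<Rightarrow> real) \<Rightarrow>
     complex^'n^'n \<Rightarrow> complex^'p^'n \<Rightarrow> complex^'n^'m \<Rightarrow> complex^'p^'m \<Rightarrow>
     (real \<Rightarrow> complex^'n) \<Rightarrow> (nat \<Rightarrow> real \<Rightarrow> complex^'p) \<Rightarrow> (nat \<Rightarrow> real \<Rightarrow> complex^'m) \<Rightarrow>
     (nat \<Rightarrow> real \<Rightarrow> complex^'n) \<Rightarrow> bool" where
  "discrete_time_solution lam k A B C D z0 ud yd zd \<longleftrightarrow>
    (\<forall>j. zd j \<in> L2_space {0<..<1} \<and> ud j \<in> L2_space {0<..<1} \<and> yd j \<in> L2_space {0<..<1}) \<and>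
    (\<forall>j. AE \<zeta> in lebesgue_on {0<..<1}. zd (j + 1) \<zeta> = A *v zd j \<zeta> + B *v ud j \<zeta>) \<and>
    (AE \<zeta> in lebesgue_on {0<..<1}. zd 0 (k \<zeta>) = lam \<zeta> *\<^sub>R z0 \<zeta>) \<and>
    (\<forall>j. AE \<zeta> in lebesgue_on {0<..<1}. yd j \<zeta> = C *v zd j \<zeta> + D *v ud j \<zeta>)"

end

theory Submission
  imports Defs
begin

text \<open>In the coordinate \<open>x = k \<zeta>\<close> the equation becomes transport with constant speed \<open>1 / p(1)\<close>, whose mild
  solutions are \<open>z(\<zeta>,t) = f(k \<zeta> + t / p(1)) / \<lambda>\<^sub>0(\<zeta>)\<close>; then \<open>\<lambda>\<^sub>0 Z(t)\<close> at \<open>\<zeta>\<close> is \<open>p(1)\<close> times the integral of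
  \<open>f\<close> over \<open>[k \<zeta>, k \<zeta> + t / p(1)]\<close>. At \<open>\<zeta> = 0\<close> and \<open>\<zeta> = 1\<close> this turns the integrated boundary conditions
  into an almost everywhere relation between \<open>f(s + 1)\<close>, \<open>f(s)\<close> and \<open>u(s p(1))\<close>, which, cut into unit
  intervals, is the discrete-time system.\<close>

section \<open>Square-integrable functions on an interval\<close>

text \<open>A mild solution offers little to differentiate: each state is known only up to a null
  set depending on \<open>t\<close>, it has no boundary values, and \<open>Z\<close>,
  \<open>w\<close>, \<open>d\<close> are supplied for each \<open>t\<close> separately, with no
  regularity in \<open>t\<close>. The direction from mild solutions to waves therefore works with
  space primitives. The integral of \<open>z\<close> over \<open>[0, x]\<close> is continuous in
  \<open>(x, t)\<close>, and integration over a window, being a bounded functional on L^2, commutes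
  with the L^2-valued time integral, so no pointwise time integral and no Fubini argument occurs.
  The result is an identity between integrals of continuous functions. Read at one end of the
  interval, it makes \<open>w t 0\<close> continuous in \<open>t\<close>; read everywhere, it is the
  transport equation in integrated form. The profile is assembled from the countably many states at
  the times \<open>j * T\<close>, one per unit interval; the transport law shows that these pieces
  also describe all times in between. Conversely, the L^2 limits for waves are proved for continuous
  profiles and carried over by density, with bounds independent of the division.\<close>

lemma AE_lebesgue_on_iff_negligible:
  assumes "S \<in> sets lebesgue"
  shows "(AE x in lebesgue_on S. Q x) \<longleftrightarrow> negligible {x\<in>S. \<not> Q x}"
proof -
  have "(AE x in lebesgue_on S. Q x) \<longleftrightarrow> (AE x in lebesgue. x \<in> S \<longrightarrow> Q x)"
    using assms by (simp add: AE_restrict_space_iff)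
  also have "\<dots> \<longleftrightarrow> {x. \<not> (x \<in> S \<longrightarrow> Q x)} \<in> null_sets lebesgue"
    by (simp add: completion.AE_iff_null_sets flip: null_sets_def)
  also have "{x. \<not> (x \<in> S \<longrightarrow> Q x)} = {x\<in>S. \<not> Q x}" by auto
  finally show ?thesis by (simp add: negligible_iff_null_sets)
qed

text \<open>The end points form a null set. Closed intervals are the working domain because gauge
  integrals, boundary values and the map \<open>k\<close> all live there.\<close>

lemma AE_open_interval_iff:
  "(AE x in lebesgue_on {a<..<b::real}. Q x) \<longleftrightarrow> negligible {x\<in>{a..b}. \<not> Q x}"
proof -
  have "negligible {x\<in>{a<..<b}. \<not> Q x} \<longleftrightarrow> negligible {x\<in>{a..b}. \<not> Q x}"
  proof
    assume "negligible {x\<in>{a<..<b}. \<not> Q x}"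
    then have "negligible ({x\<in>{a<..<b}. \<not> Q x} \<union> {a,b})" by (simp add: negligible_Un)
    then show "negligible {x\<in>{a..b}. \<not> Q x}"
      by (rule negligible_subset) auto
  qed (rule negligible_subset, auto)
  then show ?thesis by (simp add: AE_lebesgue_on_iff_negligible)
qed

lemma borel_measurable_lebesgue_on_spike:
  fixes f g :: "real \<Rightarrow> 'a::euclidean_space"
  assumes f: "f \<in> borel_measurable (lebesgue_on S)" and S: "S \<in> sets lebesgue"
    and neg: "negligible {x\<in>S. f x \<noteq> g x}"
  shows "g \<in> borel_measurable (lebesgue_on S)"
proof -
  have "(\<lambda>x. if x \<in> S then f x else 0) \<in> borel_measurable lebesgue"
    using f S by (simp add: borel_measurable_if)
  moreover have "AE x in lebesgue. (if x \<in> S then f x else 0) = (if x \<in> S then g x else 0)"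
  proof -
    have "{x\<in>S. f x \<noteq> g x} \<in> null_sets lebesgue" using neg by (simp add: negligible_iff_null_sets)
    then show ?thesis by (rule AE_I') auto
  qed
  ultimately have "(\<lambda>x. if x \<in> S then g x else 0) \<in> borel_measurable lebesgue"
    by (rule borel_measurable_AE)
  then show ?thesis using S by (simp add: borel_measurable_if)
qed

lemma borel_measurable_lebesgue_on_subset:
  fixes f :: "real \<Rightarrow> 'a::euclidean_space"
  assumes "f \<in> borel_measurable (lebesgue_on S)" "T \<subseteq> S"
  shows "f \<in> borel_measurable (lebesgue_on T)"
  by (rule measurable_restrict_mono [OF assms])

lemma borel_measurable_open_interval_iff:
  fixes f :: "real \<Rightarrow> 'a::euclidean_space"
  shows "f \<in> borel_measurable (lebesgue_on {a<..<b}) \<longleftrightarrow> f \<in> borel_measurable (lebesgue_on {a..b})"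
proof
  assume f: "f \<in> borel_measurable (lebesgue_on {a<..<b})"
  let ?g = "\<lambda>x. if x \<in> {a<..<b} then f x else 0"
  have "?g \<in> borel_measurable lebesgue"
    using f borel_measurable_if[of "{a<..<b}" f] by (auto simp del: greaterThanLessThan_iff)
  then have m: "?g \<in> borel_measurable (lebesgue_on {a..b})" by (rule measurable_restrict_space1)
  have n: "negligible {x\<in>{a..b}. ?g x \<noteq> f x}"
    by (rule negligible_subset[of "{a,b}"]) auto
  show "f \<in> borel_measurable (lebesgue_on {a..b})"
    by (rule borel_measurable_lebesgue_on_spike[OF m _ n]) simp
next
  assume "f \<in> borel_measurable (lebesgue_on {a..b})"
  then show "f \<in> borel_measurable (lebesgue_on {a<..<b})"
    by (rule borel_measurable_lebesgue_on_subset) auto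
qed

text \<open>For the nonnegative function \<open>(norm (f x))\<^sup>2\<close> gauge and Lebesgue
  integrability agree, so only the measurability of \<open>f\<close> itself has to be kept as a
  separate condition.\<close>

definition sq_integrable :: "real \<Rightarrow> real \<Rightarrow> (real \<Rightarrow> 'a::euclidean_space) \<Rightarrow> bool" where
  "sq_integrable a b f \<longleftrightarrow> f \<in> borel_measurable (lebesgue_on {a..b}) \<and>
    (\<lambda>x. (norm (f x))\<^sup>2) integrable_on {a..b}"

text \<open>The square of the L^2 norm. Working with squares lets the elementary
  \<open>norm_add_sq_le\<close> take the place of Minkowski's inequality, at the price of factors 2
  in the estimates.\<close>

definition sq_int :: "real \<Rightarrow> real \<Rightarrow> (real \<Rightarrow> 'a::euclidean_space) \<Rightarrow> real" where
  "sq_int a b f = integral {a..b} (\<lambda>x. (norm (f x))\<^sup>2)"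

lemma integrable_open_interval_iff:
  fixes f :: "real \<Rightarrow> 'a::euclidean_space"
  shows "integrable (lebesgue_on {a<..<b}) f \<longleftrightarrow> f absolutely_integrable_on {a..b}"
proof -
  have "integrable (lebesgue_on {a<..<b}) f \<longleftrightarrow> f absolutely_integrable_on {a<..<b}"
    by (simp add: integrable_restrict_space set_integrable_def)
  also have "\<dots> \<longleftrightarrow> f absolutely_integrable_on {a..b}"
    by (rule absolutely_integrable_spike_set_eq; rule negligible_subset[of "{a,b}"]; force)
  finally show ?thesis .
qed

lemma L2_space_iff: "f \<in> L2_space {a<..<b} \<longleftrightarrow> sq_integrable a b f"
proof -
  have "integrable (lebesgue_on {a<..<b}) (\<lambda>x. (norm (f x))\<^sup>2) \<longleftrightarrow> (\<lambda>x. (norm (f x))\<^sup>2) integrable_on {a..b}"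
    unfolding integrable_open_interval_iff by (rule absolutely_integrable_on_iff_nonneg) auto
  then show ?thesis
    by (simp add: L2_space_def sq_integrable_def borel_measurable_open_interval_iff)
qed

lemma L2_norm_on_eq:
  assumes "sq_integrable a b f"
  shows "L2_norm_on {a<..<b} f = sqrt (sq_int a b f)"
proof -
  let ?g = "\<lambda>x. (norm (f x))\<^sup>2"
  have "integrable (lebesgue_on {a<..<b}) ?g"
    using assms L2_space_iff[of f a b] by (auto simp: L2_space_def)
  then have "(LINT x|lebesgue_on {a<..<b}. ?g x) = integral {a<..<b} ?g"
    by (intro lebesgue_integral_eq_integral) auto
  also have "\<dots> = integral {a..b} ?g"
    by (rule integral_spike_set; rule negligible_subset[of "{a,b}"]; force)
  finally show ?thesis by (simp add: L2_norm_on_def sq_int_def)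
qed

lemma sq_integrable_spike:
  assumes "sq_integrable a b f" "negligible {x\<in>{a..b}. f x \<noteq> g x}"
  shows "sq_integrable a b g"
  unfolding sq_integrable_def
proof
  show "g \<in> borel_measurable (lebesgue_on {a..b})"
    by (rule borel_measurable_lebesgue_on_spike[OF _ _ assms(2)]) (use assms in \<open>auto simp: sq_integrable_def\<close>)
  show "(\<lambda>x. (norm (g x))\<^sup>2) integrable_on {a..b}"
    by (rule integrable_spike[of "\<lambda>x. (norm (f x))\<^sup>2", OF _ assms(2)]) (use assms in \<open>auto simp: sq_integrable_def\<close>)
qed

lemma sq_int_spike:
  assumes "negligible {x\<in>{a..b}. f x \<noteq> g x}"
  shows "sq_int a b f = sq_int a b g"
  unfolding sq_int_def by (rule integral_spike[OF assms]) auto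

lemma sq_integrable_bound:
  assumes "f \<in> borel_measurable (lebesgue_on {a..b})" "g integrable_on {a..b}"
    "\<And>x. x \<in> {a..b} \<Longrightarrow> (norm (f x))\<^sup>2 \<le> g x"
  shows "sq_integrable a b f"
  unfolding sq_integrable_def
proof
  show "(\<lambda>x. (norm (f x))\<^sup>2) integrable_on {a..b}"
    by (rule measurable_bounded_by_integrable_imp_integrable[of _ _ g]) (use assms in auto)
qed (use assms in auto)

lemma sq_integrable_const: "sq_integrable a b (\<lambda>x. c)"
  by (auto simp: sq_integrable_def)

lemma norm_add_sq_le: "(norm (x + y))\<^sup>2 \<le> 2 * (norm x)\<^sup>2 + 2 * (norm y)\<^sup>2" for x y :: "'a::real_normed_vector"
proof -
  have "(norm (x + y))\<^sup>2 \<le> (norm x + norm y)\<^sup>2" by (intro power_mono norm_triangle_ineq) auto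
  also have "\<dots> \<le> 2 * (norm x)\<^sup>2 + 2 * (norm y)\<^sup>2"
    using zero_le_power2[of "norm x - norm y"] by (simp add: power2_eq_square algebra_simps)
  finally show ?thesis .
qed

lemma sq_integrable_add:
  assumes "sq_integrable a b f" "sq_integrable a b g"
  shows "sq_integrable a b (\<lambda>x. f x + g x)"
  using assms
  by (intro sq_integrable_bound[where g="\<lambda>x. 2 * (norm (f x))\<^sup>2 + 2 * (norm (g x))\<^sup>2"])
     (auto simp: sq_integrable_def norm_add_sq_le intro!: integrable_add)

lemma sq_int_add_le:
  assumes "sq_integrable a b f" "sq_integrable a b g"
  shows "sq_int a b (\<lambda>x. f x + g x) \<le> 2 * sq_int a b f + 2 * sq_int a b g"
proof -
  have i: "(\<lambda>x. (norm (f x))\<^sup>2) integrable_on {a..b}" "(\<lambda>x. (norm (g x))\<^sup>2) integrable_on {a..b}"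
    using assms by (auto simp: sq_integrable_def)
  have "sq_int a b (\<lambda>x. f x + g x) \<le> integral {a..b} (\<lambda>x. 2 * (norm (f x))\<^sup>2 + 2 * (norm (g x))\<^sup>2)"
    unfolding sq_int_def
    using sq_integrable_add[OF assms] i
    by (intro integral_le) (auto simp: sq_integrable_def norm_add_sq_le intro!: integrable_add)
  also have "\<dots> = 2 * sq_int a b f + 2 * sq_int a b g"
    unfolding sq_int_def using i by (subst integral_add) auto
  finally show ?thesis .
qed

lemma sq_integrable_mult_bounded:
  fixes f :: "real \<Rightarrow> 'a::euclidean_space"
  assumes "sq_integrable a b f" "h \<in> borel_measurable (lebesgue_on {a..b})" "\<And>x. x\<in>{a..b} \<Longrightarrow> \<bar>h x\<bar> \<le> C"
  shows "sq_integrable a b (\<lambda>x. h x *\<^sub>R f x)"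
proof (rule sq_integrable_bound[where g="\<lambda>x. C\<^sup>2 * (norm (f x))\<^sup>2"])
  show "(norm (h x *\<^sub>R f x))\<^sup>2 \<le> C\<^sup>2 * (norm (f x))\<^sup>2" if "x\<in>{a..b}" for x
    using power_mono[OF assms(3)[OF that], of 2] by (auto simp: power_mult_distrib intro!: mult_right_mono)
qed (use assms in \<open>auto simp: sq_integrable_def intro!: integrable_on_mult_right\<close>)

lemma sq_integrable_scaleR: "sq_integrable a b f \<Longrightarrow> sq_integrable a b (\<lambda>x. c *\<^sub>R f x)"
  by (rule sq_integrable_mult_bounded[where C="\<bar>c\<bar>"]) auto

lemma sq_int_scaleR: "sq_int a b (\<lambda>x. c *\<^sub>R f x) = c\<^sup>2 * sq_int a b f"
  by (simp add: sq_int_def power_mult_distrib)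

lemma sq_integrable_uminus: "sq_integrable a b f \<Longrightarrow> sq_integrable a b (\<lambda>x. - f x)"
  using sq_integrable_scaleR[of a b f "-1"] by simp

lemma sq_integrable_diff: "sq_integrable a b f \<Longrightarrow> sq_integrable a b g \<Longrightarrow> sq_integrable a b (\<lambda>x. f x - g x)"
  using sq_integrable_add[OF _ sq_integrable_uminus, of a b f g] by simp

lemma sq_int_uminus: "sq_int a b (\<lambda>x. - f x) = sq_int a b f"
  by (simp add: sq_int_def)

lemma sq_int_diff_le:
  assumes "sq_integrable a b f" "sq_integrable a b g"
  shows "sq_int a b (\<lambda>x. f x - g x) \<le> 2 * sq_int a b f + 2 * sq_int a b g"
  using sq_int_add_le[OF assms(1) sq_integrable_uminus[OF assms(2)]] by (simp add: sq_int_uminus)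

lemma sq_int_nonneg: "0 \<le> sq_int a b f"
  proof (cases "(\<lambda>x. (norm (f x))\<^sup>2) integrable_on {a..b}")
  case True
  then show ?thesis unfolding sq_int_def by (rule integral_nonneg) auto
qed (simp add: sq_int_def not_integrable_integral)

lemma sq_integrable_sum:
  assumes "\<And>i. i \<in> I \<Longrightarrow> sq_integrable a b (f i)"
  shows "sq_integrable a b (\<lambda>x. \<Sum>i\<in>I. f i x)"
  using assms
  by (induction I rule: infinite_finite_induct) (auto simp: sq_integrable_const intro!: sq_integrable_add)

lemma sq_integrable_linear:
  assumes "sq_integrable a b f" "bounded_linear h"
  shows "sq_integrable a b (\<lambda>x. h (f x))"
proof -
  obtain C where C: "\<And>x. norm (h x) \<le> norm x * C" using bounded_linear.bounded[OF assms(2)] by auto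
  show ?thesis
  proof (rule sq_integrable_bound[where g="\<lambda>x. C\<^sup>2 * (norm (f x))\<^sup>2"])
    have "h \<in> borel_measurable borel"
      using assms(2) by (intro borel_measurable_continuous_onI linear_continuous_on)
    then show "(\<lambda>x. h (f x)) \<in> borel_measurable (lebesgue_on {a..b})"
      using assms(1) by (auto simp: sq_integrable_def)
    show "(norm (h (f x)))\<^sup>2 \<le> C\<^sup>2 * (norm (f x))\<^sup>2" for x
      using power_mono[OF C norm_ge_zero, of "f x" 2] by (simp add: power_mult_distrib mult.commute)
  qed (use assms in \<open>auto simp: sq_integrable_def intro!: integrable_on_mult_right\<close>)
qed

lemma sq_integrable_subinterval:
  assumes "sq_integrable a b f" "a \<le> c" "d \<le> b"
  shows "sq_integrable c d f"
  unfolding sq_integrable_def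
proof
  show "f \<in> borel_measurable (lebesgue_on {c..d})"
    by (rule borel_measurable_lebesgue_on_subset[of _ "{a..b}"]) (use assms in \<open>auto simp: sq_integrable_def\<close>)
  show "(\<lambda>x. (norm (f x))\<^sup>2) integrable_on {c..d}"
    by (rule integrable_on_subinterval[of _ "{a..b}"]) (use assms in \<open>auto simp: sq_integrable_def\<close>)
qed

lemma sq_int_mono_interval:
  assumes "sq_integrable a b f" "a \<le> c" "d \<le> b"
  shows "sq_int c d f \<le> sq_int a b f"
  unfolding sq_int_def using assms sq_integrable_subinterval[OF assms]
  by (intro integral_subset_le) (auto simp: sq_integrable_def)

lemma sq_integrable_continuous:
  assumes "continuous_on {a..b} f"
  shows "sq_integrable a b f"
  unfolding sq_integrable_def
  using assms by (intro conjI continuous_imp_measurable_on_sets_lebesgue integrable_continuous_interval continuous_intros) auto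

text \<open>On a bounded interval L^2 is contained in L^1, because
  \<open>r \<le> 1 + r\<^sup>2\<close>.\<close>

lemma sq_integrable_absolutely_integrable:
  assumes "sq_integrable a b f"
  shows "f absolutely_integrable_on {a..b}"
proof (rule measurable_bounded_by_integrable_imp_absolutely_integrable)
  show "norm (f x) \<le> 1 + (norm (f x))\<^sup>2" for x
    using zero_le_power2[of "norm (f x) - 1"] norm_ge_zero[of "f x"]
    unfolding power2_diff by (smt (verit) one_power2 mult_1_right)
  show "(\<lambda>x. 1 + (norm (f x))\<^sup>2) integrable_on {a..b}"
    using assms by (intro integrable_add) (auto simp: sq_integrable_def)
qed (use assms in \<open>auto simp: sq_integrable_def\<close>)

lemma sq_integrable_integrable: "sq_integrable a b f \<Longrightarrow> f integrable_on {a..b}"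
  using sq_integrable_absolutely_integrable set_lebesgue_integral_eq_integral(1) by blast

lemma sq_integrable_norm_integrable: "sq_integrable a b f \<Longrightarrow> (\<lambda>x. norm (f x)) integrable_on {a..b}"
  using sq_integrable_absolutely_integrable absolutely_integrable_on_def by blast

text \<open>Cauchy--Schwarz: integrate \<open>(norm (f x) - c)\<^sup>2 \<ge> 0\<close>, where \<open>c\<close> is the mean of
  \<open>norm (f x)\<close>.\<close>

lemma integral_norm_sq_le:
  assumes f: "sq_integrable a b f" and "a \<le> b"
  shows "(integral {a..b} (\<lambda>x. norm (f x)))\<^sup>2 \<le> (b - a) * sq_int a b f"
proof (cases "a = b")
  case False
  then have ab: "a < b" using assms by simp
  define I where "I = integral {a..b} (\<lambda>x. norm (f x))"
  define c where "c = I / (b - a)"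
  have i: "(\<lambda>x. norm (f x)) integrable_on {a..b}" "(\<lambda>x. (norm (f x))\<^sup>2) integrable_on {a..b}"
    using f sq_integrable_norm_integrable by (auto simp: sq_integrable_def)
  have "0 \<le> integral {a..b} (\<lambda>x. (norm (f x))\<^sup>2 - (2 * c) * norm (f x) + c\<^sup>2)"
  proof (rule integral_nonneg)
    show "0 \<le> (norm (f x))\<^sup>2 - (2 * c) * norm (f x) + c\<^sup>2" for x
      using zero_le_power2[of "norm (f x) - c"] by (simp add: power2_eq_square algebra_simps)
  qed (use i in \<open>auto intro!: integrable_add integrable_diff integrable_on_mult_right\<close>)
  also have "\<dots> = sq_int a b f - 2 * c * I + c\<^sup>2 * (b - a)"
    unfolding sq_int_def I_def using i ab
    by (subst integral_add integral_diff; auto intro!: integrable_diff integrable_on_mult_right)+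
  also have "\<dots> = sq_int a b f - I\<^sup>2 / (b - a)"
  proof -
    have "c * (b - a) = I" using ab by (simp add: c_def)
    then have "c\<^sup>2 * (b - a) = c * I" by (simp add: power2_eq_square)
    moreover have "I\<^sup>2 / (b - a) = c * I" by (simp add: c_def power2_eq_square)
    ultimately show ?thesis by simp
  qed
  finally show ?thesis using ab by (simp add: I_def field_simps)
qed (use assms in auto)

lemma norm_integral_sq_le:
  assumes f: "sq_integrable a b f" and "a \<le> b"
  shows "(norm (integral {a..b} f))\<^sup>2 \<le> (b - a) * sq_int a b f"
proof -
  have "norm (integral {a..b} f) \<le> integral {a..b} (\<lambda>x. norm (f x))"
    using f by (intro integral_norm_bound_integral) (auto intro: sq_integrable_integrable sq_integrable_norm_integrable)
  then show ?thesis
    using integral_norm_sq_le[OF assms] by (smt (verit) norm_ge_zero power_mono)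
qed

section \<open>Absolute continuity and indefinite integrals\<close>

text \<open>Absolute continuity speaks of divisions, a Henstock sum of tagged partial divisions.
  Forgetting the tags is harmless, and the total length is the measure of the union, hence at most
  that of any measurable \<open>T\<close> covering it.\<close>

lemma abs_continuous_on_tagged_sum:
  fixes w :: "real \<Rightarrow> 'a::euclidean_space"
  assumes ac: "\<And>D S. D division_of S \<Longrightarrow> S \<subseteq> I \<Longrightarrow> (\<Sum>k\<in>D. measure lborel k) < \<delta> \<Longrightarrow>
      (\<Sum>k\<in>D. norm (w (Sup k) - w (Inf k))) < e"
    and q: "q tagged_partial_division_of I" and T: "(\<Union>(snd ` q)) \<subseteq> T" "T \<in> lmeasurable" "measure lebesgue T < \<delta>"
  shows "(\<Sum>(x,k)\<in>q. norm (w (Sup k) - w (Inf k))) < e"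
proof -
  let ?S = "\<Union>(snd ` q)"
  have q': "q tagged_division_of ?S" by (rule tagged_partial_division_of_Union_self[OF q])
  have D: "(snd ` q) division_of ?S" by (rule division_of_tagged_division[OF q'])
  \<comment> \<open>One set may carry several tags only if it is degenerate, so the summand must
    vanish on degenerate sets. For points it does; the empty set, where \<open>Sup\<close> and
    \<open>Inf\<close> say nothing, needs the explicit 0.\<close>
  let ?h = "\<lambda>k. if k = {} then 0 else norm (w (Sup k) - w (Inf k))"
  have "(\<Sum>(x,k)\<in>q. norm (w (Sup k) - w (Inf k))) = (\<Sum>(x,k)\<in>q. ?h k)"
    using tagged_division_ofD(2)[OF q'] by (intro sum.cong) fastforce+
  also have "\<dots> = (\<Sum>k\<in>snd ` q. ?h k)"
    by (rule sum.over_tagged_division_lemma[OF q']) (auto simp: box_real cbox_interval)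
  also have "\<dots> = (\<Sum>k\<in>snd ` q. norm (w (Sup k) - w (Inf k)))"
    using division_ofD(3)[OF D] by (intro sum.cong) auto
  also have "\<dots> < e"
  proof (rule ac[OF D])
    show "?S \<subseteq> I" using q by (force simp: tagged_partial_division_of_def)
    have S: "?S \<in> lmeasurable"
      using D by (intro fmeasurable.finite_Union) (auto simp: division_of_def)
    have "(\<Sum>k\<in>snd ` q. measure lborel k) = (\<Sum>k\<in>snd ` q. integral k (\<lambda>x. 1))"
      using division_ofD(4)[OF D] by (intro sum.cong) fastforce+
    also have "\<dots> = integral ?S (\<lambda>x. 1)"
      using S D by (intro integral_combine_division_topdown[symmetric]) (auto intro: integrable_on_const)
    also have "\<dots> = measure lebesgue ?S" using S by (simp add: lmeasure_integral)
    also have "\<dots> \<le> measure lebesgue T"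
      using T S by (intro measure_mono_fmeasurable) (auto intro: fmeasurableD)
    finally show "(\<Sum>k\<in>snd ` q. measure lborel k) < \<delta>" using T by simp
  qed
  finally show ?thesis .
qed

text \<open>A Henstock argument: the gauge comes from differentiability off the exceptional set \<open>N\<close>, and
  confines intervals tagged in \<open>N\<close> to an open set of small measure, where absolute continuity applies.\<close>

theorem abs_continuous_has_integral:
  fixes w :: "real \<Rightarrow> 'a::euclidean_space"
  assumes ab: "a \<le> b" and ac: "abs_continuous_on {a..b} w" and N: "negligible N"
    and der: "\<And>x. x \<in> {a..b} - N \<Longrightarrow> (w has_vector_derivative d x) (at x)"
  shows "(d has_integral (w b - w a)) {a..b}"
proof -
  \<comment> \<open>With the value 0 on \<open>N\<close>, an interval tagged in \<open>N\<close>
    contributes only its increment of \<open>w\<close> to the error.\<close>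
  define d' where "d' x = (if x \<in> N then 0 else d x)" for x
  have "(d' has_integral (w b - w a)) {a..b}"
    unfolding has_integral_real
  proof (intro allI impI)
    fix e :: real assume e: "e > 0"
    obtain \<delta> where \<delta>: "\<delta> > 0" and acd: "\<And>D S. D division_of S \<Longrightarrow> S \<subseteq> {a..b} \<Longrightarrow> (\<Sum>k\<in>D. measure lborel k) < \<delta> \<Longrightarrow>
      (\<Sum>k\<in>D. norm (w (Sup k) - w (Inf k))) < e/2"
      using ac[unfolded abs_continuous_on_def, rule_format, of "e/2"] e by auto
    obtain T where T: "open T" "N \<subseteq> T" "T - N \<in> lmeasurable" "emeasure lebesgue (T - N) < ennreal \<delta>"
      using sets_lebesgue_outer_open[of N \<delta>] N \<delta> negligible_imp_sets by blast
    have Tm: "T \<in> lmeasurable" "measure lebesgue T < \<delta>"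
    proof -
      have TN: "T = (T - N) \<union> N" using T by auto
      show "T \<in> lmeasurable"
        by (subst TN) (intro fmeasurable.Un T negligible_imp_measurable N)
      have "measure lebesgue T = measure lebesgue (T - N)"
        using N measure_Diff_null_set[of T lebesgue N] \<open>T \<in> lmeasurable\<close> by (simp add: negligible_iff_null_sets fmeasurableD)
      also have "\<dots> < \<delta>" using T(3,4) \<delta> by (simp add: emeasure_eq_measure2 ennreal_less_iff)
      finally show "measure lebesgue T < \<delta>" .
    qed
    \<comment> \<open>The \<open>+ 1\<close> keeps the divisor positive when
      \<open>a = b\<close>.\<close>
    define e1 where "e1 = e / 2 / (b - a + 1)"
    have e1: "e1 > 0" "e1 * (b - a) < e / 2" using e ab by (auto simp: e1_def field_simps)
    have "\<exists>\<gamma>. open \<gamma> \<and> x \<in> \<gamma> \<and> (x \<in> N \<longrightarrow> \<gamma> \<subseteq> T) \<and> (x \<in> {a..b} - N \<longrightarrow>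
       (\<forall>y\<in>\<gamma>. norm (w y - w x - (y - x) *\<^sub>R d x) \<le> e1 * \<bar>y - x\<bar>))" for x
    proof (cases "x \<in> {a..b} - N")
      case True
      then obtain r where "r > 0" and r: "\<And>y. norm (y - x) < r \<Longrightarrow> norm (w y - w x - (y - x) *\<^sub>R d x) \<le> e1 * norm (y - x)"
        using der[OF True] e1 unfolding has_vector_derivative_def has_derivative_at_alt by blast
      then show ?thesis using True
        by (intro exI[of _ "ball x r"]) (auto simp: dist_norm norm_minus_commute)
    next
      case False
      show ?thesis
      proof (cases "x \<in> N")
        case True
        then show ?thesis using T by (intro exI[of _ T]) auto
      next
        case nN: False
        then show ?thesis using False by (intro exI[of _ UNIV]) auto
      qed
    qed
    then obtain \<gamma> where \<gamma>: "\<And>x. open (\<gamma> x)" "\<And>x. x \<in> \<gamma> x" "\<And>x. x \<in> N \<Longrightarrow> \<gamma> x \<subseteq> T"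
      "\<And>x y. x \<in> {a..b} - N \<Longrightarrow> y \<in> \<gamma> x \<Longrightarrow> norm (w y - w x - (y - x) *\<^sub>R d x) \<le> e1 * \<bar>y - x\<bar>"
      by metis
    show "\<exists>\<gamma>. gauge \<gamma> \<and> (\<forall>\<D>. \<D> tagged_division_of {a..b} \<and> \<gamma> fine \<D> \<longrightarrow>
        norm ((\<Sum>(x, k)\<in>\<D>. measure lborel k *\<^sub>R d' x) - (w b - w a)) < e)"
    proof (intro exI[of _ \<gamma>] conjI allI impI)
      show "gauge \<gamma>" using \<gamma> by (simp add: gauge_def)
      fix p assume "p tagged_division_of {a..b} \<and> \<gamma> fine p"
      then have p: "p tagged_division_of {a..b}" and fine: "\<gamma> fine p" by auto
      have fin: "finite p" using p by blast
      define q where "q = {(x,k)\<in>p. x \<in> N}"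
      have qp: "q \<subseteq> p" by (auto simp: q_def)
      let ?h = "\<lambda>(x,k). measure lborel k *\<^sub>R d' x - (w (Sup k) - w (Inf k))"
      have "(\<Sum>(x, k)\<in>p. measure lborel k *\<^sub>R d' x) - (w b - w a) = (\<Sum>z\<in>p. ?h z)"
        using additive_tagged_division_1[OF ab p, of w] by (simp add: sum_subtractf split_def)
      also have "\<dots> = (\<Sum>z\<in>q. ?h z) + (\<Sum>z\<in>p - q. ?h z)"
        using sum.subset_diff[OF qp fin, of ?h] by simp
      also have "norm \<dots> < e / 2 + e / 2"
      proof (rule norm_add_less)
        have "norm (\<Sum>z\<in>q. ?h z) \<le> (\<Sum>z\<in>q. norm (?h z))" by (rule norm_sum)
        also have "\<dots> = (\<Sum>(x,k)\<in>q. norm (w (Sup k) - w (Inf k)))"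
          by (rule sum.cong) (auto simp: q_def d'_def norm_minus_commute)
        also have "\<dots> < e / 2"
        proof (rule abs_continuous_on_tagged_sum[OF acd _ _ Tm])
          show "q tagged_partial_division_of {a..b}"
            using p qp by (meson tagged_division_of_def tagged_partial_division_subset)
          show "\<Union>(snd ` q) \<subseteq> T" using fine \<gamma>(3) by (force simp: q_def fine_def)
        qed
        finally show "norm (\<Sum>z\<in>q. ?h z) < e / 2" .
        have "norm (\<Sum>z\<in>p - q. ?h z) \<le> (\<Sum>z\<in>p - q. norm (?h z))" by (rule norm_sum)
        also have "\<dots> \<le> (\<Sum>z\<in>p - q. e1 * measure lborel (snd z))"
        proof (rule sum_mono)
          fix z assume z: "z \<in> p - q"
          obtain x k where zk: "z = (x,k)" by (cases z)
          have xk: "(x,k) \<in> p" "x \<notin> N" using z zk by (auto simp: q_def)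
          obtain s t where k: "k = {s..t}" using tagged_division_ofD(4)[OF p xk(1)] by auto
          have x: "x \<in> k" "k \<subseteq> {a..b}" using tagged_division_ofD(2,3)[OF p xk(1)] by auto
          then have st: "s \<le> x" "x \<le> t" "x \<in> {a..b} - N" using k xk by auto
          have "k \<subseteq> \<gamma> x" using fine xk by (auto simp: fine_def)
          then have "s \<in> \<gamma> x" "t \<in> \<gamma> x" using st k by auto
          then have b: "norm (w t - w x - (t - x) *\<^sub>R d x) \<le> e1 * \<bar>t - x\<bar>" "norm (w s - w x - (s - x) *\<^sub>R d x) \<le> e1 * \<bar>s - x\<bar>"
            using \<gamma>(4)[OF st(3)] by blast+
          \<comment> \<open>The tag lies between the end points, so the two linearization errors are
            bounded by multiples of \<open>x - s\<close> and \<open>t - x\<close>, which add up to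
            the length of the interval.\<close>
          have "?h z = (w s - w x - (s - x) *\<^sub>R d x) - (w t - w x - (t - x) *\<^sub>R d x)"
            using st xk by (simp add: zk k d'_def algebra_simps)
          then have "norm (?h z) \<le> norm (w s - w x - (s - x) *\<^sub>R d x) + norm (w t - w x - (t - x) *\<^sub>R d x)"
            by (simp only: norm_triangle_ineq4)
          also have "\<dots> \<le> e1 * \<bar>s - x\<bar> + e1 * \<bar>t - x\<bar>" using b by simp
          also have "\<dots> = e1 * measure lborel (snd z)" using st by (simp add: zk k algebra_simps)
          finally show "norm (?h z) \<le> e1 * measure lborel (snd z)" .
        qed
        also have "\<dots> \<le> (\<Sum>z\<in>p. e1 * measure lborel (snd z))"
          using fin e1 by (intro sum_mono2) auto
        also have "\<dots> = e1 * (b - a)"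
          using additive_content_tagged_division[of p a b] p ab by (simp add: sum_distrib_left[symmetric] split_def)
        also have "\<dots> < e / 2" by (rule e1)
        finally show "norm (\<Sum>z\<in>p - q. ?h z) < e / 2" .
      qed
      finally show "norm ((\<Sum>(x, k)\<in>p. measure lborel k *\<^sub>R d' x) - (w b - w a)) < e" by simp
    qed
  qed
  then show ?thesis
    by (rule has_integral_spike[OF N, rotated]) (auto simp: d'_def)
qed

lemma negligible_Lipschitz_image:
  fixes \<phi> :: "real \<Rightarrow> real"
  assumes "negligible N" "\<And>x y. x \<in> N \<Longrightarrow> y \<in> N \<Longrightarrow> \<bar>\<phi> x - \<phi> y\<bar> \<le> C * \<bar>x - y\<bar>"
  shows "negligible (\<phi> ` N)"
proof (rule negligible_locally_Lipschitz_image[OF _ assms(1)])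
  show "\<exists>T B. open T \<and> x \<in> T \<and> (\<forall>y\<in>N \<inter> T. norm (\<phi> y - \<phi> x) \<le> B * norm (y - x))" if "x \<in> N" for x
    using assms(2) that by (intro exI[of _ UNIV] exI[of _ C]) auto
qed simp

text \<open>Lebesgue differentiation is available for averages over \<open>[x, x + h]\<close> with
  \<open>h > 0\<close>. Applied to the extension \<open>g\<close> of \<open>f\<close> by 0 it gives
  the right derivative, applied to the reflection of \<open>g\<close> the left one.\<close>

lemma indefinite_integral_vector_derivative_AE:
  fixes f :: "real \<Rightarrow> 'a::euclidean_space"
  assumes f: "f integrable_on {a..b}"
  obtains N where "negligible N"
    "\<And>x. x \<in> {a<..<b} - N \<Longrightarrow> ((\<lambda>x. integral {a..x} f) has_vector_derivative f x) (at x)"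
proof -
  define g where "g x = (if x \<in> {a..b} then f x else 0)" for x
  have "g integrable_on UNIV" unfolding g_def using f by (simp only: integrable_restrict_UNIV)
  then have g: "g integrable_on cbox c d" for c d by (rule integrable_on_subcbox) simp
  have g': "(\<lambda>x. g (- x)) integrable_on cbox c d" for c d
    using g[of "-d" "-c"] Henstock_Kurzweil_Integration.integrable_reflect_real[where f=g and a="-d" and b="-c"] by simp
  obtain N1 where N1: "negligible N1" "\<And>x e. \<lbrakk>x \<notin> N1; 0 < e\<rbrakk> \<Longrightarrow>
      \<exists>d>0. \<forall>h. 0 < h \<and> h < d \<longrightarrow> norm (integral (cbox x (x + h *\<^sub>R One)) g /\<^sub>R h ^ DIM(real) - g x) < e"
    using integrable_ccontinuous_explicit[of g] g by metis
  obtain N2 where N2: "negligible N2" "\<And>x e. \<lbrakk>x \<notin> N2; 0 < e\<rbrakk> \<Longrightarrow>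
      \<exists>d>0. \<forall>h. 0 < h \<and> h < d \<longrightarrow> norm (integral (cbox x (x + h *\<^sub>R One)) (\<lambda>x. g (- x)) /\<^sub>R h ^ DIM(real) - g (- x)) < e"
    using integrable_ccontinuous_explicit[of "\<lambda>x. g (- x)"] g' by metis
  show ?thesis
  proof
    show "negligible (N1 \<union> uminus ` N2)"
      using N1 negligible_Lipschitz_image[OF N2(1), of uminus 1] by (auto intro: negligible_Un)
    fix x assume x: "x \<in> {a<..<b} - (N1 \<union> uminus ` N2)"
    then have x': "x \<notin> N1" "- x \<notin> N2" by force+
    show "((\<lambda>x. integral {a..x} f) has_vector_derivative f x) (at x)"
      unfolding has_vector_derivative_def has_derivative_at_alt
    proof (intro conjI allI impI)
      fix e :: real assume "e > 0"
      obtain d1 where d1: "d1 > 0" "\<And>h. 0 < h \<Longrightarrow> h < d1 \<Longrightarrow> norm (integral {x..x+h} g /\<^sub>R h - g x) < e"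
        using N1(2)[OF x'(1) \<open>e > 0\<close>] by auto
      obtain d2 where d2: "d2 > 0" "\<And>h. 0 < h \<Longrightarrow> h < d2 \<Longrightarrow> norm (integral {-x..-x+h} (\<lambda>x. g (- x)) /\<^sub>R h - g x) < e"
        using N2(2)[OF x'(2) \<open>e > 0\<close>] by auto
      have fg: "integral {s..t} f = integral {s..t} g" if "a \<le> s" "t \<le> b" for s t
        using that by (intro integral_cong) (auto simp: g_def)
      have gx: "g x = f x" using x by (simp add: g_def)
      have *: "norm (I - h *\<^sub>R f x) \<le> e * h" if "norm (I /\<^sub>R h - g x) < e" "h > 0" for I h
      proof -
        have "I - h *\<^sub>R f x = h *\<^sub>R (I /\<^sub>R h - g x)" using that gx by (simp add: algebra_simps)
        then have "norm (I - h *\<^sub>R f x) = h * norm (I /\<^sub>R h - g x)" using that by simp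
        then show ?thesis using that by (simp add: mult.commute)
      qed
      have "norm (integral {a..y} f - integral {a..x} f - (y - x) *\<^sub>R f x) \<le> e * norm (y - x)"
        if y: "norm (y - x) < Min {d1, d2, x - a, b - x}" for y
      proof -
        consider "y = x" | "y > x" | "y < x" by linarith
        then show ?thesis
        proof cases
          case 2
          have "integral {a..x} f + integral {x..y} f = integral {a..y} f"
            using 2 y x by (intro Henstock_Kurzweil_Integration.integral_combine integrable_on_subinterval[OF f]) auto
          then have "integral {a..y} f - integral {a..x} f = integral {x..y} g"
            using fg[of x y] x y 2 by (simp add: algebra_simps)
          then show ?thesis using *[OF d1(2)[of "y - x"]] 2 y by simp
        next
          case 3
          have "integral {a..y} f + integral {y..x} f = integral {a..x} f"
            using 3 y x by (intro Henstock_Kurzweil_Integration.integral_combine integrable_on_subinterval[OF f]) auto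
          then have "integral {a..x} f - integral {a..y} f = integral {y..x} g"
            using fg[of y x] x y 3 by (simp add: algebra_simps)
          also have "\<dots> = integral {-x..-x+(x-y)} (\<lambda>x. g (- x))"
            using Henstock_Kurzweil_Integration.integral_reflect_real[where f=g and a=y and b=x] by simp
          finally have "norm (integral {a..x} f - integral {a..y} f - (x - y) *\<^sub>R f x) \<le> e * (x - y)"
            using *[OF d2(2)[of "x - y"]] 3 y by simp
          moreover have "integral {a..y} f - integral {a..x} f - (y - x) *\<^sub>R f x = - (integral {a..x} f - integral {a..y} f - (x - y) *\<^sub>R f x)"
            by (simp add: algebra_simps)
          ultimately have "norm (integral {a..y} f - integral {a..x} f - (y - x) *\<^sub>R f x) \<le> e * (x - y)"
            by (simp only: norm_minus_cancel)
          then show ?thesis using 3 by simp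
        qed simp
      qed
      then show "\<exists>d>0. \<forall>y. norm (y - x) < d \<longrightarrow>
          norm (integral {a..y} f - integral {a..x} f - (y - x) *\<^sub>R f x) \<le> e * norm (y - x)"
        using x d1(1) d2(1) by (intro exI[of _ "Min {d1, d2, x - a, b - x}"]) auto
    qed (simp add: bounded_linear_scaleR_left)
  qed
qed

text \<open>Both functions are almost everywhere the derivative of one and the same primitive. This
  is how identities between integrals are turned back into almost everywhere identities for
  \<open>z\<close> and for the boundary relation.\<close>

lemma negligible_neq_if_integral_eq:
  fixes f g :: "real \<Rightarrow> 'a::euclidean_space"
  assumes f: "f integrable_on {a..b}" and g: "g integrable_on {a..b}"
    and eq: "\<And>x. x \<in> {a..b} \<Longrightarrow> integral {a..x} f = integral {a..x} g"
  shows "negligible {x\<in>{a..b}. f x \<noteq> g x}"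
proof -
  obtain N where N: "negligible N"
    "\<And>x. x \<in> {a<..<b} - N \<Longrightarrow> ((\<lambda>x. integral {a..x} f) has_vector_derivative f x) (at x)"
    using indefinite_integral_vector_derivative_AE[OF f] by metis
  obtain N' where N': "negligible N'"
    "\<And>x. x \<in> {a<..<b} - N' \<Longrightarrow> ((\<lambda>x. integral {a..x} g) has_vector_derivative g x) (at x)"
    using indefinite_integral_vector_derivative_AE[OF g] by metis
  have "f x = g x" if x: "x \<in> {a<..<b} - (N \<union> N')" for x
  proof -
    have "((\<lambda>x. integral {a..x} g) has_vector_derivative f x) (at x)"
      by (rule has_vector_derivative_transform_within_open[OF N(2), of x "{a<..<b}"]) (use x eq in auto)
    then show ?thesis using N'(2)[of x] x vector_derivative_unique_at by blast
  qed
  then have "{x\<in>{a..b}. f x \<noteq> g x} \<subseteq> N \<union> N' \<union> {a,b}" by force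
  moreover have "negligible (N \<union> N' \<union> {a,b})" using N N' by (intro negligible_Un) auto
  ultimately show ?thesis using negligible_subset by blast
qed

text \<open>Young's inequality bounds \<open>norm (d x)\<close> by
  \<open>c + (norm (d x))\<^sup>2 / c\<close>. Summed over a division, the first term is controlled
  by the total length, the second by \<open>sq_int a b d\<close> whatever the division is.\<close>

lemma abs_continuous_on_indefinite_integral:
  fixes w :: "real \<Rightarrow> 'a::euclidean_space"
  assumes d: "sq_integrable a b d" and w: "\<And>x. x \<in> {a..b} \<Longrightarrow> w x = w0 + integral {a..x} d"
  shows "abs_continuous_on {a..b} w"
  unfolding abs_continuous_on_def
proof (intro allI impI)
  fix e :: real assume e: "e > 0"
  \<comment> \<open>Large enough for the quadratic term to contribute at most \<open>e / 2\<close>;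
    the \<open>+ 1\<close> keeps \<open>c\<close> positive when \<open>d\<close> vanishes. The
    choice of \<open>\<delta>\<close> then makes the linear term smaller than
    \<open>e / 2\<close>.\<close>
  define c where "c = 2 * (sq_int a b d + 1) / e"
  have c: "c > 0" using sq_int_nonneg[of a b d] e by (simp add: c_def add_nonneg_pos)
  have young: "norm v \<le> c + (norm v)\<^sup>2 / c" for v :: 'a
  proof (cases "norm v \<le> c")
    case False
    then have "norm v * c \<le> norm v * norm v" by (intro mult_left_mono) auto
    then have "norm v \<le> (norm v)\<^sup>2 / c" using c by (simp add: field_simps power2_eq_square)
    then show ?thesis using c by simp
  qed (use c in \<open>simp add: add_increasing2\<close>)
  show "\<exists>\<delta>>0. \<forall>D S. D division_of S \<longrightarrow> S \<subseteq> {a..b} \<longrightarrow> (\<Sum>k\<in>D. measure lborel k) < \<delta> \<longrightarrow>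
      (\<Sum>k\<in>D. norm (w (Sup k) - w (Inf k))) < e"
  proof (intro exI[of _ "e / 2 / c"] conjI allI impI)
    fix D S assume D: "D division_of S" and S: "S \<subseteq> {a..b}" and le: "(\<Sum>k\<in>D. measure lborel k) < e / 2 / c"
    have i2: "(\<lambda>x. (norm (d x))\<^sup>2) integrable_on {a..b}" using d by (simp add: sq_integrable_def)
    have "norm (w (Sup k) - w (Inf k)) \<le> c * measure lborel k + integral k (\<lambda>x. (norm (d x))\<^sup>2) / c" if k: "k \<in> D" for k
    proof -
      obtain s t where st: "k = {s..t}" using division_ofD(4)[OF D k] by auto
      have "k \<noteq> {}" "k \<subseteq> {a..b}" using division_ofD(2,3)[OF D k] S by auto
      then have st': "s \<le> t" "a \<le> s" "t \<le> b" using st by auto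
      have sub: "{s..t} \<subseteq> {a..b}" using st' by auto
      have "integral {a..s} d + integral {s..t} d = integral {a..t} d"
        using st' by (intro Henstock_Kurzweil_Integration.integral_combine integrable_on_subinterval[OF sq_integrable_integrable[OF d]]) auto
      then have "w (Sup k) - w (Inf k) = integral {s..t} d"
        using st' by (simp add: st w algebra_simps)
      also have "norm \<dots> \<le> integral {s..t} (\<lambda>x. c + (norm (d x))\<^sup>2 / c)"
        using young sub
        by (intro integral_norm_bound_integral integrable_add integrable_on_subinterval[OF sq_integrable_integrable[OF d]]
           integrable_on_divide integrable_on_subinterval[OF i2] ) auto
      also have "\<dots> = c * (t - s) + integral {s..t} (\<lambda>x. (norm (d x))\<^sup>2) / c"
        using st' integrable_on_subinterval[OF i2 sub]
          by (subst integral_add) (auto intro: integrable_on_divide)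
      finally show ?thesis using st' by (simp add: st)
    qed
    then have "(\<Sum>k\<in>D. norm (w (Sup k) - w (Inf k))) \<le> (\<Sum>k\<in>D. c * measure lborel k + integral k (\<lambda>x. (norm (d x))\<^sup>2) / c)"
      by (rule sum_mono)
    also have "\<dots> = c * (\<Sum>k\<in>D. measure lborel k) + (\<Sum>k\<in>D. integral k (\<lambda>x. (norm (d x))\<^sup>2)) / c"
      by (simp add: sum.distrib sum_distrib_left sum_divide_distrib)
    also have "(\<Sum>k\<in>D. integral k (\<lambda>x. (norm (d x))\<^sup>2)) = integral S (\<lambda>x. (norm (d x))\<^sup>2)"
      using integrable_on_subdivision[OF D i2 S] D by (intro integral_combine_division_topdown[symmetric])
    also have "\<dots> \<le> sq_int a b d"
      unfolding sq_int_def using integrable_on_subdivision[OF D i2 S] i2 S by (intro integral_subset_le) auto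
    also have "c * (\<Sum>k\<in>D. measure lborel k) + sq_int a b d / c < e / 2 + e / 2"
    proof (rule add_less_le_mono)
      show "c * (\<Sum>k\<in>D. measure lborel k) < e / 2" using le c by (simp add: field_simps)
      have "sq_int a b d + 1 > 0" using sq_int_nonneg[of a b d] by simp
      then show "sq_int a b d / c \<le> e / 2"
        using sq_int_nonneg[of a b d] e by (simp add: c_def field_simps)
    qed
    finally show "(\<Sum>k\<in>D. norm (w (Sup k) - w (Inf k))) < e" using c by (simp add: divide_right_mono)
  qed (use e c in auto)
qed

text \<open>The fundamental theorem for absolutely continuous functions in one direction, Lebesgue
  differentiation in the other. Membership in H^1 is used below only through this integral
  formula.\<close>

lemma H1_with_derivative_iff:
  "H1_with_derivative w d \<longleftrightarrow> sq_integrable 0 1 d \<and> (\<forall>x\<in>{0..1}. w x = w 0 + integral {0..x} d)"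
proof
  assume "H1_with_derivative w d"
  then have ac: "abs_continuous_on {0..1} w" and d: "sq_integrable 0 1 d"
    and N: "negligible {x\<in>{0..1}. \<not> (w has_vector_derivative d x) (at x)}" (is "negligible ?N")
    by (auto simp: H1_with_derivative_def L2_space_iff AE_open_interval_iff)
  have "w x = w 0 + integral {0..x} d" if x: "x \<in> {0..1}" for x
  proof -
    have sub: "S \<subseteq> {0..1}" if "S \<subseteq> {0..x}" for S using that x by force
    have "abs_continuous_on {0..x} w" using ac sub unfolding abs_continuous_on_def by meson
    then have "(d has_integral (w x - w 0)) {0..x}"
      using x by (intro abs_continuous_has_integral[OF _ _ N]) auto
    then show ?thesis by (simp add: integral_unique)
  qed
  with d show "sq_integrable 0 1 d \<and> (\<forall>x\<in>{0..1}. w x = w 0 + integral {0..x} d)" by blast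
next
  assume *: "sq_integrable 0 1 d \<and> (\<forall>x\<in>{0..1}. w x = w 0 + integral {0..x} d)"
  then have d: "sq_integrable 0 1 d" by blast
  have eq: "w 0 + integral {0..y} d = w y" if "y \<in> {0..1}" for y
    using bspec[OF conjunct2[OF *] that] by (rule sym)
  obtain N where N: "negligible N"
    "\<And>x. x \<in> {0<..<1} - N \<Longrightarrow> ((\<lambda>x. integral {0..x} d) has_vector_derivative d x) (at x)"
    using indefinite_integral_vector_derivative_AE[OF sq_integrable_integrable[OF d]] by metis
  have wd: "(w has_vector_derivative d x) (at x)" if x: "x \<in> {0<..<1} - N" for x
  proof -
    have "((\<lambda>x. w 0 + integral {0..x} d) has_vector_derivative d x) (at x)"
      using has_vector_derivative_add[OF has_vector_derivative_const N(2)[OF x], of "w 0"] by simp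
    then show ?thesis
      by (rule has_vector_derivative_transform_within_open[of _ _ _ "{0<..<1}"]) (use x eq in auto)
  qed
  have "x \<in> N \<union> {0,1}" if "x \<in> {x\<in>{0..1}. \<not> (w has_vector_derivative d x) (at x)}" for x
    using wd[of x] that by (cases "x = 0 \<or> x = 1") auto
  then have "{x\<in>{0..1}. \<not> (w has_vector_derivative d x) (at x)} \<subseteq> N \<union> {0,1}" by blast
  moreover have "negligible (N \<union> {0,1})" using N(1) by (intro negligible_Un) auto
  ultimately have "negligible {x\<in>{0..1}. \<not> (w has_vector_derivative d x) (at x)}"
    using negligible_subset by blast
  then show "H1_with_derivative w d"
    using d abs_continuous_on_indefinite_integral[OF d eq[symmetric]]
    by (simp add: H1_with_derivative_def L2_space_iff AE_open_interval_iff)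
qed

section \<open>Density of continuous functions in L^2\<close>

definition trunc :: "real \<Rightarrow> 'a::euclidean_space \<Rightarrow> 'a" where
  "trunc R v = (R / max R (norm v)) *\<^sub>R v"

lemma trunc_eq: "0 < R \<Longrightarrow> norm v \<le> R \<Longrightarrow> trunc R v = v"
  by (simp add: trunc_def max_def)

lemma norm_trunc_le: "0 < R \<Longrightarrow> norm (trunc R v) \<le> R"
  by (auto simp: trunc_def max_def)

lemma norm_trunc_diff_le: "0 < R \<Longrightarrow> norm (v - trunc R v) \<le> norm v"
proof -
  assume R: "0 < R"
  have "v - trunc R v = (1 - R / max R (norm v)) *\<^sub>R v" by (simp add: trunc_def algebra_simps)
  also have "norm \<dots> = \<bar>1 - R / max R (norm v)\<bar> * norm v" by simp
  also have "\<dots> \<le> 1 * norm v"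
    using R by (intro mult_right_mono) (auto simp: abs_le_iff max_def divide_le_eq)
  finally show ?thesis by simp
qed

lemma continuous_on_trunc: "0 < R \<Longrightarrow> continuous_on S f \<Longrightarrow> continuous_on S (\<lambda>x. trunc R (f x))"
  unfolding trunc_def by (intro continuous_intros) auto

lemma sq_integrable_trunc:
  assumes "sq_integrable a b f" "0 < R"
  shows "sq_integrable a b (\<lambda>x. trunc R (f x))"
proof (rule sq_integrable_bound[where g="\<lambda>x. R\<^sup>2"])
  have "trunc R \<in> borel_measurable (borel :: 'a measure)"
    using continuous_on_trunc[OF assms(2), of UNIV "\<lambda>x. x"] by (intro borel_measurable_continuous_onI) auto
  then show "(\<lambda>x. trunc R (f x)) \<in> borel_measurable (lebesgue_on {a..b})"
    using assms by (auto simp: sq_integrable_def)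
  show "(norm (trunc R (f x)))\<^sup>2 \<le> R\<^sup>2" for x
    by (intro power_mono norm_trunc_le assms) auto
qed auto

text \<open>Measurability provides continuous functions converging to \<open>f\<close> almost
  everywhere, but without any bound. Truncating \<open>f\<close> costs little in L^2, and the same
  truncation, being continuous, preserves the continuity of the approximants and bounds them by
  \<open>R\<close>, so dominated convergence applies twice.\<close>

theorem sq_integrable_approximate_continuous:
  fixes f :: "real \<Rightarrow> 'a::euclidean_space"
  assumes f: "sq_integrable a b f" and e: "e > 0"
  obtains g where "continuous_on UNIV g" "sq_int a b (\<lambda>x. f x - g x) < e"
proof -
  have f2: "(\<lambda>x. (norm (f x))\<^sup>2) integrable_on {a..b}" using f by (simp add: sq_integrable_def)
  have "(\<lambda>n. sq_int a b (\<lambda>x. f x - trunc (real (Suc n)) (f x))) \<longlonglongrightarrow> integral {a..b} (\<lambda>x. 0)"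
    unfolding sq_int_def
  proof (rule dominated_convergence(2)[OF _ f2])
    show "(\<lambda>x. (norm (f x - trunc (real (Suc n)) (f x)))\<^sup>2) integrable_on {a..b}" for n
      using sq_integrable_diff[OF f sq_integrable_trunc[OF f, of "real (Suc n)"]] by (simp add: sq_integrable_def)
    show "norm ((norm (f x - trunc (real (Suc n)) (f x)))\<^sup>2) \<le> (norm (f x))\<^sup>2" for n x
      using norm_trunc_diff_le[of "real (Suc n)" "f x"] by (auto intro: power_mono)
    show "(\<lambda>n. (norm (f x - trunc (real (Suc n)) (f x)))\<^sup>2) \<longlonglongrightarrow> 0" for x
    proof (rule tendsto_eventually)
      obtain m where m: "norm (f x) \<le> real m" using real_arch_simple by blast
      show "\<forall>\<^sub>F n in sequentially. (norm (f x - trunc (real (Suc n)) (f x)))\<^sup>2 = 0"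
        unfolding eventually_sequentially using m by (intro exI[of _ m]) (auto simp: trunc_eq)
    qed
  qed
  then have "\<forall>\<^sub>F n in sequentially. sq_int a b (\<lambda>x. f x - trunc (real (Suc n)) (f x)) < e / 4"
    using e by (intro order_tendstoD(2)[where y=0]) auto
  then obtain n where n: "sq_int a b (\<lambda>x. f x - trunc (real (Suc n)) (f x)) < e / 4"
    using eventually_happens trivial_limit_sequentially by blast
  define R where "R = real (Suc n)"
  have R: "R > 0" by (simp add: R_def)
  have "(\<lambda>x. if x \<in> {a..b} then f x else 0) \<in> borel_measurable lebesgue"
    using f borel_measurable_if[of "{a..b}" f] by (auto simp: sq_integrable_def simp del: atLeastAtMost_iff)
  then have "(\<lambda>x. if x \<in> {a..b} then f x else 0) measurable_on UNIV"
    by (rule lebesgue_measurable_imp_measurable_on) simp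
  from this[unfolded measurable_on_def] obtain N g where
    Ng: "negligible N \<and> (\<forall>n. continuous_on UNIV (g n)) \<and>
      (\<forall>x. x \<notin> N \<longrightarrow> (\<lambda>n. g n x) \<longlonglongrightarrow> (if x \<in> UNIV then if x \<in> {a..b} then f x else 0 else 0))"
    by (elim exE)
  then have N: "negligible N" and g: "\<And>m. continuous_on UNIV (g m)"
    and lim: "\<And>x. x \<notin> N \<Longrightarrow> (\<lambda>m. g m x) \<longlonglongrightarrow> (if x \<in> {a..b} then f x else 0)"
    by simp_all
  let ?h = "\<lambda>m x. trunc R (f x) - trunc R (g m x)"
  have cont: "continuous_on UNIV (trunc R :: 'a \<Rightarrow> 'a)"
    using continuous_on_trunc[OF R, of UNIV "\<lambda>x. x"] by simp
  have h: "sq_integrable a b (?h m)" for m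
    using continuous_on_trunc[OF R g[of m]]
    by (intro sq_integrable_diff sq_integrable_trunc f R sq_integrable_continuous) (auto intro: continuous_on_subset)
  have "(\<lambda>m. integral {a..b} (\<lambda>x. if x \<in> N then 0 else (norm (?h m x))\<^sup>2)) \<longlonglongrightarrow> integral {a..b} (\<lambda>x. 0)"
  proof (rule dominated_convergence(2))
    show "(\<lambda>x. if x \<in> N then 0 else (norm (?h m x))\<^sup>2) integrable_on {a..b}" for m
      by (rule integrable_spike[OF _ N, of "\<lambda>x. (norm (?h m x))\<^sup>2"]) (use h[of m] in \<open>auto simp: sq_integrable_def\<close>)
    show "(\<lambda>x. (2 * R)\<^sup>2) integrable_on {a..b}" by auto
    show "norm (if x \<in> N then 0 else (norm (?h m x))\<^sup>2) \<le> (2 * R)\<^sup>2" for m x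
    proof -
      have "norm (?h m x) \<le> 2 * R"
        using norm_triangle_ineq4[of "trunc R (f x)" "trunc R (g m x)"] norm_trunc_le[OF R, of "f x"] norm_trunc_le[OF R, of "g m x"]
        by linarith
      then have "(norm (?h m x))\<^sup>2 \<le> (2 * R)\<^sup>2" by (rule power_mono) simp
      then show ?thesis by simp
    qed
    show "(\<lambda>m. if x \<in> N then 0 else (norm (?h m x))\<^sup>2) \<longlonglongrightarrow> 0" if "x \<in> {a..b}" for x
    proof (cases "x \<in> N")
      case False
      have "(\<lambda>m. trunc R (g m x)) \<longlonglongrightarrow> trunc R (f x)"
        using continuous_on_tendsto_compose[OF cont lim[OF False]] that by simp
      then have "(\<lambda>m. (norm (?h m x))\<^sup>2) \<longlonglongrightarrow> (norm (trunc R (f x) - trunc R (f x)))\<^sup>2"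
        by (intro tendsto_intros)
      then show ?thesis using False by simp
    qed simp
  qed
  moreover have "integral {a..b} (\<lambda>x. if x \<in> N then 0 else (norm (?h m x))\<^sup>2) = sq_int a b (?h m)" for m
    unfolding sq_int_def by (rule integral_spike[OF N]) auto
  ultimately have "\<forall>\<^sub>F m in sequentially. sq_int a b (?h m) < e / 4"
    using e by (intro order_tendstoD(2)[where y=0]) auto
  then obtain m where m: "sq_int a b (?h m) < e / 4"
    using eventually_happens trivial_limit_sequentially by blast
  show ?thesis
  proof
    show "continuous_on UNIV (\<lambda>x. trunc R (g m x))" by (rule continuous_on_trunc[OF R g])
    have "sq_int a b (\<lambda>x. f x - trunc R (g m x)) = sq_int a b (\<lambda>x. (f x - trunc R (f x)) + ?h m x)" by simp
    also have "\<dots> \<le> 2 * sq_int a b (\<lambda>x. f x - trunc R (f x)) + 2 * sq_int a b (?h m)"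
      by (intro sq_int_add_le h sq_integrable_diff sq_integrable_trunc f R)
    also have "\<dots> < e" using m n by (simp add: R_def)
    finally show "sq_int a b (\<lambda>x. f x - trunc R (g m x)) < e" .
  qed
qed

section \<open>The travel-time coordinate\<close>

text \<open>An expansive map is injective with Lipschitz inverse, and Lipschitz images of null sets
  are null.\<close>

lemma negligible_expansive_preimage:
  fixes \<phi> :: "real \<Rightarrow> real"
  assumes "negligible N" and ex: "\<And>x y. x \<in> S \<Longrightarrow> y \<in> S \<Longrightarrow> \<bar>x - y\<bar> \<le> C * \<bar>\<phi> x - \<phi> y\<bar>"
  shows "negligible {x\<in>S. \<phi> x \<in> N}"
proof -
  have inj: "inj_on \<phi> S" using ex by (fastforce intro: inj_onI)
  have "negligible (inv_into S \<phi> ` (N \<inter> \<phi> ` S))"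
  proof (rule negligible_Lipschitz_image[where C=C])
    show "negligible (N \<inter> \<phi> ` S)" using assms(1) by (rule negligible_subset) auto
    show "\<bar>inv_into S \<phi> x - inv_into S \<phi> y\<bar> \<le> C * \<bar>x - y\<bar>" if "x \<in> N \<inter> \<phi> ` S" "y \<in> N \<inter> \<phi> ` S" for x y
      using that inj by (auto simp: ex)
  qed
  then show ?thesis
  proof (rule negligible_subset)
    show "{x\<in>S. \<phi> x \<in> N} \<subseteq> inv_into S \<phi> ` (N \<inter> \<phi> ` S)"
    proof
      fix x assume "x \<in> {x\<in>S. \<phi> x \<in> N}"
      then show "x \<in> inv_into S \<phi> ` (N \<inter> \<phi> ` S)"
        using inj by (intro image_eqI[of _ _ "\<phi> x"]) auto
    qed
  qed
qed

text \<open>A continuous map pulls back Borel sets to Borel sets, but in general not Lebesgue sets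
  to Lebesgue sets. A Lebesgue set is a Borel set up to a null set, and expansiveness makes the
  preimage of that null set null.\<close>

lemma borel_measurable_expansive_compose:
  fixes \<phi> :: "real \<Rightarrow> real" and f :: "real \<Rightarrow> 'a::euclidean_space"
  assumes f: "f \<in> borel_measurable (lebesgue_on {a..b})"
    and \<phi>: "continuous_on {c..d} \<phi>" "\<phi> ` {c..d} \<subseteq> {a..b}"
    and ex: "\<And>x y. x \<in> {c..d} \<Longrightarrow> y \<in> {c..d} \<Longrightarrow> \<bar>x - y\<bar> \<le> C * \<bar>\<phi> x - \<phi> y\<bar>"
  shows "(\<lambda>x. f (\<phi> x)) \<in> borel_measurable (lebesgue_on {c..d})"
proof -
  have pre: "{x\<in>{c..d}. \<phi> x \<in> A} \<in> sets lebesgue" if A': "A \<in> sets lebesgue" for A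
  proof -
    obtain S N N' where A: "A = S \<union> N" "N \<subseteq> N'" "N' \<in> null_sets lborel" "S \<in> sets lborel"
      using sets_completionE[OF A'] by blast
    have "negligible N"
      using A by (meson negligible_iff_null_sets negligible_subset null_sets_completionI)
    then have "negligible {x\<in>{c..d}. \<phi> x \<in> N}"
      using ex by (rule negligible_expansive_preimage)
    moreover have "{x\<in>{c..d}. \<phi> x \<in> S} \<in> sets lebesgue"
    proof -
      have "\<phi> \<in> borel_measurable (restrict_space borel {c..d})"
        by (rule borel_measurable_continuous_on_restrict[OF \<phi>(1)])
      from measurable_sets[OF this, of S] A(4)
      have "\<phi> -` S \<inter> {c..d} \<in> sets (restrict_space borel {c..d})" by (simp add: space_restrict_space)
      then have "\<phi> -` S \<inter> {c..d} \<in> sets borel" by (simp add: sets_restrict_space_iff)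
      moreover have "{x\<in>{c..d}. \<phi> x \<in> S} = \<phi> -` S \<inter> {c..d}" by auto
      ultimately show ?thesis by simp
    qed
    moreover have "{x\<in>{c..d}. \<phi> x \<in> A} = {x\<in>{c..d}. \<phi> x \<in> S} \<union> {x\<in>{c..d}. \<phi> x \<in> N}" using A by auto
    ultimately show ?thesis by (simp only: sets.Un negligible_imp_sets)
  qed
  have "\<phi> \<in> measurable (lebesgue_on {c..d}) (lebesgue_on {a..b})"
  proof (rule measurableI)
    fix A assume "A \<in> sets (lebesgue_on {a..b})"
    then have "A \<in> sets lebesgue" by (simp add: sets_restrict_space_iff)
    moreover have "\<phi> -` A \<inter> space (lebesgue_on {c..d}) = {x\<in>{c..d}. \<phi> x \<in> A} \<inter> {c..d}" by auto
    ultimately show "\<phi> -` A \<inter> space (lebesgue_on {c..d}) \<in> sets (lebesgue_on {c..d})"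
      using pre[of A] by (auto simp: sets_restrict_space_iff Int_def conj_ac)
  qed (use \<phi>(2) in \<open>simp add: image_subset_iff del: atLeastAtMost_iff\<close>)
  then show ?thesis using f by (rule measurable_compose)
qed

lemma has_integral_affine:
  fixes h :: "real \<Rightarrow> 'a::euclidean_space"
  assumes "h integrable_on {m * a + s..m * b + s}" "m > 0"
  shows "((\<lambda>x. h (m * x + s)) has_integral (integral {m * a + s..m * b + s} h /\<^sub>R m)) {a..b}"
  using has_integral_affinity'[of h "integral {m * a + s..m * b + s} h" "m * a + s" "m * b + s" m s] assms
  by (auto simp: integrable_integral field_simps)

lemma sq_integrable_affine:
  fixes h :: "real \<Rightarrow> 'a::euclidean_space"
  assumes h: "sq_integrable (m * a + s) (m * b + s) h" and m: "m > 0"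
  shows "sq_integrable a b (\<lambda>x. h (m * x + s))"
  unfolding sq_integrable_def
proof
  show "(\<lambda>x. h (m * x + s)) \<in> borel_measurable (lebesgue_on {a..b})"
  proof (rule borel_measurable_expansive_compose[where C = "1/m"])
    show "h \<in> borel_measurable (lebesgue_on {m * a + s..m * b + s})" using h by (simp add: sq_integrable_def)
    show "\<bar>x - y\<bar> \<le> 1 / m * \<bar>m * x + s - (m * y + s)\<bar>" for x y
    proof -
      have "m * x + s - (m * y + s) = m * (x - y)" by (simp add: algebra_simps)
      then show ?thesis using m by (simp add: abs_mult)
    qed
  qed (use m in \<open>auto intro!: continuous_intros\<close>)
  show "(\<lambda>x. (norm (h (m * x + s)))\<^sup>2) integrable_on {a..b}"
    using has_integral_affine[of "\<lambda>x. (norm (h x))\<^sup>2" m a s b] h m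
    by (auto simp: sq_integrable_def integrable_on_def)
qed

lemma sq_int_shift:
  assumes "sq_integrable (a + s) (b + s) h"
  shows "sq_int a b (\<lambda>x. h (x + s)) = sq_int (a + s) (b + s) h"
  using has_integral_affine[of "\<lambda>x. (norm (h x))\<^sup>2" 1 a s b] assms
  by (auto simp: sq_integrable_def sq_int_def integral_unique)

lemma sq_integrable_shift:
  assumes "sq_integrable (a + s) (b + s) h"
  shows "sq_integrable a b (\<lambda>x. h (x + s))"
  using sq_integrable_affine[of 1 a s b h] assms by simp

text \<open>The two essential bounds make \<open>k\<close> bi-Lipschitz: the lower one makes it
  Lipschitz, the upper one expansive. Hence null sets and measurability pass through
  \<open>k\<close> and \<open>k_inv\<close> in both directions.\<close>

locale wave_speed =
  fixes lam :: "real \<Rightarrow> real" and \<epsilon> C :: real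
  assumes eps: "\<epsilon> > 0"
    and lam_measurable: "lam \<in> borel_measurable (lebesgue_on {0..1})"
    and lam_bounds: "negligible {x\<in>{0..1}. \<not> (\<epsilon> \<le> lam x \<and> lam x \<le> C)}"
begin

definition bad :: "real set" where "bad = {x\<in>{0..1}. \<not> (\<epsilon> \<le> lam x \<and> lam x \<le> C)}"

text \<open>The time a wave needs from 0 to \<open>x\<close>. On \<open>{0..1}\<close> it is the
  function \<open>p\<close> of the theorem, and \<open>T\<close> is \<open>p 1\<close>.\<close>

definition travel :: "real \<Rightarrow> real" where
  "travel x = integral {0..x} (\<lambda>x. inverse (lam x))"

definition T :: real where "T = travel 1"

definition k :: "real \<Rightarrow> real" where "k x = 1 - travel x / T"

definition k_inv :: "real \<Rightarrow> real" where "k_inv = inv_into {0..1} k"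

lemma negligible_bad: "negligible bad"
  using lam_bounds by (simp add: bad_def)

lemma not_bad:
  assumes "x \<in> {0..1} - bad"
  shows "\<epsilon> \<le> lam x" "lam x \<le> C" "0 < lam x" "inverse (lam x) \<le> 1 / \<epsilon>" "1 / C \<le> inverse (lam x)" "0 < inverse (lam x)"
proof -
  show *: "\<epsilon> \<le> lam x" "lam x \<le> C" using assms by (auto simp: bad_def)
  then show "0 < lam x" using eps by simp
  then show "inverse (lam x) \<le> 1 / \<epsilon>" "1 / C \<le> inverse (lam x)" "0 < inverse (lam x)"
    using * eps by (auto simp: inverse_eq_divide intro!: divide_left_mono mult_pos_pos)
qed

lemma C_pos: "C > 0"
proof -
  have "\<not> negligible {0..1::real}" using negligible_interval(1)[of 0 "1::real"] by (simp add: box_real)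
  then obtain x where "x \<in> {0..1} - bad" using negligible_bad negligible_subset by blast
  then show ?thesis using not_bad(2,3)[of x] by simp
qed

lemma inverse_lam_measurable: "(\<lambda>x. inverse (lam x)) \<in> borel_measurable (lebesgue_on {0..1})"
  using lam_measurable by measurable

lemma sq_integrable_weight:
  fixes f :: "real \<Rightarrow> 'a::euclidean_space"
  assumes f: "sq_integrable 0 1 f" and h: "h \<in> borel_measurable (lebesgue_on {0..1})"
    and b: "\<And>x. x \<in> {0..1} - bad \<Longrightarrow> \<bar>h x\<bar> \<le> B"
  shows "sq_integrable 0 1 (\<lambda>x. h x *\<^sub>R f x)"
proof -
  let ?h = "\<lambda>x. if x \<in> bad then 0 else h x"
  have B: "B \<ge> 0 \<or> {0..1::real} - bad = {}" using b abs_ge_zero order_trans by blast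
  have neg: "negligible {x \<in> {0..1}. h x \<noteq> ?h x}"
    by (rule negligible_subset[OF negligible_bad]) auto
  have m: "?h \<in> borel_measurable (lebesgue_on {0..1})"
    by (rule borel_measurable_lebesgue_on_spike[OF h _ neg]) simp
  have "sq_integrable 0 1 (\<lambda>x. ?h x *\<^sub>R f x)"
    \<comment> \<open>The maximum also covers the value 0 that \<open>?h\<close> takes on
      \<open>bad\<close>.\<close>
    by (rule sq_integrable_mult_bounded[OF f m, of "max B 0"]) (use b in force)
  then show ?thesis
    by (rule sq_integrable_spike, intro negligible_subset[OF negligible_bad]) auto
qed

lemma sq_integrable_inverse_lam:
  fixes f :: "real \<Rightarrow> 'a::euclidean_space"
  shows "sq_integrable 0 1 f \<Longrightarrow> sq_integrable 0 1 (\<lambda>x. inverse (lam x) *\<^sub>R f x)"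
  by (rule sq_integrable_weight[OF _ inverse_lam_measurable, where B="1/\<epsilon>"])
    (simp_all only: abs_of_pos[OF not_bad(6)] not_bad(4))

lemma sq_integrable_lam:
  fixes f :: "real \<Rightarrow> 'a::euclidean_space"
  shows "sq_integrable 0 1 f \<Longrightarrow> sq_integrable 0 1 (\<lambda>x. lam x *\<^sub>R f x)"
  by (rule sq_integrable_weight[OF _ lam_measurable, where B="C"]) (use not_bad(2,3) in \<open>auto simp: abs_of_pos\<close>)

lemma inverse_lam_integrable: "(\<lambda>x. inverse (lam x)) integrable_on {0..1}"
  using sq_integrable_integrable[OF sq_integrable_inverse_lam[OF sq_integrable_const[of 0 1 "1::real"]]] by simp

lemma travel_diff:
  assumes "0 \<le> a" "a \<le> b" "b \<le> 1"
  shows "travel b - travel a = integral {a..b} (\<lambda>x. inverse (lam x))"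
    "(b - a) / C \<le> travel b - travel a" "travel b - travel a \<le> (b - a) / \<epsilon>"
proof -
  let ?r = "\<lambda>x. inverse (lam x)"
  have "integral {0..a} ?r + integral {a..b} ?r = integral {0..b} ?r"
    using assms by (intro Henstock_Kurzweil_Integration.integral_combine integrable_on_subinterval[OF inverse_lam_integrable]) auto
  then show *: "travel b - travel a = integral {a..b} ?r" by (simp add: travel_def)
  \<comment> \<open>On the null set \<open>bad\<close> the integrand is replaced by the bound
    itself, so that the integrals can be compared pointwise.\<close>
  let ?r' = "\<lambda>x. if x \<in> bad then 1 / \<epsilon> else ?r x" and ?r'' = "\<lambda>x. if x \<in> bad then 1 / C else ?r x"
  have i: "?r integrable_on {a..b}"
    using assms by (intro integrable_on_subinterval[OF inverse_lam_integrable]) auto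
  have "?r' integrable_on {a..b}" "?r'' integrable_on {a..b}"
    by (rule integrable_spike[OF i negligible_bad], simp)+
  moreover have "integral {a..b} ?r = integral {a..b} ?r'" "integral {a..b} ?r = integral {a..b} ?r''"
    by (rule integral_spike[OF negligible_bad], simp)+
  moreover have "integral {a..b} ?r' \<le> integral {a..b} (\<lambda>x. 1 / \<epsilon>)"
    using calculation assms not_bad(4) by (intro integral_le) auto
  moreover have "integral {a..b} (\<lambda>x. 1 / C) \<le> integral {a..b} ?r''"
    using calculation assms not_bad(5) by (intro integral_le) auto
  ultimately show "(b - a) / C \<le> travel b - travel a" "travel b - travel a \<le> (b - a) / \<epsilon>"
    using assms by (auto simp: *)
qed

lemma travel_0: "travel 0 = 0" by (simp add: travel_def)

lemma T_pos: "T > 0"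
  using travel_diff(2)[of 0 1] C_pos by (simp add: T_def travel_0) (smt (verit) divide_pos_pos)

lemma k_0 [simp]: "k 0 = 1" and k_1 [simp]: "k 1 = 0"
  using T_pos by (auto simp: k_def travel_0 T_def)

lemma k_diff:
  assumes "0 \<le> a" "a \<le> b" "b \<le> 1"
  shows "(b - a) / (C * T) \<le> k a - k b" "k a - k b \<le> (b - a) / (\<epsilon> * T)"
proof -
  have "k a - k b = (travel b - travel a) / T" by (simp add: k_def diff_divide_distrib)
  then show "(b - a) / (C * T) \<le> k a - k b" "k a - k b \<le> (b - a) / (\<epsilon> * T)"
    using divide_right_mono[OF travel_diff(2)[OF assms], of T] divide_right_mono[OF travel_diff(3)[OF assms], of T] T_pos
    by auto
qed

lemma k_expansive:
  assumes "x \<in> {0..1}" "y \<in> {0..1}"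
  shows "\<bar>x - y\<bar> \<le> C * T * \<bar>k x - k y\<bar>"
proof -
  have *: "b - a \<le> C * T * (k a - k b)" "k a - k b \<ge> 0" if "0 \<le> a" "a \<le> b" "b \<le> 1" for a b
  proof -
    show "b - a \<le> C * T * (k a - k b)"
      using k_diff(1)[OF that] C_pos T_pos by (simp add: divide_le_eq mult.commute)
    have "0 \<le> (b - a) / (C * T)" using that C_pos T_pos by simp
    then show "k a - k b \<ge> 0" using k_diff(1)[OF that] by linarith
  qed
  show ?thesis using *[of x y] *[of y x] assms by (cases "x \<le> y") (auto simp: abs_if)
qed

lemma k_Lipschitz:
  assumes "x \<in> {0..1}" "y \<in> {0..1}"
  shows "\<bar>k x - k y\<bar> \<le> 1 / (\<epsilon> * T) * \<bar>x - y\<bar>"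
proof -
  have *: "\<bar>k a - k b\<bar> \<le> 1 / (\<epsilon> * T) * \<bar>b - a\<bar>" if "0 \<le> a" "a \<le> b" "b \<le> 1" for a b
  proof -
    have "0 \<le> (b - a) / (C * T)" using that C_pos T_pos by simp
    then show ?thesis using k_diff[OF that] that by (simp add: abs_if)
  qed
  show ?thesis using *[of x y] *[of y x] assms by (cases "x \<le> y") (auto simp: abs_minus_commute)
qed

lemma k_strict: "0 \<le> a \<Longrightarrow> a < b \<Longrightarrow> b \<le> 1 \<Longrightarrow> k b < k a"
  using k_diff(1)[of a b] divide_pos_pos[of "b - a" "C * T"] mult_pos_pos[OF C_pos T_pos] by linarith

lemma k_antimono: "0 \<le> a \<Longrightarrow> a \<le> b \<Longrightarrow> b \<le> 1 \<Longrightarrow> k b \<le> k a"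
  using k_strict[of a b] by (cases "a = b") auto

lemma continuous_on_k: "continuous_on {0..1} k"
proof (rule lipschitz_on_continuous_on)
  show "(1 / (\<epsilon> * T))-lipschitz_on {0..1} k"
    using k_Lipschitz eps T_pos by (intro lipschitz_onI) (auto simp: dist_real_def)
qed

lemma k_image_interval:
  assumes "0 \<le> a" "a \<le> b" "b \<le> 1"
  shows "k ` {a..b} = {k b..k a}"
proof
  show "k ` {a..b} \<subseteq> {k b..k a}" using assms k_antimono[of a] k_antimono[of _ b] by auto
  have "continuous_on {a..b} k" by (rule continuous_on_subset[OF continuous_on_k]) (use assms in auto)
  then show "{k b..k a} \<subseteq> k ` {a..b}"
    using IVT2'[of k b _ a] assms by fastforce
qed

lemma k_image: "k ` {0..1} = {0..1}"
  using k_image_interval[of 0 1] by simp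

lemma k_in [simp]: "x \<in> {0..1} \<Longrightarrow> k x \<in> {0..1}"
  using k_image by auto

lemma inj_on_k: "inj_on k {0..1}"
  by (rule linorder_inj_onI) (use k_strict in force)+

lemma k_inv_in: "x \<in> {0..1} \<Longrightarrow> k_inv x \<in> {0..1}"
  unfolding k_inv_def using inv_into_into[of x k "{0..1}"] by (simp only: k_image)

lemma k_k_inv [simp]: "x \<in> {0..1} \<Longrightarrow> k (k_inv x) = x"
  unfolding k_inv_def using f_inv_into_f[of x k "{0..1}"] by (simp only: k_image)

lemma k_inv_k [simp]: "x \<in> {0..1} \<Longrightarrow> k_inv (k x) = x"
  unfolding k_inv_def using inv_into_f_f[OF inj_on_k] by simp

lemma k_inv_Lipschitz:
  assumes "x \<in> {0..1}" "y \<in> {0..1}"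
  shows "\<bar>k_inv x - k_inv y\<bar> \<le> C * T * \<bar>x - y\<bar>"
  using k_expansive[OF k_inv_in k_inv_in, OF assms] assms by simp

lemma k_inv_expansive:
  assumes "x \<in> {0..1}" "y \<in> {0..1}"
  shows "\<bar>x - y\<bar> \<le> 1 / (\<epsilon> * T) * \<bar>k_inv x - k_inv y\<bar>"
  using k_Lipschitz[OF k_inv_in k_inv_in, OF assms] assms by simp

lemma continuous_on_k_inv: "continuous_on {0..1} k_inv"
proof (rule lipschitz_on_continuous_on)
  show "(C * T)-lipschitz_on {0..1} k_inv"
    using k_inv_Lipschitz C_pos T_pos by (intro lipschitz_onI) (auto simp: dist_real_def)
qed

lemma negligible_k_image:
  assumes "negligible N" "N \<subseteq> {0..1}"
  shows "negligible (k ` N)"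
  using assms(1) by (rule negligible_Lipschitz_image[where C="1 / (\<epsilon> * T)"]) (use assms(2) in \<open>blast intro: k_Lipschitz\<close>)

lemma change_of_variables:
  fixes h :: "real \<Rightarrow> 'a::euclidean_space"
  assumes ab: "0 \<le> a" "a \<le> b" "b \<le> 1"
  shows "(\<lambda>x. inverse (lam x) *\<^sub>R h (k x)) absolutely_integrable_on {a..b} \<longleftrightarrow> h absolutely_integrable_on {k b..k a}" (is ?A)
    and "h absolutely_integrable_on {k b..k a} \<Longrightarrow>
      integral {a..b} (\<lambda>x. inverse (lam x) *\<^sub>R h (k x)) = T *\<^sub>R integral {k b..k a} h" (is "_ \<Longrightarrow> ?B")
proof -
  obtain N where N: "negligible N"
    "\<And>x. x \<in> {0<..<1} - N \<Longrightarrow> (travel has_vector_derivative inverse (lam x)) (at x)"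
    using indefinite_integral_vector_derivative_AE[OF inverse_lam_integrable] unfolding travel_def[abs_def] by metis
  define E where "E = (N \<inter> {0..1}) \<union> bad"
  have E: "negligible E" "E \<subseteq> {0..1}"
    using N negligible_bad by (auto simp: E_def bad_def intro: negligible_Un negligible_subset[of N])
  define S where "S = {a<..<b} - E"
  have S: "S \<subseteq> {a..b}" "S \<subseteq> {0<..<1}" "S \<subseteq> {0..1} - bad" using ab by (auto simp: S_def E_def)
  have Sm: "S \<in> sets lebesgue" unfolding S_def using E by (intro sets.Diff) (auto intro: negligible_imp_sets)
  have der: "(k has_field_derivative - inverse (lam x) / T) (at x within S)" if "x \<in> S" for x
  proof -
    have "(travel has_real_derivative inverse (lam x)) (at x)"
      using N(2)[of x] that S by (auto simp: S_def E_def has_real_derivative_iff_has_vector_derivative)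
    then have "((\<lambda>x. 1 - travel x / T) has_field_derivative - inverse (lam x) / T) (at x)"
      using T_pos by (auto intro!: derivative_eq_intros)
    then show ?thesis unfolding k_def[abs_def] by (rule has_field_derivative_at_within)
  qed
  have inj: "inj_on k S" using inj_on_k by (rule inj_on_subset) (use S in auto)
  have abs: "\<bar>- inverse (lam x) / T\<bar> = inverse (lam x) / T" if "x \<in> S" for x
  proof -
    have "0 < inverse (lam x)" using that S(3) not_bad(6) by blast
    then show ?thesis using T_pos by simp
  qed
  have neg: "negligible ({a..b} - S)"
    by (rule negligible_subset[of "E \<union> {a,b}"]) (use E in \<open>auto simp: S_def intro: negligible_Un\<close>)
  have kS: "k ` S \<subseteq> {k b..k a}" using S(1) k_image_interval[OF ab] by blast
  have "{k b..k a} - k ` S \<subseteq> k ` ({a..b} - S)" using k_image_interval[OF ab] by blast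
  moreover have "negligible (k ` ({a..b} - S))" by (rule negligible_k_image[OF neg]) (use ab in auto)
  ultimately have negk: "negligible ({k b..k a} - k ` S)" using negligible_subset by blast
  let ?f = "\<lambda>x. (inverse (lam x) / T) *\<^sub>R h (k x)"
  have cov: "(?f absolutely_integrable_on S \<and> integral S ?f = v \<longleftrightarrow> h absolutely_integrable_on k ` S \<and> integral (k ` S) h = v)" for v
  proof -
    have "?f absolutely_integrable_on S \<longleftrightarrow> (\<lambda>x. \<bar>- inverse (lam x) / T\<bar> *\<^sub>R h (k x)) absolutely_integrable_on S"
      by (rule set_integrable_cong) (use abs in auto)
    moreover have "integral S ?f = integral S (\<lambda>x. \<bar>- inverse (lam x) / T\<bar> *\<^sub>R h (k x))"
      by (rule integral_cong) (use abs in auto)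
    ultimately show ?thesis
      using has_absolute_integral_change_of_variables_real[OF Sm der inj, of h v] by simp
  qed
  have 1: "?f absolutely_integrable_on S \<longleftrightarrow> ?f absolutely_integrable_on {a..b}"
  proof (rule absolutely_integrable_spike_set_eq)
    show "negligible {x \<in> S - {a..b}. ?f x \<noteq> 0}" by (rule negligible_subset[OF negligible_empty], use S(1) in blast)
    show "negligible {x \<in> {a..b} - S. ?f x \<noteq> 0}" by (rule negligible_subset[OF neg]) auto
  qed
  have 2: "h absolutely_integrable_on k ` S \<longleftrightarrow> h absolutely_integrable_on {k b..k a}"
  proof (rule absolutely_integrable_spike_set_eq)
    show "negligible {x \<in> k ` S - {k b..k a}. h x \<noteq> 0}" by (rule negligible_subset[OF negligible_empty], use kS in blast)
    show "negligible {x \<in> {k b..k a} - k ` S. h x \<noteq> 0}" by (rule negligible_subset[OF negk]) auto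
  qed
  have 3: "?f absolutely_integrable_on {a..b} \<longleftrightarrow> (\<lambda>x. inverse (lam x) *\<^sub>R h (k x)) absolutely_integrable_on {a..b}"
  proof -
    have "?f = (\<lambda>x. (1 / T) *\<^sub>R (inverse (lam x) *\<^sub>R h (k x)))" by (auto simp: fun_eq_iff)
    then show ?thesis using absolutely_integrable_on_scaleR_iff[where c="1/T" and f="\<lambda>x. inverse (lam x) *\<^sub>R h (k x)" and S="{a..b}"] T_pos by simp
  qed
  show ?A using cov 1 2 3 by blast
  assume h: "h absolutely_integrable_on {k b..k a}"
  then have "integral S ?f = integral (k ` S) h" using cov 2 by blast
  moreover have "integral S ?f = integral {a..b} ?f"
  proof (rule integral_spike_set)
    show "negligible {x \<in> S - {a..b}. ?f x \<noteq> 0}" by (rule negligible_subset[OF negligible_empty], use S(1) in blast)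
    show "negligible {x \<in> {a..b} - S. ?f x \<noteq> 0}" by (rule negligible_subset[OF neg]) auto
  qed
  moreover have "integral (k ` S) h = integral {k b..k a} h"
  proof (rule integral_spike_set)
    show "negligible {x \<in> k ` S - {k b..k a}. h x \<noteq> 0}" by (rule negligible_subset[OF negligible_empty], use kS in blast)
    show "negligible {x \<in> {k b..k a} - k ` S. h x \<noteq> 0}" by (rule negligible_subset[OF negk]) auto
  qed
  moreover have "integral {a..b} (\<lambda>x. inverse (lam x) *\<^sub>R h (k x)) = T *\<^sub>R integral {a..b} ?f"
  proof -
    have "(\<lambda>x. inverse (lam x) *\<^sub>R h (k x)) = (\<lambda>x. T *\<^sub>R ?f x)" using T_pos by (auto simp: fun_eq_iff)
    then show ?thesis by (simp only: integral_cmul)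
  qed
  ultimately show ?B by simp
qed

text \<open>The square of the function contains \<open>inverse (lam x)\<close> twice: one factor is
  at most \<open>1 / \<epsilon>\<close>, the other is \<open>T\<close> times the Jacobian of
  \<open>k\<close>. This is the origin of the constant \<open>T / \<epsilon>\<close>.\<close>

lemma sq_integrable_travelling:
  fixes h :: "real \<Rightarrow> 'a::euclidean_space"
  assumes h: "sq_integrable s (1 + s) h"
  shows "sq_integrable 0 1 (\<lambda>x. inverse (lam x) *\<^sub>R h (k x + s))"
    "sq_int 0 1 (\<lambda>x. inverse (lam x) *\<^sub>R h (k x + s)) \<le> T / \<epsilon> * sq_int s (1 + s) h"
proof -
  let ?g = "\<lambda>x. inverse (lam x) *\<^sub>R h (k x + s)"
  let ?n = "\<lambda>y. (norm (h (y + s)))\<^sup>2"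
  have sh: "sq_integrable 0 1 (\<lambda>y. h (y + s))" using h sq_integrable_shift[of 0 s 1 h] by simp
  then have n: "?n absolutely_integrable_on {k 1..k 0}"
    by (simp add: sq_integrable_def absolutely_integrable_on_iff_nonneg)
  have i: "(\<lambda>x. inverse (lam x) *\<^sub>R ?n (k x)) absolutely_integrable_on {0..1}"
    using change_of_variables(1)[of 0 1 ?n] n by simp
  then have i': "(\<lambda>x. inverse (lam x) *\<^sub>R ?n (k x)) integrable_on {0..1}"
    using set_lebesgue_integral_eq_integral(1) by blast
  have eq: "integral {0..1} (\<lambda>x. inverse (lam x) *\<^sub>R ?n (k x)) = T * sq_int s (1 + s) h"
    using change_of_variables(2)[OF _ _ _ n] sq_int_shift[of 0 s 1 h] h by (simp add: sq_int_def)
  let ?b = "\<lambda>x. if x \<in> bad then (norm (?g x))\<^sup>2 else 1 / \<epsilon> * (inverse (lam x) *\<^sub>R ?n (k x))"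
  have bint: "?b integrable_on {0..1}"
    by (rule integrable_spike[OF integrable_on_mult_right[OF i', of "1/\<epsilon>"] negligible_bad]) auto
  have le: "(norm (?g x))\<^sup>2 \<le> ?b x" if "x \<in> {0..1}" for x
  proof (cases "x \<in> bad")
    case False
    then have r: "0 < inverse (lam x)" "inverse (lam x) \<le> 1 / \<epsilon>" using that not_bad by auto
    have "(norm (?g x))\<^sup>2 = inverse (lam x) * (inverse (lam x) * ?n (k x))"
      by (simp add: power_mult_distrib power2_eq_square flip: abs_inverse)
    also have "\<dots> \<le> 1 / \<epsilon> * (inverse (lam x) * ?n (k x))"
      using r by (intro mult_right_mono) auto
    finally show ?thesis using False by simp
  qed simp
  show s: "sq_integrable 0 1 ?g"
  proof (rule sq_integrable_bound[OF _ bint le])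
    have "(\<lambda>x. h (k x + s)) \<in> borel_measurable (lebesgue_on {0..1})"
      by (rule borel_measurable_expansive_compose[where C = "C * T" and a=s and b="1+s"])
        (use h k_expansive k_in in \<open>auto simp: sq_integrable_def intro!: continuous_intros continuous_on_k\<close>)
    then show "?g \<in> borel_measurable (lebesgue_on {0..1})"
      using inverse_lam_measurable by measurable
  qed
  have "sq_int 0 1 ?g \<le> integral {0..1} ?b"
    unfolding sq_int_def using s bint le by (intro integral_le) (auto simp: sq_integrable_def)
  also have "\<dots> = integral {0..1} (\<lambda>x. 1 / \<epsilon> * (inverse (lam x) *\<^sub>R ?n (k x)))"
    by (rule integral_spike[OF negligible_bad]) auto
  also have "\<dots> = T / \<epsilon> * sq_int s (1 + s) h"
    using eq by (simp only: integral_mult_right) simp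
  finally show "sq_int 0 1 ?g \<le> T / \<epsilon> * sq_int s (1 + s) h" .
qed

text \<open>The integrability part of \<open>change_of_variables\<close> is an equivalence, so the
  square may be composed with \<open>k\<close> instead of substituting along \<open>k_inv\<close>.
  There it becomes \<open>inverse (lam x)\<close> times an integrable function, and that weight is
  essentially bounded.\<close>

lemma sq_integrable_k_inv:
  fixes g :: "real \<Rightarrow> 'a::euclidean_space"
  assumes g: "sq_integrable 0 1 g"
  shows "sq_integrable 0 1 (\<lambda>y. lam (k_inv y) *\<^sub>R g (k_inv y))"
proof -
  let ?h = "\<lambda>x. lam x *\<^sub>R g x"
  have h: "sq_integrable 0 1 ?h" by (rule sq_integrable_lam[OF g])
  let ?n = "\<lambda>y. (norm (?h (k_inv y)))\<^sup>2"
  have "sq_integrable 0 1 (\<lambda>x. inverse (lam x) *\<^sub>R ?h x)" by (rule sq_integrable_inverse_lam[OF h])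
  have m: "(\<lambda>y. ?h (k_inv y)) \<in> borel_measurable (lebesgue_on {0..1})"
    by (rule borel_measurable_expansive_compose[where C = "1 / (\<epsilon> * T)" and a=0 and b=1])
      (use h k_inv_expansive k_inv_in in \<open>auto simp: sq_integrable_def intro!: continuous_on_k_inv\<close>)
  let ?w = "\<lambda>x. inverse (lam x) *\<^sub>R (norm (?h x))\<^sup>2"
  have wm: "?w \<in> borel_measurable (lebesgue_on {0..1})"
    using h inverse_lam_measurable unfolding sq_integrable_def by (intro borel_measurable_scaleR borel_measurable_power borel_measurable_norm) (auto simp del: norm_scaleR)
  have wb: "norm (?w x) \<le> (if x \<in> bad then \<bar>?w x\<bar> else 1 / \<epsilon> * (norm (?h x))\<^sup>2)" if "x \<in> {0..1}" for x
  proof (cases "x \<in> bad")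
    case False
    then have "0 < inverse (lam x)" "inverse (lam x) \<le> 1 / \<epsilon>" using that not_bad by auto
    then have "norm (?w x) = inverse (lam x) * (norm (?h x))\<^sup>2"
      by (simp add: abs_mult del: norm_scaleR)
    moreover have "inverse (lam x) * (norm (?h x))\<^sup>2 \<le> 1 / \<epsilon> * (norm (?h x))\<^sup>2"
      by (rule mult_right_mono) (use \<open>inverse (lam x) \<le> 1 / \<epsilon>\<close> in auto)
    ultimately have "norm (?w x) \<le> 1 / \<epsilon> * (norm (?h x))\<^sup>2" by (simp only:)
    then show ?thesis using False by simp
  qed simp
  have wi: "(\<lambda>x. if x \<in> bad then \<bar>?w x\<bar> else 1 / \<epsilon> * (norm (?h x))\<^sup>2) integrable_on {0..1}"
    by (rule integrable_spike[OF _ negligible_bad, of "\<lambda>x. 1 / \<epsilon> * (norm (?h x))\<^sup>2"])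
      (use h integrable_on_mult_right[of "\<lambda>x. (norm (?h x))\<^sup>2" "{0..1}" "1/\<epsilon>"] in \<open>auto simp: sq_integrable_def simp del: norm_scaleR\<close>)
  have "?w absolutely_integrable_on {0..1}"
    by (rule measurable_bounded_by_integrable_imp_absolutely_integrable[OF wm _ wi wb]) simp
  moreover have "?w absolutely_integrable_on {0..1} \<longleftrightarrow> (\<lambda>x. inverse (lam x) *\<^sub>R ?n (k x)) absolutely_integrable_on {0..1}"
    by (rule set_integrable_cong) auto
  ultimately have "?n absolutely_integrable_on {0..1}"
    using change_of_variables(1)[of 0 1 ?n] by simp
  then have "?n integrable_on {0..1}"
    using set_lebesgue_integral_eq_integral(1) by blast
  then show ?thesis using m by (simp add: sq_integrable_def)
qed

end

section \<open>Translation and Riemann sums in L2\<close>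

lemma norm_weighted_sum_sq_le:
  fixes v :: "'i \<Rightarrow> 'a::real_normed_vector"
  assumes m: "\<And>i. i \<in> I \<Longrightarrow> 0 \<le> m i"
  shows "(norm (\<Sum>i\<in>I. m i *\<^sub>R v i))\<^sup>2 \<le> (\<Sum>i\<in>I. m i) * (\<Sum>i\<in>I. m i * (norm (v i))\<^sup>2)"
proof -
  have "norm (\<Sum>i\<in>I. m i *\<^sub>R v i) \<le> (\<Sum>i\<in>I. m i * norm (v i))"
    by (rule sum_norm_le) (simp add: m)
  \<comment> \<open>Splitting each weight into two square roots prepares the Cauchy-Schwarz
    inequality.\<close>
  also have "\<dots> = (\<Sum>i\<in>I. sqrt (m i) * (sqrt (m i) * norm (v i)))"
    by (rule sum.cong) (auto simp: m mult.assoc[symmetric])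
  finally have "(norm (\<Sum>i\<in>I. m i *\<^sub>R v i))\<^sup>2 \<le> (\<Sum>i\<in>I. sqrt (m i) * (sqrt (m i) * norm (v i)))\<^sup>2"
    by (rule power_mono) simp
  also have "\<dots> \<le> (\<Sum>i\<in>I. (sqrt (m i))\<^sup>2) * (\<Sum>i\<in>I. (sqrt (m i) * norm (v i))\<^sup>2)"
    by (rule Cauchy_Schwarz_ineq_sum)
  also have "\<dots> = (\<Sum>i\<in>I. m i) * (\<Sum>i\<in>I. m i * (norm (v i))\<^sup>2)"
    using m by (simp add: power_mult_distrib)
  finally show ?thesis .
qed

text \<open>The bound sees only the total weight and not the number of summands, so for Riemann sums
  it is the same for every division.\<close>

lemma sq_int_sum_le:
  assumes f: "\<And>i. i \<in> I \<Longrightarrow> sq_integrable a b (f i)" and m: "\<And>i. i \<in> I \<Longrightarrow> 0 \<le> m i"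
    and le: "\<And>i. i \<in> I \<Longrightarrow> sq_int a b (f i) \<le> B" and fin: "finite I"
  shows "sq_int a b (\<lambda>x. \<Sum>i\<in>I. m i *\<^sub>R f i x) \<le> (\<Sum>i\<in>I. m i)\<^sup>2 * B"
proof -
  have i: "(\<lambda>x. m j * (norm (f j x))\<^sup>2) integrable_on {a..b}" if "j \<in> I" for j
    using f[OF that] by (intro integrable_on_mult_right) (simp add: sq_integrable_def)
  have s: "sq_integrable a b (\<lambda>x. \<Sum>i\<in>I. m i *\<^sub>R f i x)"
    by (intro sq_integrable_sum sq_integrable_scaleR f)
  have "sq_int a b (\<lambda>x. \<Sum>i\<in>I. m i *\<^sub>R f i x) \<le>
      integral {a..b} (\<lambda>x. (\<Sum>i\<in>I. m i) * (\<Sum>i\<in>I. m i * (norm (f i x))\<^sup>2))"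
    unfolding sq_int_def
    by (rule integral_le) (use s in \<open>auto simp: sq_integrable_def m intro!: norm_weighted_sum_sq_le integrable_on_mult_right integrable_sum fin i\<close>)
  also have "\<dots> = (\<Sum>i\<in>I. m i) * (\<Sum>i\<in>I. m i * sq_int a b (f i))"
    using i by (simp add: integral_sum fin sq_int_def)
  also have "\<dots> \<le> (\<Sum>i\<in>I. m i) * (\<Sum>i\<in>I. m i * B)"
    using m le by (intro mult_left_mono sum_mono sum_nonneg) auto
  also have "\<dots> = (\<Sum>i\<in>I. m i)\<^sup>2 * B" by (simp add: sum_distrib_right[symmetric] power2_eq_square)
  finally show ?thesis .
qed

lemma sq_int_le_of_norm_le:
  assumes "sq_integrable 0 1 f" "\<And>x. x \<in> {0..1} \<Longrightarrow> norm (f x) \<le> B"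
  shows "sq_int 0 1 f \<le> B\<^sup>2"
proof -
  have "sq_int 0 1 f \<le> integral {0..1} (\<lambda>x::real. B\<^sup>2)"
    unfolding sq_int_def using assms by (intro integral_le power_mono) (auto simp: sq_integrable_def)
  then show ?thesis by simp
qed

text \<open>The sum approximates the integral of \<open>f (y + s / T)\<close> over \<open>s\<close>
  in \<open>{0..t}\<close>, which by substitution is \<open>T\<close> times a window integral of
  \<open>f\<close>. Using \<open>y\<close> in place of \<open>k x\<close> separates the
  approximation from the wave speed.\<close>

definition riemann_error :: "real \<Rightarrow> real \<Rightarrow> (real \<times> real set) set \<Rightarrow> (real \<Rightarrow> 'a::euclidean_space) \<Rightarrow> real \<Rightarrow> 'a" where
  "riemann_error T t D f y = (\<Sum>(s,K)\<in>D. measure lborel K *\<^sub>R f (y + s / T)) - T *\<^sub>R integral {y..y + t / T} f"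

text \<open>The length \<open>X\<close> is such that every translate \<open>y + s / T\<close> with
  \<open>y\<close> in \<open>{0..1}\<close> and \<open>s\<close> in \<open>{0..t}\<close> stays in
  \<open>{0..X}\<close>.\<close>

context
  fixes T t X :: real
  assumes T: "T > 0" and t: "t \<ge> 0" and X: "1 + t / T \<le> X"
begin

lemma tT: "0 \<le> t / T" using T t by simp

lemma tagged_sum_measure:
  assumes "D tagged_division_of {0..t}"
  shows "(\<Sum>z\<in>D. measure lborel (snd z)) = t"
  using additive_content_tagged_division[of D 0 t] assms t by (simp add: split_def)

lemma tag_bounds:
  assumes "D tagged_division_of {0..t}" "z \<in> D"
  shows "0 \<le> fst z / T" "fst z / T \<le> t / T"
  using tag_in_interval[OF assms(1), of "fst z" "snd z"] assms(2) T by (auto simp: divide_right_mono)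

lemma integral_window:
  fixes f :: "real \<Rightarrow> 'a::euclidean_space"
  assumes "sq_integrable 0 X f" "y \<in> {0..1}"
  shows "integral {y..y + t / T} f = integral {0..y + t / T} f - integral {0..y} f"
proof -
  have "integral {0..y} f + integral {y..y + t / T} f = integral {0..y + t / T} f"
    using assms tT X
    by (intro Henstock_Kurzweil_Integration.integral_combine integrable_on_subinterval[OF sq_integrable_integrable]) auto
  then show ?thesis by (simp add: algebra_simps)
qed

lemma continuous_on_window:
  fixes f :: "real \<Rightarrow> 'a::euclidean_space"
  assumes f: "sq_integrable 0 X f"
  shows "continuous_on {0..1} (\<lambda>y. integral {y..y + t / T} f)"
proof -
  have c: "continuous_on {0..X} (\<lambda>y. integral {0..y} f)"
    by (rule indefinite_integral_continuous_1[OF sq_integrable_integrable[OF f]])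
  have "continuous_on {0..1} (\<lambda>y. integral {0..y + t / T} f - integral {0..y} f)"
    using tT X by (intro continuous_on_diff continuous_on_compose2[OF c] continuous_intros) auto
  then show ?thesis
    by (rule continuous_on_eq) (simp add: integral_window[OF f])
qed

lemma sq_integrable_translate:
  fixes f :: "real \<Rightarrow> 'a::euclidean_space"
  assumes f: "sq_integrable 0 X f" and s: "0 \<le> s" "s \<le> t / T"
  shows "sq_integrable 0 1 (\<lambda>y. f (y + s))" "sq_int 0 1 (\<lambda>y. f (y + s)) \<le> sq_int 0 X f"
proof -
  have "sq_integrable s (1 + s) f" using sq_integrable_subinterval[OF f, of s "1 + s"] s X by simp
  then show "sq_integrable 0 1 (\<lambda>y. f (y + s))" "sq_int 0 1 (\<lambda>y. f (y + s)) \<le> sq_int 0 X f"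
    using sq_integrable_shift[of 0 s 1 f] sq_int_shift[of 0 s 1 f] sq_int_mono_interval[OF f, of s "1 + s"] s X by auto
qed

text \<open>The constant must not depend on \<open>D\<close>, since this is what allows
  \<open>f\<close> to be replaced by a nearby function before the mesh is chosen. The Riemann sum
  accounts for \<open>2 * t\<^sup>2\<close>; the window integral, through Cauchy-Schwarz on a window
  of length \<open>t / T\<close>, for \<open>2 * T * t\<close>.\<close>

lemma riemann_error_bound:
  fixes f :: "real \<Rightarrow> 'a::euclidean_space"
  assumes f: "sq_integrable 0 X f" and D: "D tagged_division_of {0..t}"
  shows "sq_integrable 0 1 (riemann_error T t D f)"
    "sq_int 0 1 (riemann_error T t D f) \<le> (2 * t\<^sup>2 + 2 * T * t) * sq_int 0 X f"
proof -
  let ?S = "\<lambda>y. \<Sum>z\<in>D. measure lborel (snd z) *\<^sub>R f (y + fst z / T)"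
  let ?W = "\<lambda>y. T *\<^sub>R integral {y..y + t / T} f"
  have eq: "riemann_error T t D f = (\<lambda>y. ?S y - ?W y)" by (simp add: riemann_error_def[abs_def] split_def)
  have S: "sq_integrable 0 1 ?S"
    by (intro sq_integrable_sum sq_integrable_scaleR sq_integrable_translate[OF f] tag_bounds[OF D])
  have W: "sq_integrable 0 1 ?W"
    by (intro sq_integrable_scaleR sq_integrable_continuous continuous_on_window f)
  show "sq_integrable 0 1 (riemann_error T t D f)" unfolding eq by (rule sq_integrable_diff[OF S W])
  have "sq_int 0 1 ?S \<le> (\<Sum>z\<in>D. measure lborel (snd z))\<^sup>2 * sq_int 0 X f"
    using D by (intro sq_int_sum_le sq_integrable_translate[OF f] tag_bounds[OF D]) auto
  then have 1: "sq_int 0 1 ?S \<le> t\<^sup>2 * sq_int 0 X f" by (simp add: tagged_sum_measure[OF D])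
  have "norm (integral {y..y + t / T} f) \<le> sqrt (t / T * sq_int 0 X f)" if "y \<in> {0..1}" for y
  proof (rule real_le_rsqrt)
    have s: "sq_integrable y (y + t / T) f" "sq_int y (y + t / T) f \<le> sq_int 0 X f"
      using sq_integrable_subinterval[OF f] sq_int_mono_interval[OF f] that X tT by auto
    have "(norm (integral {y..y + t / T} f))\<^sup>2 \<le> t / T * sq_int y (y + t / T) f"
      using norm_integral_sq_le[OF s(1)] tT by simp
    also have "\<dots> \<le> t / T * sq_int 0 X f" using s tT by (intro mult_left_mono) auto
    finally show "(norm (integral {y..y + t / T} f))\<^sup>2 \<le> t / T * sq_int 0 X f" .
  qed
  then have "sq_int 0 1 (\<lambda>y. integral {y..y + t / T} f) \<le> (sqrt (t / T * sq_int 0 X f))\<^sup>2"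
    by (intro sq_int_le_of_norm_le sq_integrable_continuous continuous_on_window f)
  also have "\<dots> = t / T * sq_int 0 X f" by (rule real_sqrt_pow2) (intro mult_nonneg_nonneg tT sq_int_nonneg)
  finally have "T\<^sup>2 * sq_int 0 1 (\<lambda>y. integral {y..y + t / T} f) \<le> T\<^sup>2 * (t / T * sq_int 0 X f)"
    by (rule mult_left_mono) simp
  also have "\<dots> = T * t * sq_int 0 X f" using T by (simp add: power2_eq_square)
  finally have 2: "sq_int 0 1 ?W \<le> T * t * sq_int 0 X f" by (simp add: sq_int_scaleR)
  show "sq_int 0 1 (riemann_error T t D f) \<le> (2 * t\<^sup>2 + 2 * T * t) * sq_int 0 X f"
    unfolding eq using sq_int_diff_le[OF S W] 1 2 by (simp add: algebra_simps)
qed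

text \<open>On each piece of the division the integrand differs from its value at the tag by at most
  \<open>\<omega>\<close>. The mesh is \<open>\<delta> * T\<close> because the argument of
  \<open>g\<close> moves with \<open>s / T\<close>.\<close>

lemma riemann_error_continuous:
  fixes g :: "real \<Rightarrow> 'a::euclidean_space"
  assumes g: "continuous_on UNIV g" and D: "D tagged_division_of {0..t}" "(\<lambda>s. ball s (\<delta> * T)) fine D"
    and \<delta>: "\<And>x y. x \<in> {0..X} \<Longrightarrow> y \<in> {0..X} \<Longrightarrow> \<bar>x - y\<bar> < \<delta> \<Longrightarrow> norm (g x - g y) \<le> \<omega>"
    and y: "y \<in> {0..1}"
  shows "norm (riemann_error T t D g y) \<le> t * \<omega>"
proof -
  let ?h = "\<lambda>s. g (y + s / T)"
  have gc: "continuous_on S g" for S by (rule continuous_on_subset[OF g]) simp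
  have hi: "?h integrable_on {a..b}" for a b
    using T by (intro integrable_continuous_interval continuous_on_compose2[OF g] continuous_intros) auto
  have "integral {0..t} ?h = T *\<^sub>R integral {y..y + t / T} g"
    using has_integral_affine[of g "1/T" 0 y t] T
    by (simp add: integrable_continuous_interval gc integral_unique add.commute)
  then have "riemann_error T t D g y = (\<Sum>(s,K)\<in>D. measure lborel K *\<^sub>R ?h s) - integral {0..t} ?h"
    by (simp add: riemann_error_def)
  also have "integral {0..t} ?h = (\<Sum>(s,K)\<in>D. integral K ?h)"
    using integral_combine_tagged_division_topdown[of ?h 0 t D] hi D by simp
  finally have "riemann_error T t D g y = (\<Sum>z\<in>D. measure lborel (snd z) *\<^sub>R ?h (fst z) - integral (snd z) ?h)"
    by (simp add: sum_subtractf split_def)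
  also have "norm \<dots> \<le> (\<Sum>z\<in>D. measure lborel (snd z) * \<omega>)"
  proof (rule sum_norm_le)
    fix z assume z: "z \<in> D"
    obtain s K where zK: "z = (s,K)" by (cases z)
    have sK: "(s,K) \<in> D" using z zK by simp
    obtain a b where K: "K = {a..b}" using tagged_division_ofD(4)[OF D(1) sK] by auto
    have in_K: "s \<in> K" "K \<subseteq> {0..t}" "K \<subseteq> ball s (\<delta> * T)"
      using tagged_division_ofD(2,3)[OF D(1) sK] fineD[OF D(2) sK] by auto
    then have ab: "a \<le> b" using K by auto
    have "norm (?h s - ?h r) \<le> \<omega>" if r: "r \<in> {a..b}" for r
    proof (rule \<delta>)
      have r': "0 \<le> r" "r \<le> t" "\<bar>s - r\<bar> < \<delta> * T" "0 \<le> s" "s \<le> t"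
        using r in_K K by (auto simp: subset_iff dist_real_def)
      show "y + s / T \<in> {0..X}" "y + r / T \<in> {0..X}"
        using r' y T X divide_right_mono[of s t T] divide_right_mono[of r t T] by auto
      have "\<bar>y + s / T - (y + r / T)\<bar> = \<bar>s - r\<bar> / T" using T by (simp add: diff_divide_distrib[symmetric])
      also have "\<dots> < \<delta>" using r' T by (simp add: divide_less_eq)
      finally show "\<bar>y + s / T - (y + r / T)\<bar> < \<delta>" .
    qed
    then have "norm (integral {a..b} (\<lambda>r. ?h s - ?h r)) \<le> integral {a..b} (\<lambda>r. \<omega>)"
      by (intro integral_norm_bound_integral integrable_diff hi) auto
    moreover have "integral {a..b} (\<lambda>r. ?h s - ?h r) = measure lborel (snd z) *\<^sub>R ?h (fst z) - integral (snd z) ?h"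
      using hi ab by (subst integral_diff) (auto simp: zK K)
    ultimately show "norm (measure lborel (snd z) *\<^sub>R ?h (fst z) - integral (snd z) ?h) \<le> measure lborel (snd z) * \<omega>"
      using ab by (simp add: zK K)
  qed
  also have "\<dots> = t * \<omega>" by (simp add: sum_distrib_right[symmetric] tagged_sum_measure[OF D(1)])
  finally show ?thesis .
qed

lemma uniform_modulus:
  fixes g :: "real \<Rightarrow> 'a::euclidean_space"
  assumes g: "continuous_on UNIV g" and "\<omega> > 0"
  obtains \<delta> where "\<delta> > 0" "\<And>x y. x \<in> {0..X} \<Longrightarrow> y \<in> {0..X} \<Longrightarrow> \<bar>x - y\<bar> < \<delta> \<Longrightarrow> norm (g x - g y) \<le> \<omega>"
proof -
  have "uniformly_continuous_on {0..X} g"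
    by (intro compact_uniformly_continuous continuous_on_subset[OF g]) auto
  then obtain \<delta> where "\<delta> > 0" "\<And>x y. x \<in> {0..X} \<Longrightarrow> y \<in> {0..X} \<Longrightarrow> dist y x < \<delta> \<Longrightarrow> dist (g y) (g x) < \<omega>"
    using \<open>\<omega> > 0\<close> unfolding uniformly_continuous_on_def by metis
  then show ?thesis using that[of \<delta>] by (force simp: dist_norm norm_minus_commute)
qed

text \<open>Approximate \<open>f\<close> by a continuous \<open>g\<close>, whose Riemann sums converge uniformly; the error of \<open>f - g\<close> is bounded
  in \<open>L\<^sup>2\<close> independently of the division.\<close>

lemma riemann_error_tendsto:
  fixes f :: "real \<Rightarrow> 'a::euclidean_space"
  assumes f: "sq_integrable 0 X f" and e: "e > 0"
  obtains \<delta> where "\<delta> > 0" "\<And>D. D tagged_division_of {0..t} \<Longrightarrow> (\<lambda>s. ball s \<delta>) fine D \<Longrightarrow>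
     sq_int 0 1 (riemann_error T t D f) < e"
proof -
  \<comment> \<open>The constant of \<open>riemann_error_bound\<close>, made positive by the
    \<open>+ 1\<close>. The two parts of the error then contribute less than
    \<open>2 * (e / 4)\<close> and at most \<open>2 * (e / 8)\<close>.\<close>
  define M where "M = 2 * t\<^sup>2 + 2 * T * t + 1"
  have M: "M > 0" using T t by (simp add: M_def add_nonneg_pos)
  obtain g where g: "continuous_on UNIV g" and fg: "sq_int 0 X (\<lambda>x. f x - g x) < e / (4 * M)"
    using sq_integrable_approximate_continuous[OF f, of "e / (4 * M)"] e M by auto
  define \<omega> where "\<omega> = sqrt (e / 8) / (t + 1)"
  have \<omega>: "\<omega> > 0" "t * \<omega> \<le> sqrt (e / 8)" using e t by (auto simp: \<omega>_def field_simps)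
  obtain \<delta> where \<delta>: "\<delta> > 0" "\<And>x y. x \<in> {0..X} \<Longrightarrow> y \<in> {0..X} \<Longrightarrow> \<bar>x - y\<bar> < \<delta> \<Longrightarrow> norm (g x - g y) \<le> \<omega>"
    using uniform_modulus[OF g \<omega>(1)] by metis
  have gs: "sq_integrable 0 X g" by (intro sq_integrable_continuous continuous_on_subset[OF g]) auto
  show ?thesis
  proof
    show "\<delta> * T > 0" using \<delta> T by simp
    fix D assume D: "D tagged_division_of {0..t}" "(\<lambda>s. ball s (\<delta> * T)) fine D"
    have lin: "riemann_error T t D f y = riemann_error T t D (\<lambda>x. f x - g x) y + riemann_error T t D g y" if "y \<in> {0..1}" for y
    proof -
      have "f integrable_on {y..y + t / T}" "g integrable_on {y..y + t / T}"
        using that X by (auto intro!: integrable_on_subinterval[OF sq_integrable_integrable[OF f]] integrable_on_subinterval[OF sq_integrable_integrable[OF gs]])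
      then show ?thesis
        by (simp add: riemann_error_def integral_diff split_def scaleR_diff_right sum_subtractf)
    qed
    have "sq_int 0 1 (riemann_error T t D f) = sq_int 0 1 (\<lambda>y. riemann_error T t D (\<lambda>x. f x - g x) y + riemann_error T t D g y)"
      unfolding sq_int_def by (rule integral_cong) (simp add: lin)
    also have "\<dots> \<le> 2 * sq_int 0 1 (riemann_error T t D (\<lambda>x. f x - g x)) + 2 * sq_int 0 1 (riemann_error T t D g)"
      by (intro sq_int_add_le riemann_error_bound D sq_integrable_diff f gs)
    also have "\<dots> \<le> 2 * (M * sq_int 0 X (\<lambda>x. f x - g x)) + 2 * (e / 8)"
    proof (intro add_mono mult_left_mono)
      have "sq_int 0 1 (riemann_error T t D (\<lambda>x. f x - g x)) \<le> (2 * t\<^sup>2 + 2 * T * t) * sq_int 0 X (\<lambda>x. f x - g x)"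
        by (intro riemann_error_bound D sq_integrable_diff f gs)
      also have "\<dots> \<le> M * sq_int 0 X (\<lambda>x. f x - g x)"
        by (intro mult_right_mono sq_int_nonneg) (simp add: M_def)
      finally show "sq_int 0 1 (riemann_error T t D (\<lambda>x. f x - g x)) \<le> M * sq_int 0 X (\<lambda>x. f x - g x)" .
      have "sq_int 0 1 (riemann_error T t D g) \<le> (sqrt (e / 8))\<^sup>2"
        using riemann_error_continuous[OF g D \<delta>(2)] \<omega>(2)
        by (intro sq_int_le_of_norm_le riemann_error_bound D gs) fastforce
      then show "sq_int 0 1 (riemann_error T t D g) \<le> e / 8" using e by simp
    qed auto
    also have "M * sq_int 0 X (\<lambda>x. f x - g x) < e / 4"
      using fg M by (simp add: field_simps)
    finally show "sq_int 0 1 (riemann_error T t D f) < e" using e by simp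
  qed
qed

text \<open>A continuous \<open>g\<close> near \<open>f\<close> is uniformly continuous on
  \<open>{0..X}\<close>, and translating \<open>f - g\<close> does not increase its square integral
  beyond that over \<open>{0..X}\<close>. Hence one \<open>\<delta>\<close> serves all pairs of
  translations in the range.\<close>

lemma translation_continuous:
  fixes f :: "real \<Rightarrow> 'a::euclidean_space"
  assumes f: "sq_integrable 0 X f" and e: "e > 0"
  obtains \<delta> where "\<delta> > 0" "\<And>r s. r \<in> {0..t / T} \<Longrightarrow> s \<in> {0..t / T} \<Longrightarrow> \<bar>r - s\<bar> < \<delta> \<Longrightarrow>
     sq_int 0 1 (\<lambda>y. f (y + r) - f (y + s)) < e"
proof -
  obtain g where g: "continuous_on UNIV g" and fg: "sq_int 0 X (\<lambda>x. f x - g x) < e / 16"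
    using sq_integrable_approximate_continuous[OF f, of "e / 16"] e by auto
  define \<omega> where "\<omega> = sqrt (e / 8)"
  have \<omega>: "\<omega> > 0" using e by (auto simp: \<omega>_def)
  obtain \<delta> where \<delta>: "\<delta> > 0" "\<And>x y. x \<in> {0..X} \<Longrightarrow> y \<in> {0..X} \<Longrightarrow> \<bar>x - y\<bar> < \<delta> \<Longrightarrow> norm (g x - g y) \<le> \<omega>"
    using uniform_modulus[OF g \<omega>(1)] by metis
  have gs: "sq_integrable 0 X g" by (intro sq_integrable_continuous continuous_on_subset[OF g]) auto
  note h = sq_integrable_diff[OF f gs]
  show ?thesis
  proof (rule that[OF \<delta>(1)])
    fix r s assume rs: "r \<in> {0..t / T}" "s \<in> {0..t / T}" "\<bar>r - s\<bar> < \<delta>"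
    let ?h = "\<lambda>r y. f (y + r) - g (y + r)"
    have i: "sq_integrable 0 1 (?h r)" "sq_integrable 0 1 (?h s)" "sq_integrable 0 1 (\<lambda>y. g (y + r))" "sq_integrable 0 1 (\<lambda>y. g (y + s))"
      and b: "sq_int 0 1 (?h r) < e / 16" "sq_int 0 1 (?h s) < e / 16"
      using sq_integrable_translate[OF h, of r] sq_integrable_translate[OF h, of s]
        sq_integrable_translate[OF gs, of r] sq_integrable_translate[OF gs, of s] rs fg by auto
    have "sq_int 0 1 (\<lambda>y. f (y + r) - f (y + s)) = sq_int 0 1 (\<lambda>y. (?h r y - ?h s y) + (g (y + r) - g (y + s)))"
      by (simp add: algebra_simps)
    also have "\<dots> \<le> 2 * sq_int 0 1 (\<lambda>y. ?h r y - ?h s y) + 2 * sq_int 0 1 (\<lambda>y. g (y + r) - g (y + s))"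
      by (intro sq_int_add_le sq_integrable_diff[OF i(1,2)] sq_integrable_diff[OF i(3,4)])
    also have "\<dots> < 2 * (e / 4) + 2 * (e / 4)"
    proof (intro add_strict_mono mult_strict_left_mono)
      show "sq_int 0 1 (\<lambda>y. ?h r y - ?h s y) < e / 4"
        using sq_int_diff_le[OF i(1,2)] b by simp
      have "sq_int 0 1 (\<lambda>y. g (y + r) - g (y + s)) \<le> \<omega>\<^sup>2"
      proof (rule sq_int_le_of_norm_le[OF sq_integrable_diff[OF i(3,4)]])
        show "norm (g (y + r) - g (y + s)) \<le> \<omega>" if "y \<in> {0..1}" for y
          using that rs X by (intro \<delta>(2)) auto
      qed
      then show "sq_int 0 1 (\<lambda>y. g (y + r) - g (y + s)) < e / 4" using e by (simp add: \<omega>_def)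
    qed auto
    finally show "sq_int 0 1 (\<lambda>y. f (y + r) - f (y + s)) < e" by simp
  qed
qed

end

section \<open>Travelling waves are mild solutions\<close>

text \<open>For \<open>X \<le> 0\<close> the interval is a point or empty, so no sign condition on
  \<open>X\<close> has to be carried along.\<close>

lemma L2_loc_iff: "f \<in> L2_loc \<longleftrightarrow> (\<forall>X. sq_integrable 0 X f)"
proof
  assume f: "f \<in> L2_loc"
  show "\<forall>X. sq_integrable 0 X f"
  proof
    fix X :: real
    have "sq_integrable 0 (max X 1) f" using f by (auto simp: L2_loc_def L2_space_iff)
    then show "sq_integrable 0 X f" by (rule sq_integrable_subinterval) auto
  qed
qed (simp add: L2_loc_def L2_space_iff)

lemma continuous_L2_curve_iff:
  "continuous_L2_curve z \<longleftrightarrow> (\<forall>t\<ge>0. sq_integrable 0 1 (\<lambda>x. z x t)) \<and>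
    (\<forall>t\<ge>0. \<forall>e>0. \<exists>\<delta>>0. \<forall>s\<ge>0. \<bar>s - t\<bar> < \<delta> \<longrightarrow> sq_int 0 1 (\<lambda>x. z x s - z x t) < e)"
  (is "?L \<longleftrightarrow> ?sq \<and> ?C")
proof (cases ?sq)
  case True
  have norm_eq: "L2_norm_on {0<..<1} (\<lambda>x. z x s - z x t) = sqrt (sq_int 0 1 (\<lambda>x. z x s - z x t))"
    if "s \<ge> 0" "t \<ge> 0" for s t
    by (rule L2_norm_on_eq) (intro sq_integrable_diff, use True that in auto)
  have "((\<lambda>s. L2_norm_on {0<..<1} (\<lambda>x. z x s - z x t)) \<longlongrightarrow> 0) (at t within {0..}) \<longleftrightarrow>
     (\<forall>e>0. \<exists>\<delta>>0. \<forall>s\<ge>0. \<bar>s - t\<bar> < \<delta> \<longrightarrow> sq_int 0 1 (\<lambda>x. z x s - z x t) < e)" (is "?l \<longleftrightarrow> ?r") if t: "t \<ge> 0" for t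
  proof -
    let ?q = "\<lambda>s. sq_int 0 1 (\<lambda>x. z x s - z x t)"
    \<comment> \<open>The limit ignores \<open>s = t\<close>; since the difference is 0 there, that
      point can be included in the epsilon-delta form.\<close>
    have q0: "?q t = 0" by (simp add: sq_int_def)
    have "?l \<longleftrightarrow> ((\<lambda>s. sqrt (?q s)) \<longlongrightarrow> 0) (at t within {0..})"
      using t by (intro tendsto_cong) (auto simp: eventually_at_filter norm_eq)
    also have "\<dots> \<longleftrightarrow> (?q \<longlongrightarrow> 0) (at t within {0..})"
    proof
      assume "((\<lambda>s. sqrt (?q s)) \<longlongrightarrow> 0) (at t within {0..})"
      from tendsto_power[OF this, of 2] show "(?q \<longlongrightarrow> 0) (at t within {0..})"
        by (simp add: sq_int_nonneg)
    next
      assume "(?q \<longlongrightarrow> 0) (at t within {0..})"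
      from tendsto_real_sqrt[OF this] show "((\<lambda>s. sqrt (?q s)) \<longlongrightarrow> 0) (at t within {0..})" by simp
    qed
    also have "\<dots> \<longleftrightarrow> ?r"
    proof
      assume l: "(?q \<longlongrightarrow> 0) (at t within {0..})"
      show ?r
      proof (intro allI impI)
        fix e :: real assume e: "e > 0"
        obtain d where d: "d > 0" "\<And>s. s \<in> {0..} \<Longrightarrow> 0 < dist s t \<Longrightarrow> dist s t < d \<Longrightarrow> dist (?q s) 0 < e"
          using l e unfolding Lim_within by meson
        show "\<exists>\<delta>>0. \<forall>s\<ge>0. \<bar>s - t\<bar> < \<delta> \<longrightarrow> ?q s < e"
        proof (intro exI[of _ d] conjI allI impI)
          fix s assume s: "s \<ge> 0" "\<bar>s - t\<bar> < d"
          show "?q s < e"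
          proof (cases "s = t")
            case True then show ?thesis using q0 e by simp
          next
            case False then show ?thesis using d(2)[of s] s by (simp add: dist_real_def)
          qed
        qed (rule d)
      qed
    next
      assume r: ?r
      show "(?q \<longlongrightarrow> 0) (at t within {0..})"
        unfolding Lim_within
      proof (intro allI impI)
        fix e :: real assume "e > 0"
        then obtain d where "d > 0" "\<forall>s\<ge>0. \<bar>s - t\<bar> < d \<longrightarrow> ?q s < e" using r by blast
        then show "\<exists>d>0. \<forall>s\<in>{0..}. 0 < dist s t \<and> dist s t < d \<longrightarrow> dist (?q s) 0 < e"
          by (intro exI[of _ d]) (auto simp: dist_real_def sq_int_nonneg)
      qed
    qed
    finally show ?thesis .
  qed
  then have "(\<forall>t\<ge>0. ((\<lambda>s. L2_norm_on {0<..<1} (\<lambda>x. z x s - z x t)) \<longlongrightarrow> 0) (at t within {0..})) \<longleftrightarrow> ?C" by meson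
  then show ?thesis unfolding continuous_L2_curve_def L2_space_iff by (rule conj_cong[OF refl])
next
  case False
  then show ?thesis unfolding continuous_L2_curve_def L2_space_iff by meson
qed

lemma has_L2_integral_iff:
  assumes z: "\<And>s. s \<in> {0..t} \<Longrightarrow> sq_integrable 0 1 (\<lambda>x. z x s)"
  shows "has_L2_integral z t Zt \<longleftrightarrow> sq_integrable 0 1 Zt \<and>
    (\<forall>e>0. \<exists>\<delta>>0. \<forall>D. D tagged_division_of {0..t} \<longrightarrow> (\<lambda>s. ball s \<delta>) fine D \<longrightarrow>
      sq_int 0 1 (\<lambda>x. (\<Sum>(s, k)\<in>D. measure lborel k *\<^sub>R z x s) - Zt x) < e)"
  (is "_ \<longleftrightarrow> _ \<and> ?C")
proof (cases "sq_integrable 0 1 Zt")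
  case True
  let ?E = "\<lambda>D x. (\<Sum>(s, k)\<in>D. measure lborel k *\<^sub>R z x s) - Zt x"
  have sq: "sq_integrable 0 1 (?E D)" if "D tagged_division_of {0..t}" for D
    unfolding split_def
    by (intro sq_integrable_diff sq_integrable_sum sq_integrable_scaleR z True)
      (use tag_in_interval[OF that] in auto)
  have eq: "L2_norm_on {0<..<1} (?E D) = sqrt (sq_int 0 1 (?E D))" if "D tagged_division_of {0..t}" for D
    by (rule L2_norm_on_eq[OF sq[OF that]])
  have "(\<forall>e>0. \<exists>\<delta>>0. \<forall>D. D tagged_division_of {0..t} \<longrightarrow> (\<lambda>s. ball s \<delta>) fine D \<longrightarrow>
      L2_norm_on {0<..<1} (?E D) < e) \<longleftrightarrow> ?C" (is "?l \<longleftrightarrow> _")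
  proof
    assume l: ?l
    show ?C
    proof (intro allI impI)
      fix e :: real assume "e > 0"
      then obtain \<delta> where \<delta>: "\<delta> > 0" "\<And>D. D tagged_division_of {0..t} \<Longrightarrow> (\<lambda>s. ball s \<delta>) fine D \<Longrightarrow>
        L2_norm_on {0<..<1} (?E D) < sqrt e" using l[rule_format, of "sqrt e"] by auto
      show "\<exists>\<delta>>0. \<forall>D. D tagged_division_of {0..t} \<longrightarrow> (\<lambda>s. ball s \<delta>) fine D \<longrightarrow> sq_int 0 1 (?E D) < e"
      proof (intro exI[of _ \<delta>] conjI allI impI)
        fix D assume D: "D tagged_division_of {0..t}" "(\<lambda>s. ball s \<delta>) fine D"
        show "sq_int 0 1 (?E D) < e" using \<delta>(2)[OF D] unfolding eq[OF D(1)] by (rule real_sqrt_less_iff[THEN iffD1])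
      qed (rule \<delta>)
    qed
  next
    assume l: ?C
    show ?l
    proof (intro allI impI)
      fix e :: real assume e: "e > 0"
      then obtain \<delta> where \<delta>: "\<delta> > 0" "\<And>D. D tagged_division_of {0..t} \<Longrightarrow> (\<lambda>s. ball s \<delta>) fine D \<Longrightarrow>
        sq_int 0 1 (?E D) < e\<^sup>2" using l[rule_format, of "e\<^sup>2"] by auto
      show "\<exists>\<delta>>0. \<forall>D. D tagged_division_of {0..t} \<longrightarrow> (\<lambda>s. ball s \<delta>) fine D \<longrightarrow> L2_norm_on {0<..<1} (?E D) < e"
      proof (intro exI[of _ \<delta>] conjI allI impI)
        fix D assume D: "D tagged_division_of {0..t}" "(\<lambda>s. ball s \<delta>) fine D"
        show "L2_norm_on {0<..<1} (?E D) < e" unfolding eq[OF D(1)] using \<delta>(2)[OF D] e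
          by (intro real_less_lsqrt sq_int_nonneg) auto
      qed (rule \<delta>)
    qed
  qed
  then show ?thesis unfolding has_L2_integral_def L2_space_iff by (rule conj_cong[OF refl])
next
  case False
  then show ?thesis unfolding has_L2_integral_def L2_space_iff by meson
qed

context wave_speed
begin

definition wave :: "(real \<Rightarrow> 'a::euclidean_space) \<Rightarrow> real \<Rightarrow> real \<Rightarrow> 'a" where
  "wave f t x = inverse (lam x) *\<^sub>R f (k x + t / T)"

text \<open>The time integral of \<^term>\<open>\<lambda>t. lam x *\<^sub>R wave f t x\<close>, after the substitution \<open>y = k x + s / T\<close>.\<close>

definition flux :: "(real \<Rightarrow> 'a::euclidean_space) \<Rightarrow> real \<Rightarrow> real \<Rightarrow> 'a" where
  "flux f t x = T *\<^sub>R integral {k x..k x + t / T} f"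

context
  fixes f :: "real \<Rightarrow> 'a::euclidean_space"
  assumes f: "\<And>X. sq_integrable 0 X f"
begin

lemma sq_integrable_wave:
  assumes "t \<ge> 0"
  shows "sq_integrable 0 1 (wave f t)"
  unfolding wave_def[abs_def]
  by (rule sq_integrable_travelling, rule sq_integrable_subinterval[OF f]) (use assms T_pos in auto)

lemma wave_continuous:
  assumes t: "t \<ge> 0" and e: "e > 0"
  shows "\<exists>\<delta>>0. \<forall>s\<ge>0. \<bar>s - t\<bar> < \<delta> \<longrightarrow> sq_int 0 1 (\<lambda>x. wave f s x - wave f t x) < e"
proof -
  \<comment> \<open>This tolerance compensates the factor \<open>T / \<epsilon>\<close> lost in
    passing from the profile to the wave.\<close>
  have e': "e * \<epsilon> / T > 0" using e eps T_pos by simp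
  obtain \<delta> where \<delta>: "\<delta> > 0" "\<And>r s. r \<in> {0..(t + T) / T} \<Longrightarrow> s \<in> {0..(t + T) / T} \<Longrightarrow> \<bar>r - s\<bar> < \<delta> \<Longrightarrow>
     sq_int 0 1 (\<lambda>y. f (y + r) - f (y + s)) < e * \<epsilon> / T"
    using translation_continuous[OF T_pos _ order_refl f e', of "t + T"] t T_pos by (auto simp: add_nonneg_nonneg)
  show ?thesis
  \<comment> \<open>The bound by \<open>T\<close> keeps \<open>s\<close> below \<open>t + T\<close>,
    the range in which \<open>\<delta>\<close> was obtained.\<close>
  proof (intro exI[of _ "min T (\<delta> * T)"] conjI allI impI)
    show "min T (\<delta> * T) > 0" using T_pos \<delta> by simp
    fix s assume s: "s \<ge> 0" "\<bar>s - t\<bar> < min T (\<delta> * T)"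
    have "\<bar>s / T - t / T\<bar> = \<bar>s - t\<bar> / T" using T_pos by (simp add: diff_divide_distrib[symmetric])
    also have "\<dots> < \<delta>" using s T_pos by (simp add: divide_less_eq)
    finally have d: "\<bar>s / T - t / T\<bar> < \<delta>" .
    have r: "s / T \<in> {0..(t + T) / T}" "t / T \<in> {0..(t + T) / T}"
      using s t T_pos by (auto intro!: divide_right_mono)
    let ?h = "\<lambda>y. f (y + s / T) - f (y + t / T)"
    have h: "sq_integrable 0 1 ?h"
      using s t T_pos by (intro sq_integrable_diff sq_integrable_shift sq_integrable_subinterval[OF f]) auto
    have "(\<lambda>x. wave f s x - wave f t x) = (\<lambda>x. inverse (lam x) *\<^sub>R ?h (k x + 0))"
      by (auto simp: wave_def scaleR_diff_right)
    then have "sq_int 0 1 (\<lambda>x. wave f s x - wave f t x) \<le> T / \<epsilon> * sq_int 0 1 ?h"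
      using sq_integrable_travelling(2)[of 0 ?h] h by simp
    also have "\<dots> < T / \<epsilon> * (e * \<epsilon> / T)"
      using T_pos eps \<delta>(2)[OF r d] by (intro mult_strict_left_mono) auto
    finally show "sq_int 0 1 (\<lambda>x. wave f s x - wave f t x) < e" using T_pos eps by simp
  qed
qed

lemma sq_integrable_flux:
  assumes t: "t \<ge> 0"
  shows "sq_integrable 0 1 (\<lambda>x. inverse (lam x) *\<^sub>R flux f t x)"
proof -
  have c: "continuous_on {0..1} (\<lambda>y. T *\<^sub>R integral {y..y + t / T} f)"
    by (intro continuous_intros continuous_on_window[OF T_pos t order_refl f])
  have "continuous_on {0..1} (flux f t)"
    unfolding flux_def[abs_def] by (rule continuous_on_compose2[OF c continuous_on_k]) (simp add: k_image)
  then show ?thesis by (intro sq_integrable_inverse_lam sq_integrable_continuous)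
qed

text \<open>The error for the waves is exactly \<open>inverse (lam x)\<close> times
  \<open>riemann_error\<close> at \<open>k x\<close>, so its square integral grows by at most
  \<open>T / \<epsilon>\<close>.\<close>

lemma wave_riemann_sums:
  assumes t: "t \<ge> 0" and e: "e > 0"
  shows "\<exists>\<delta>>0. \<forall>D. D tagged_division_of {0..t} \<longrightarrow> (\<lambda>s. ball s \<delta>) fine D \<longrightarrow>
      sq_int 0 1 (\<lambda>x. (\<Sum>(s, K)\<in>D. measure lborel K *\<^sub>R wave f s x) - inverse (lam x) *\<^sub>R flux f t x) < e"
proof -
  have e': "e * \<epsilon> / T > 0" using e eps T_pos by simp
  obtain \<delta> where \<delta>: "\<delta> > 0" "\<And>D. D tagged_division_of {0..t} \<Longrightarrow> (\<lambda>s. ball s \<delta>) fine D \<Longrightarrow>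
     sq_int 0 1 (riemann_error T t D f) < e * \<epsilon> / T"
    using riemann_error_tendsto[OF T_pos t order_refl f e'] by metis
  show ?thesis
  proof (intro exI[of _ \<delta>] conjI allI impI)
    fix D assume D: "D tagged_division_of {0..t}" "(\<lambda>s. ball s \<delta>) fine D"
    have h: "sq_integrable 0 1 (riemann_error T t D f)"
      by (rule riemann_error_bound[OF T_pos t order_refl f D(1)])
    have "(\<lambda>x. (\<Sum>(s, K)\<in>D. measure lborel K *\<^sub>R wave f s x) - inverse (lam x) *\<^sub>R flux f t x) =
       (\<lambda>x. inverse (lam x) *\<^sub>R riemann_error T t D f (k x + 0))"
      by (auto simp: fun_eq_iff wave_def flux_def riemann_error_def scaleR_diff_right scaleR_sum_right split_def
          mult.commute intro!: sum.cong)
    then have "sq_int 0 1 (\<lambda>x. (\<Sum>(s, K)\<in>D. measure lborel K *\<^sub>R wave f s x) - inverse (lam x) *\<^sub>R flux f t x)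
        \<le> T / \<epsilon> * sq_int 0 1 (riemann_error T t D f)"
      using sq_integrable_travelling(2)[of 0 "riemann_error T t D f"] h by simp
    also have "\<dots> < T / \<epsilon> * (e * \<epsilon> / T)"
      using T_pos eps \<delta>(2)[OF D] by (intro mult_strict_left_mono) auto
    finally show "sq_int 0 1 (\<lambda>x. (\<Sum>(s, K)\<in>D. measure lborel K *\<^sub>R wave f s x) - inverse (lam x) *\<^sub>R flux f t x) < e"
      using T_pos eps by simp
  qed (rule \<delta>)
qed

lemma integral_inverse_lam_translate:
  assumes s: "s \<ge> 0" and x: "x \<in> {0..1}"
  shows "((\<lambda>x. inverse (lam x) *\<^sub>R f (k x + s)) has_integral T *\<^sub>R (integral {0..1 + s} f - integral {0..k x + s} f)) {0..x}"
proof -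
  have fs: "sq_integrable (k x) 1 (\<lambda>y. f (y + s))"
    using s k_in[OF x] by (intro sq_integrable_shift sq_integrable_subinterval[OF f]) auto
  have "(\<lambda>y. f (y + s)) absolutely_integrable_on {k x..k 0}"
    using sq_integrable_absolutely_integrable[OF fs] by simp
  note cov = change_of_variables(1)[of 0 x "\<lambda>y. f (y + s)"] change_of_variables(2)[of 0 x "\<lambda>y. f (y + s)", OF _ _ _ this]
  have "(\<lambda>x. inverse (lam x) *\<^sub>R f (k x + s)) integrable_on {0..x}"
    using cov(1) x sq_integrable_absolutely_integrable[OF fs] set_lebesgue_integral_eq_integral(1) by force
  moreover have "integral {k x..1} (\<lambda>y. f (y + s)) = integral {k x + s..1 + s} f"
    using has_integral_affine[of f 1 "k x" s 1] sq_integrable_integrable[OF sq_integrable_subinterval[OF f[of "1 + s"], of "k x + s" "1 + s"]] s k_in[OF x]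
    by (simp add: integral_unique)
  moreover have "integral {k x + s..1 + s} f = integral {0..1 + s} f - integral {0..k x + s} f"
    using Henstock_Kurzweil_Integration.integral_combine[of 0 "k x + s" "1 + s" f] s k_in[OF x]
      sq_integrable_integrable[OF f[of "1 + s"]] by (simp add: algebra_simps)
  ultimately show ?thesis using cov(2) x by (simp add: has_integral_iff)
qed

lemma flux_eq:
  assumes "t \<ge> 0" "x \<in> {0..1}"
  shows "flux f t x = T *\<^sub>R (integral {0..k x + t / T} f - integral {0..k x} f)"
  unfolding flux_def using integral_window[OF T_pos assms(1) order_refl f k_in[OF assms(2)]] by simp

text \<open>Moving \<open>x\<close> moves both ends of the window \<open>{k x..k x + t / T}\<close>,
  so the derivative is a difference of two values of \<open>f\<close>, each weighted by
  \<open>inverse (lam x)\<close>: the wave at time 0 minus the wave at time \<open>t\<close>, as the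
  mild equation requires.\<close>

lemma H1_flux:
  assumes t: "t \<ge> 0"
  shows "H1_with_derivative (flux f t) (\<lambda>x. wave f 0 x - wave f t x)"
  unfolding H1_with_derivative_iff
proof (intro conjI ballI)
  show "sq_integrable 0 1 (\<lambda>x. wave f 0 x - wave f t x)" by (intro sq_integrable_diff sq_integrable_wave t) simp
  fix x :: real assume x: "x \<in> {0..1}"
  have tT: "t / T \<ge> 0" using t T_pos by simp
  have "((\<lambda>x. wave f 0 x - wave f t x) has_integral
    T *\<^sub>R (integral {0..1} f - integral {0..k x} f) - T *\<^sub>R (integral {0..1 + t / T} f - integral {0..k x + t / T} f)) {0..x}"
    using has_integral_diff[OF integral_inverse_lam_translate[OF _ x, of 0] integral_inverse_lam_translate[OF tT x]]
    by (simp add: wave_def)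
  then have I: "integral {0..x} (\<lambda>x. wave f 0 x - wave f t x) =
    T *\<^sub>R (integral {0..1} f - integral {0..k x} f) - T *\<^sub>R (integral {0..1 + t / T} f - integral {0..k x + t / T} f)"
    by (rule integral_unique)
  then show "flux f t x = flux f t 0 + integral {0..x} (\<lambda>x. wave f 0 x - wave f t x)"
    unfolding I flux_eq[OF t x] using flux_eq[OF t, of 0] by (simp add: algebra_simps)
qed

lemma wave_is_solution:
  assumes z: "\<And>t. t \<ge> 0 \<Longrightarrow> negligible {x\<in>{0..1}. z x t \<noteq> wave f t x}"
  shows "continuous_L2_curve z"
    and "t \<ge> 0 \<Longrightarrow> has_L2_integral z t (\<lambda>x. inverse (lam x) *\<^sub>R flux f t x)"
proof -
  have z': "negligible {x\<in>{0..1}. wave f t x \<noteq> z x t}" if "t \<ge> 0" for t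
    by (rule negligible_subset[OF z[OF that]]) auto
  have sz: "sq_integrable 0 1 (\<lambda>x. z x t)" if "t \<ge> 0" for t
    by (rule sq_integrable_spike[OF sq_integrable_wave[OF that] z'[OF that]])
  have "sq_int 0 1 (\<lambda>x. z x s - z x t) = sq_int 0 1 (\<lambda>x. wave f s x - wave f t x)" if "s \<ge> 0" "t \<ge> 0" for s t
    by (rule sq_int_spike, rule negligible_subset[OF negligible_Un[OF z[OF that(1)] z[OF that(2)]]]) auto
  then show "continuous_L2_curve z"
    unfolding continuous_L2_curve_iff using sz wave_continuous by simp
  assume t: "t \<ge> 0"
  have eq: "sq_int 0 1 (\<lambda>x. (\<Sum>(s, K)\<in>D. measure lborel K *\<^sub>R z x s) - inverse (lam x) *\<^sub>R flux f t x) =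
      sq_int 0 1 (\<lambda>x. (\<Sum>(s, K)\<in>D. measure lborel K *\<^sub>R wave f s x) - inverse (lam x) *\<^sub>R flux f t x)"
    if D: "D tagged_division_of {0..t}" for D
  proof (rule sq_int_spike)
    \<comment> \<open>The exceptional set depends on the time, but a Riemann sum sees only finitely
      many times.\<close>
    let ?N = "\<Union>d\<in>D. {x\<in>{0..1}. z x (fst d) \<noteq> wave f (fst d) x}"
    have "negligible {x\<in>{0..1}. z x (fst d) \<noteq> wave f (fst d) x}" if "d \<in> D" for d
      by (rule z) (use tag_in_interval[OF D, of "fst d" "snd d"] that in auto)
    moreover have "finite D" using D by blast
    ultimately have N: "negligible ?N" by (intro negligible_Union finite_imageI) blast+
    have eq: "(\<Sum>(s, K)\<in>D. measure lborel K *\<^sub>R z x s) = (\<Sum>(s, K)\<in>D. measure lborel K *\<^sub>R wave f s x)" if "x \<in> {0..1} - ?N" for x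
      by (rule sum.cong) (use that in auto)
    show "negligible {x \<in> {0..1}. (\<Sum>(s, K)\<in>D. measure lborel K *\<^sub>R z x s) - inverse (lam x) *\<^sub>R flux f t x \<noteq>
        (\<Sum>(s, K)\<in>D. measure lborel K *\<^sub>R wave f s x) - inverse (lam x) *\<^sub>R flux f t x}" (is "negligible ?M")
    proof (rule negligible_subset[OF N])
      show "?M \<subseteq> ?N"
      proof
        fix x assume x: "x \<in> ?M"
        show "x \<in> ?N"
        proof (rule ccontr)
          assume "x \<notin> ?N"
          then show False using x eq[of x] by simp
        qed
      qed
    qed
  qed
  show "has_L2_integral z t (\<lambda>x. inverse (lam x) *\<^sub>R flux f t x)"
    by (subst has_L2_integral_iff) (use sz sq_integrable_flux[OF t] wave_riemann_sums[OF t] eq in auto)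
qed

end

end

section \<open>Mild solutions are travelling waves\<close>

text \<open>Joint continuity is what later makes the potential in the transport argument
  differentiable as a function of two variables.\<close>

lemma continuous_on_Times_uniform:
  fixes V :: "real \<Rightarrow> real \<Rightarrow> 'a::real_normed_vector"
  assumes V: "\<And>t. t \<in> Y \<Longrightarrow> continuous_on X (\<lambda>x. V x t)"
    and u: "\<And>t e. t \<in> Y \<Longrightarrow> e > 0 \<Longrightarrow> \<exists>\<delta>>0. \<forall>s\<in>Y. \<bar>s - t\<bar> < \<delta> \<longrightarrow> (\<forall>x\<in>X. norm (V x s - V x t) \<le> e)"
  shows "continuous_on (X \<times> Y) (\<lambda>(x, t). V x t)"
  unfolding continuous_on_iff
proof (intro ballI allI impI)
  fix p :: "real \<times> real" and e :: real
  assume p: "p \<in> X \<times> Y" and e: "0 < e"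
  obtain x t where xt: "p = (x, t)" "x \<in> X" "t \<in> Y" using p by auto
  obtain \<delta> where \<delta>: "\<delta> > 0" "\<And>s x. s \<in> Y \<Longrightarrow> \<bar>s - t\<bar> < \<delta> \<Longrightarrow> x \<in> X \<Longrightarrow> norm (V x s - V x t) \<le> e / 2"
    using u[OF xt(3), of "e / 2"] e by auto
  obtain \<eta> where \<eta>: "\<eta> > 0" "\<And>y. y \<in> X \<Longrightarrow> dist y x < \<eta> \<Longrightarrow> dist (V y t) (V x t) < e / 2"
    using V[OF xt(3)] xt(2) e unfolding continuous_on_iff by (meson half_gt_zero)
  show "\<exists>d>0. \<forall>q\<in>X \<times> Y. dist q p < d \<longrightarrow> dist (case q of (x, t) \<Rightarrow> V x t) (case p of (x, t) \<Rightarrow> V x t) < e"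
  proof (intro exI[of _ "min \<delta> \<eta>"] conjI ballI impI)
    fix q assume q: "q \<in> X \<times> Y" "dist q p < min \<delta> \<eta>"
    obtain y s where ys: "q = (y, s)" "y \<in> X" "s \<in> Y" using q by auto
    have d: "dist y x < \<eta>" "\<bar>s - t\<bar> < \<delta>"
      using q(2) dist_fst_le[of q p] dist_snd_le[of q p] by (auto simp: ys xt dist_real_def)
    have "dist (V y s) (V x t) \<le> dist (V y s) (V y t) + dist (V y t) (V x t)" by (rule dist_triangle)
    also have "\<dots> < e / 2 + e / 2"
      using \<delta>(2)[OF ys(3) d(2) ys(2)] \<eta>(2)[OF ys(2) d(1)] by (intro add_le_less_mono) (auto simp: dist_norm)
    finally show "dist (case q of (x, t) \<Rightarrow> V x t) (case p of (x, t) \<Rightarrow> V x t) < e" by (simp add: xt ys)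
  qed (use \<delta> \<eta> in auto)
qed

lemma integral_right_has_vector_derivative:
  fixes g :: "real \<Rightarrow> 'a::banach"
  assumes g: "continuous_on {0..1} g" and x: "x \<in> {0..1}"
  shows "((\<lambda>x. integral {x..1} g) has_vector_derivative - g x) (at x within {0..1})"
proof -
  have "((\<lambda>x. integral {0..1} g - integral {0..x} g) has_vector_derivative 0 - g x) (at x within {0..1})"
    by (intro has_vector_derivative_diff has_vector_derivative_const integral_has_vector_derivative g x)
  moreover have "integral {0..1} g - integral {0..y} g = integral {y..1} g" if "y \<in> {0..1}" for y
    using Henstock_Kurzweil_Integration.integral_combine[of 0 y 1 g] that integrable_continuous_interval[OF g]
    by (simp add: algebra_simps)
  ultimately show ?thesis
    using has_vector_derivative_transform[OF x, of "\<lambda>x. integral {x..1} g" "\<lambda>x. integral {0..1} g - integral {0..x} g"] by simp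
qed

lemma vector_derivative_unique_within_Icc:
  fixes f :: "real \<Rightarrow> 'a::euclidean_space"
  assumes "(f has_vector_derivative u) (at x within {a..b})" "(f has_vector_derivative v) (at x within {a..b})"
    "a < b" "x \<in> {a..b}"
  shows "u = v"
  by (rule vector_derivative_unique_within_closed_interval[of a b x f]) (use assms in \<open>simp_all add: cbox_interval\<close>)

text \<open>The integral form of \<open>T \<partial>\<^sub>t B = \<partial>\<^sub>x B\<close> for a merely continuous \<open>B\<close>: the integrated identity says that
  the 1-form \<open>T B dx + B dt\<close> is closed, its potential is \<open>C\<^sup>1\<close> and constant along characteristics, and \<open>B\<close> is
  recovered by differentiating the potential in \<open>x\<close>.\<close>

lemma transport_constant_on_characteristics:
  fixes B :: "real \<Rightarrow> real \<Rightarrow> 'a::euclidean_space"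
  assumes T: "T > 0" and cont: "continuous_on ({0..1} \<times> {0..}) (\<lambda>(x, t). B x t)" and b: "continuous_on {0..1} b"
    and eq: "\<And>x t. x \<in> {0..1} \<Longrightarrow> t \<ge> 0 \<Longrightarrow>
      T *\<^sub>R integral {x..1} (\<lambda>y. B y t + b y) = integral {0..t} (\<lambda>s. B 1 s - B x s)"
  shows "x \<in> {0..1} \<Longrightarrow> B x 0 = - b x"
    and "x \<in> {0..1} \<Longrightarrow> t \<ge> 0 \<Longrightarrow> h \<ge> 0 \<Longrightarrow> x - h / T \<in> {0..1} \<Longrightarrow> B (x - h / T) (t + h) = B x t"
proof -
  have cx: "continuous_on {0..1} (\<lambda>x. B x t)" if "t \<ge> 0" for t
    using continuous_on_compose2[OF cont, of "{0..1}" "\<lambda>x. (x, t)"] that by (force intro: continuous_intros)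
  have ct: "continuous_on {0..} (\<lambda>t. B x t)" if "x \<in> {0..1}" for x
    using continuous_on_compose2[OF cont, of "{0..}" "\<lambda>t. (x, t)"] that by (force intro: continuous_intros)
  have "B x 0 + b x = 0" if x: "x \<in> {0..1}" for x
  proof -
    have "((\<lambda>x. integral {x..1} (\<lambda>y. B y 0 + b y)) has_vector_derivative - (B x 0 + b x)) (at x within {0..1})"
      by (intro integral_right_has_vector_derivative continuous_on_add cx b x) simp
    moreover have "integral {y..1} (\<lambda>y. B y 0 + b y) = 0" if "y \<in> {0..1}" for y
      using eq[OF that, of 0] T by simp
    ultimately have "((\<lambda>x. 0) has_vector_derivative - (B x 0 + b x)) (at x within {0..1})"
      using has_vector_derivative_transform[OF x, of "\<lambda>x. 0" "\<lambda>x. integral {x..1} (\<lambda>y. B y 0 + b y)"] by simp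
    from vector_derivative_unique_within_Icc[OF this has_vector_derivative_const] x
    have "- (B x 0 + b x) = 0" by simp
    then show ?thesis by (metis neg_equal_0_iff_equal)
  qed
  then show "x \<in> {0..1} \<Longrightarrow> B x 0 = - b x" by (simp add: eq_neg_iff_add_eq_0)
  \<comment> \<open>The potential, up to sign. In this form it can be differentiated in
    \<open>x\<close>; the hypothesis \<open>eq\<close> rewrites it into a form that can be
    differentiated in \<open>t\<close>. The partial derivatives are
    \<open>- (T *\<^sub>R B x t)\<close> and \<open>- B x t\<close>.\<close>
  define \<Phi> where "\<Phi> x t = T *\<^sub>R integral {x..1} (\<lambda>y. B y t) - integral {0..t} (\<lambda>s. B 1 s)" for x t
  have \<Phi>': "\<Phi> x t = - (T *\<^sub>R integral {x..1} b) - integral {0..t} (\<lambda>s. B x s)" if "x \<in> {0..1}" "t \<ge> 0" for x t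
  proof -
    have sub: "{x..1} \<subseteq> {0..1}" using that by auto
    have i: "(\<lambda>y. B y t) integrable_on {x..1}" "b integrable_on {x..1}"
      using cx[OF that(2)] b by (auto intro!: integrable_continuous_interval continuous_on_subset[OF _ sub])
    have j: "(\<lambda>s. B y s) integrable_on {0..t}" if "y \<in> {0..1}" for y
      by (rule integrable_continuous_interval, rule continuous_on_subset[OF ct[OF that]]) auto
    show ?thesis
      using eq[OF that] i j[of 1] j[OF that(1)]
      by (simp add: \<Phi>_def integral_add integral_diff algebra_simps)
  qed
  have dx: "((\<lambda>x. \<Phi> x t) has_vector_derivative - (T *\<^sub>R B x t)) (at x within {0..1})" if "x \<in> {0..1}" "t \<ge> 0" for x t
  proof -
    have "((\<lambda>x. T *\<^sub>R integral {x..1} (\<lambda>y. B y t) - integral {0..t} (\<lambda>s. B 1 s)) has_vector_derivative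
        T *\<^sub>R (- B x t) - 0) (at x within {0..1})"
      by (intro has_vector_derivative_diff has_vector_derivative_const
          bounded_linear.has_vector_derivative[OF bounded_linear_scaleR_right] integral_right_has_vector_derivative cx that)
    then show ?thesis by (simp add: \<Phi>_def)
  qed
  have dt: "((\<lambda>t. \<Phi> x t) has_vector_derivative - B x t) (at t within {0..R})" if "x \<in> {0..1}" "t \<in> {0..R}" for x t R
  proof -
    have "((\<lambda>t. - (T *\<^sub>R integral {x..1} b) - integral {0..t} (\<lambda>s. B x s)) has_vector_derivative 0 - B x t) (at t within {0..R})"
      using that by (intro has_vector_derivative_diff has_vector_derivative_const integral_has_vector_derivative
          continuous_on_subset[OF ct]) auto
    then show ?thesis
      using has_vector_derivative_transform[OF that(2), of "\<lambda>t. \<Phi> x t" "\<lambda>t. - (T *\<^sub>R integral {x..1} b) - integral {0..t} (\<lambda>s. B x s)"]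
        \<Phi>'[OF that(1)] by simp
  qed
  have d: "((\<lambda>(x, t). \<Phi> x t) has_derivative (\<lambda>(tx, ty). tx *\<^sub>R - (T *\<^sub>R B x t) + ty *\<^sub>R (- B x t))) (at (x, t) within {0..1} \<times> {0..R})"
    if xt: "x \<in> {0..1}" "t \<in> {0..R}" for x t R
  proof -
    have "((\<lambda>(x, y). \<Phi> x y) has_derivative (\<lambda>(tx, ty). tx *\<^sub>R - (T *\<^sub>R B x t) + blinfun_apply (blinfun_scaleR_left (- B x t)) ty))
        (at (x, t) within {0..1} \<times> {0..R})"
    proof (rule has_derivative_partialsI)
      show "((\<lambda>x. \<Phi> x t) has_derivative (\<lambda>h. h *\<^sub>R - (T *\<^sub>R B x t))) (at x within {0..1})"
        using dx[of x t] xt by (simp add: has_vector_derivative_def)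
      show "((\<lambda>y. \<Phi> x y) has_derivative blinfun_apply (blinfun_scaleR_left (- B x y))) (at y within {0..R})"
        if "x \<in> {0..1}" "y \<in> {0..R}" for x y
        using dt[OF that] by (simp add: has_vector_derivative_def)
      have "continuous_on ({0..1} \<times> {0..R}) (\<lambda>p. blinfun_scaleR_left (- (case p of (x, y) \<Rightarrow> B x y)))"
        by (intro continuous_intros continuous_on_subset[OF cont]) auto
      then show "continuous (at (x, t) within {0..1} \<times> {0..R}) (\<lambda>(x, y). blinfun_scaleR_left (- B x y))"
        using xt by (auto simp: continuous_on_eq_continuous_within split_def)
    qed (use xt in auto)
    then show ?thesis by simp
  qed
  \<comment> \<open>In the direction \<open>(- 1 / T, 1)\<close> the two partial derivatives
    cancel.\<close>
  have char: "\<Phi> (x - h / T) (t + h) = \<Phi> x t" if "x \<in> {0..1}" "t \<ge> 0" "h \<ge> 0" "x - h / T \<in> {0..1}" for x t h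
  proof -
    define \<phi> where "\<phi> s = \<Phi> (x - s / T) (t + s)" for s
    have line: "(x - s / T, t + s) \<in> {0..1} \<times> {0..t + h}" if "s \<in> {0..h}" for s
    proof -
      have "0 \<le> s / T" "s / T \<le> h / T" using that T by (auto intro: divide_right_mono)
      then show ?thesis using that \<open>x \<in> {0..1}\<close> \<open>x - h / T \<in> {0..1}\<close> \<open>t \<ge> 0\<close> by auto
    qed
    have "(\<phi> has_derivative (\<lambda>_. 0)) (at s within {0..h})" if s: "s \<in> {0..h}" for s
    proof -
      have g: "((\<lambda>s. (x - s / T, t + s)) has_derivative (\<lambda>h. (- h / T, h))) (at s within {0..h})"
        using T by (auto intro!: derivative_eq_intros)
      have sub: "(\<lambda>s. (x - s / T, t + s)) ` {0..h} \<subseteq> {0..1} \<times> {0..t + h}" using line by blast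
      have dd: "((\<lambda>(x, t). \<Phi> x t) has_derivative (\<lambda>(tx, ty). tx *\<^sub>R - (T *\<^sub>R B (fst q) (snd q)) + ty *\<^sub>R - B (fst q) (snd q))) (at q within {0..1} \<times> {0..t + h})"
        if "q \<in> {0..1} \<times> {0..t + h}" for q
        using d[of "fst q" "snd q" "t + h"] that by auto
      show ?thesis using has_derivative_in_compose2[OF dd sub s g] T by (simp add: \<phi>_def[abs_def])
    qed
    then have "\<exists>c. \<forall>s\<in>{0..h}. \<phi> s = c"
      by (intro has_derivative_zero_constant) auto
    then have "\<phi> h = \<phi> 0" using \<open>h \<ge> 0\<close> by auto
    then show ?thesis by (simp add: \<phi>_def)
  qed
  \<comment> \<open>Both sides come from differentiating the same function of \<open>x\<close> on
    \<open>{h / T..1}\<close>. The condition \<open>h < T\<close> keeps this interval nondegenerate,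
    without which the derivative would not be unique.\<close>
  have main: "B (x - h / T) (t + h) = B x t" if "x \<in> {0..1}" "t \<ge> 0" "h \<ge> 0" "x - h / T \<in> {0..1}" "h < T" for x t h
  proof -
    have hT: "0 \<le> h / T" "h / T < 1" using that T by (auto simp: divide_less_eq)
    have x: "x \<in> {h / T..1}" using that by auto
    have "((\<lambda>x. \<Phi> x t) has_vector_derivative - (T *\<^sub>R B x t)) (at x within {h / T..1})"
      using dx[OF that(1,2)] by (rule has_vector_derivative_within_subset) (use hT in auto)
    moreover have "((\<lambda>x. \<Phi> x t) has_vector_derivative - (T *\<^sub>R B (x - h / T) (t + h))) (at x within {h / T..1})"
    proof -
      have "((\<lambda>y. \<Phi> y (t + h)) has_vector_derivative - (T *\<^sub>R B (x - h / T) (t + h))) (at (x - h / T) within (\<lambda>x. x - h / T) ` {h / T..1})"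
      proof (intro has_vector_derivative_within_subset[OF dx])
        have "(\<lambda>x. x - a) ` {a..1} \<subseteq> {0..1}" if "0 \<le> a" for a :: real using that by auto
        then show "(\<lambda>x. x - h / T) ` {h / T..1} \<subseteq> {0..1}" using hT(1) by blast
      qed (use that in auto)
      then have "(((\<lambda>y. \<Phi> y (t + h)) \<circ> (\<lambda>x. x - h / T)) has_vector_derivative 1 *\<^sub>R - (T *\<^sub>R B (x - h / T) (t + h))) (at x within {h / T..1})"
        by (intro vector_diff_chain_within) (auto intro!: derivative_eq_intros)
      then have D: "((\<lambda>x. \<Phi> (x - h / T) (t + h)) has_vector_derivative - (T *\<^sub>R B (x - h / T) (t + h))) (at x within {h / T..1})"
        by (simp add: o_def)
      have E: "\<Phi> y t = \<Phi> (y - h / T) (t + h)" if "y \<in> {h / T..1}" for y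
        using char[of y t h] that \<open>t \<ge> 0\<close> \<open>h \<ge> 0\<close> hT by simp
      show ?thesis by (rule has_vector_derivative_transform[OF x E D])
    qed
    ultimately have "- (T *\<^sub>R B x t) = - (T *\<^sub>R B (x - h / T) (t + h))"
      using hT x by (intro vector_derivative_unique_within_Icc[of "\<lambda>x. \<Phi> x t" _ x "h / T" 1])
    then show ?thesis using T by simp
  qed
  show "B (x - h / T) (t + h) = B x t" if "x \<in> {0..1}" "t \<ge> 0" "h \<ge> 0" "x - h / T \<in> {0..1}"
  proof (cases "h < T")
    case False
    have "h / T \<le> 1" using that by auto
    then have "h \<le> T" using T by (simp add: divide_le_eq)
    then have h: "h = T" using False by simp
    then have x: "x = 1" using that T by simp
    \<comment> \<open>The full crossing \<open>h = T\<close> is composed of two half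
      crossings.\<close>
    have "B (1/2) (t + T / 2) = B 1 t" using main[of 1 t "T / 2"] that T by simp
    moreover have "B 0 (t + T) = B (1/2) (t + T / 2)" using main[of "1/2" "t + T / 2" "T / 2"] that T by (simp add: add.commute)
    ultimately show ?thesis using h x T by simp
  qed (use main that in blast)
qed

text \<open>By Cauchy-Schwarz, integration over a window is bounded by the L^2 norm, so the L^2
  Riemann sums turn into convergent real-variable Riemann sums with the same gauge. This exchange of
  space and time integrals takes the place of Fubini's theorem.\<close>

lemma has_L2_integral_window:
  fixes z :: "real \<Rightarrow> real \<Rightarrow> 'a::euclidean_space"
  assumes z: "\<And>s. s \<in> {0..t} \<Longrightarrow> sq_integrable 0 1 (\<lambda>x. z x s)" and Zt: "has_L2_integral z t Zt"
    and ab: "0 \<le> a" "a \<le> b" "b \<le> 1"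
  shows "((\<lambda>s. integral {a..b} (\<lambda>x. z x s)) has_integral integral {a..b} Zt) {0..t}"
  unfolding has_integral_real
proof (intro allI impI)
  fix e :: real assume e: "e > 0"
  have sZ: "sq_integrable 0 1 Zt" using Zt by (simp add: has_L2_integral_def L2_space_iff)
  have "\<forall>e>0. \<exists>\<delta>>0. \<forall>D. D tagged_division_of {0..t} \<longrightarrow> (\<lambda>s. ball s \<delta>) fine D \<longrightarrow>
      sq_int 0 1 (\<lambda>x. (\<Sum>(s, k)\<in>D. measure lborel k *\<^sub>R z x s) - Zt x) < e"
    using Zt has_L2_integral_iff[where z=z and t=t and Zt=Zt] z by blast
  from this[rule_format, of "e\<^sup>2"] e
  obtain \<delta> where \<delta>: "\<delta> > 0" "\<And>D. D tagged_division_of {0..t} \<Longrightarrow> (\<lambda>s. ball s \<delta>) fine D \<Longrightarrow>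
      sq_int 0 1 (\<lambda>x. (\<Sum>(s, k)\<in>D. measure lborel k *\<^sub>R z x s) - Zt x) < e\<^sup>2"
    by auto
  show "\<exists>\<gamma>. gauge \<gamma> \<and> (\<forall>\<D>. \<D> tagged_division_of {0..t} \<and> \<gamma> fine \<D> \<longrightarrow>
      norm ((\<Sum>(s, k)\<in>\<D>. measure lborel k *\<^sub>R integral {a..b} (\<lambda>x. z x s)) - integral {a..b} Zt) < e)"
  proof (intro exI[of _ "\<lambda>s. ball s \<delta>"] conjI allI impI)
    show "gauge (\<lambda>s. ball s \<delta>)" using \<delta> by (simp add: gauge_ball)
    fix D assume "D tagged_division_of {0..t} \<and> (\<lambda>s. ball s \<delta>) fine D"
    then have D: "D tagged_division_of {0..t}" "(\<lambda>s. ball s \<delta>) fine D" by auto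
    let ?S = "\<lambda>x. (\<Sum>d\<in>D. measure lborel (snd d) *\<^sub>R z x (fst d))"
    have zi: "sq_integrable 0 1 (\<lambda>x. z x (fst d))" if "d \<in> D" for d
      using tag_in_interval[OF D(1), of "fst d" "snd d"] that by (intro z) simp
    have E: "sq_integrable 0 1 (\<lambda>x. ?S x - Zt x)"
      by (intro sq_integrable_diff sq_integrable_sum sq_integrable_scaleR zi sZ)
    have sub: "g integrable_on {a..b}" if "sq_integrable 0 1 g" for g :: "real \<Rightarrow> 'a"
      by (intro sq_integrable_integrable sq_integrable_subinterval[OF that]) (use ab in auto)
    have fin: "finite D" using D(1) by blast
    have i: "(\<lambda>x. measure lborel (snd d) *\<^sub>R z x (fst d)) integrable_on {a..b}" if "d \<in> D" for d
      by (intro sub sq_integrable_scaleR zi that)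
    have "integral {a..b} (\<lambda>x. ?S x - Zt x) = integral {a..b} ?S - integral {a..b} Zt"
      by (intro integral_diff integrable_sum fin i sub sZ)
    also have "integral {a..b} ?S = (\<Sum>d\<in>D. measure lborel (snd d) *\<^sub>R integral {a..b} (\<lambda>x. z x (fst d)))"
      by (simp add: integral_sum[OF fin i])
    finally have "integral {a..b} (\<lambda>x. ?S x - Zt x) = (\<Sum>d\<in>D. measure lborel (snd d) *\<^sub>R integral {a..b} (\<lambda>x. z x (fst d))) - integral {a..b} Zt" .
    then have eq: "(\<Sum>(s, k)\<in>D. measure lborel k *\<^sub>R integral {a..b} (\<lambda>x. z x s)) - integral {a..b} Zt = integral {a..b} (\<lambda>x. ?S x - Zt x)"
      by (simp add: split_def)
    have "(norm (integral {a..b} (\<lambda>x. ?S x - Zt x)))\<^sup>2 \<le> (b - a) * sq_int a b (\<lambda>x. ?S x - Zt x)"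
      by (rule norm_integral_sq_le[OF sq_integrable_subinterval[OF E]]) (use ab in auto)
    also have "\<dots> \<le> 1 * sq_int 0 1 (\<lambda>x. ?S x - Zt x)"
      by (intro mult_mono sq_int_mono_interval[OF E] sq_int_nonneg) (use ab in auto)
    also have "\<dots> < e\<^sup>2" using \<delta>(2)[OF D] by (simp add: split_def)
    finally have "norm (integral {a..b} (\<lambda>x. ?S x - Zt x)) < e" using e by (simp add: power_less_imp_less_base)
    then show "norm ((\<Sum>(s, k)\<in>D. measure lborel k *\<^sub>R integral {a..b} (\<lambda>x. z x s)) - integral {a..b} Zt) < e"
      by (simp only: eq)
  qed
qed

lemma sq_integrable_combine:
  fixes f :: "real \<Rightarrow> 'a::euclidean_space"
  assumes ab: "sq_integrable a b f" and bc: "sq_integrable b c f" and le: "a \<le> b" "b \<le> c"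
  shows "sq_integrable a c f"
  unfolding sq_integrable_def
proof
  let ?g = "\<lambda>x. (if x \<in> {a..b} then f x else 0) + (if x \<in> {b..c} then f x else 0)"
  have m: "(\<lambda>x. if x \<in> {a..b} then f x else 0) \<in> borel_measurable lebesgue"
    "(\<lambda>x. if x \<in> {b..c} then f x else 0) \<in> borel_measurable lebesgue"
    using ab bc borel_measurable_if[of "{a..b}" f] borel_measurable_if[of "{b..c}" f]
    by (auto simp: sq_integrable_def simp del: atLeastAtMost_iff)
  then have "?g \<in> borel_measurable lebesgue" by (rule borel_measurable_add)
  then have g: "?g \<in> borel_measurable (lebesgue_on {a..c})" by (rule measurable_restrict_space1)
  have neg: "negligible {x\<in>{a..c}. ?g x \<noteq> f x}"
    by (rule negligible_subset[of "{b}"]) auto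
  show "f \<in> borel_measurable (lebesgue_on {a..c})"
    by (rule borel_measurable_lebesgue_on_spike[OF g _ neg]) simp
  show "(\<lambda>x. (norm (f x))\<^sup>2) integrable_on {a..c}"
    using ab bc le by (intro Henstock_Kurzweil_Integration.integrable_combine[of a b c]) (auto simp: sq_integrable_def)
qed

section \<open>Recovering the profile from a mild solution\<close>

context wave_speed
begin

text \<open>The witnesses of a mild solution, chosen for each \<open>t\<close> independently:
  nothing relates \<open>w t\<close> or \<open>Z t\<close> at different times except the conditions
  listed here.\<close>

context
  fixes z :: "real \<Rightarrow> real \<Rightarrow> 'a::euclidean_space" and z0 :: "real \<Rightarrow> 'a" and Z w d :: "real \<Rightarrow> real \<Rightarrow> 'a"
  assumes curve: "continuous_L2_curve z" and z0: "sq_integrable 0 1 z0"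
    and Z: "\<And>t. t \<ge> 0 \<Longrightarrow> has_L2_integral z t (Z t)"
    and wZ: "\<And>t. t \<ge> 0 \<Longrightarrow> negligible {x\<in>{0..1}. w t x \<noteq> lam x *\<^sub>R Z t x}"
    and H1: "\<And>t. t \<ge> 0 \<Longrightarrow> H1_with_derivative (w t) (d t)"
    and zd: "\<And>t. t \<ge> 0 \<Longrightarrow> negligible {x\<in>{0..1}. z x t - z0 x \<noteq> - d t x}"
begin

lemma sq_z: "t \<ge> 0 \<Longrightarrow> sq_integrable 0 1 (\<lambda>x. z x t)"
  using curve by (simp add: continuous_L2_curve_iff)

definition prim :: "real \<Rightarrow> real \<Rightarrow> 'a" where
  "prim x t = integral {0..x} (\<lambda>y. z y t)"

definition prim0 :: "real \<Rightarrow> 'a" where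
  "prim0 x = integral {0..x} z0"

lemma w_eq:
  assumes t: "t \<ge> 0" and x: "x \<in> {0..1}"
  shows "w t x = w t 0 - prim x t + prim0 x"
proof -
  have sub: "{0..x} \<subseteq> {0..1}" using x by auto
  have "w t x = w t 0 + integral {0..x} (d t)"
    using H1[OF t] x unfolding H1_with_derivative_iff by blast
  also have "integral {0..x} (d t) = integral {0..x} (\<lambda>x. z0 x - z x t)"
  proof (rule integral_spike[OF zd[OF t]])
    show "z0 y - z y t = d t y" if "y \<in> {0..x} - {x \<in> {0..1}. z x t - z0 x \<noteq> - d t x}" for y
      using that sub by (auto simp: algebra_simps)
  qed
  also have "\<dots> = prim0 x - prim x t"
    unfolding prim_def prim0_def
    using sq_z[OF t] z0 sub by (intro integral_diff) (auto intro: integrable_on_subinterval sq_integrable_integrable)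
  finally show ?thesis by simp
qed

lemma continuous_on_prim: "t \<ge> 0 \<Longrightarrow> continuous_on {0..1} (\<lambda>x. prim x t)"
  unfolding prim_def by (intro indefinite_integral_continuous_1 sq_integrable_integrable sq_z)

lemma continuous_on_prim0: "continuous_on {0..1} prim0"
  unfolding prim0_def by (intro indefinite_integral_continuous_1 sq_integrable_integrable z0)

text \<open>Cauchy-Schwarz bounds the difference of the primitives at every \<open>x\<close> by the
  L^2 distance of the states, which does not involve \<open>x\<close>.\<close>

lemma prim_uniform:
  assumes t: "t \<ge> 0" and e: "e > 0"
  shows "\<exists>\<delta>>0. \<forall>s\<in>{0..}. \<bar>s - t\<bar> < \<delta> \<longrightarrow> (\<forall>x\<in>{0..1}. norm (prim x s - prim x t) \<le> e)"
proof -
  obtain \<delta> where \<delta>: "\<delta> > 0" "\<And>s. s \<ge> 0 \<Longrightarrow> \<bar>s - t\<bar> < \<delta> \<Longrightarrow> sq_int 0 1 (\<lambda>x. z x s - z x t) < e\<^sup>2"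
    using curve t e unfolding continuous_L2_curve_iff by (meson zero_less_power)
  show ?thesis
  proof (intro exI[of _ \<delta>] conjI ballI impI)
    fix s x :: real assume s: "s \<in> {0..}" "\<bar>s - t\<bar> < \<delta>" and x: "x \<in> {0..1}"
    have E: "sq_integrable 0 1 (\<lambda>x. z x s - z x t)" using s t by (intro sq_integrable_diff sq_z) auto
    have eq: "prim x s - prim x t = integral {0..x} (\<lambda>x. z x s - z x t)"
      unfolding prim_def
      by (rule integral_diff[symmetric]; rule integrable_on_subinterval[OF sq_integrable_integrable[OF sq_z]])
        (use s t x in auto)
    have le: "(norm (integral {0..x} (\<lambda>x. z x s - z x t)))\<^sup>2 \<le> e\<^sup>2"
    proof -
      have "(norm (integral {0..x} (\<lambda>x. z x s - z x t)))\<^sup>2 \<le> (x - 0) * sq_int 0 x (\<lambda>x. z x s - z x t)"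
        by (rule norm_integral_sq_le[OF sq_integrable_subinterval[OF E]]) (use x in auto)
      also have "\<dots> \<le> 1 * sq_int 0 1 (\<lambda>x. z x s - z x t)"
        by (intro mult_mono sq_int_mono_interval[OF E] sq_int_nonneg) (use x in auto)
      also have "\<dots> \<le> e\<^sup>2" using \<delta>(2)[of s] s by auto
      finally show ?thesis .
    qed
    show "norm (prim x s - prim x t) \<le> e"
      unfolding eq by (rule power2_le_imp_le[OF le]) (use e in simp)
  qed (rule \<delta>)
qed

definition V :: "real \<Rightarrow> real \<Rightarrow> 'a" where "V x t = prim (k_inv x) t"
definition v0 :: "real \<Rightarrow> 'a" where "v0 x = prim0 (k_inv x)"
text \<open>In the travel-time coordinate this is \<open>w t\<close> with the contribution
  \<open>v0\<close> of the initial state removed. It will turn out to be, up to a constant,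
  \<open>T\<close> times the primitive of the profile at \<open>x + t / T\<close>.\<close>

definition B :: "real \<Rightarrow> real \<Rightarrow> 'a" where "B x t = w t 0 - V x t"

lemma k_inv_image: "k_inv ` {0..1} \<subseteq> {0..1}"
  using k_inv_in by blast

lemma k_inv_0 [simp]: "k_inv 0 = 1" and k_inv_1 [simp]: "k_inv 1 = 0"
  using k_inv_k[of 1] k_inv_k[of 0] by auto

lemma continuous_on_V: "t \<ge> 0 \<Longrightarrow> continuous_on {0..1} (\<lambda>x. V x t)"
  unfolding V_def by (rule continuous_on_compose2[OF continuous_on_prim continuous_on_k_inv k_inv_image])

lemma continuous_on_v0: "continuous_on {0..1} v0"
  unfolding v0_def[abs_def] by (rule continuous_on_compose2[OF continuous_on_prim0 continuous_on_k_inv k_inv_image])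

lemma V_uniform:
  assumes t: "t \<ge> 0" and e: "e > 0"
  shows "\<exists>\<delta>>0. \<forall>s\<in>{0..}. \<bar>s - t\<bar> < \<delta> \<longrightarrow> (\<forall>x\<in>{0..1}. norm (V x s - V x t) \<le> e)"
  using prim_uniform[OF assms] k_inv_in unfolding V_def by meson

lemma V_1 [simp]: "V 1 t = 0"
  by (simp add: V_def prim_def)

lemma w_k_inv: "t \<ge> 0 \<Longrightarrow> x \<in> {0..1} \<Longrightarrow> w t (k_inv x) = B x t + v0 x"
  using w_eq[OF _ k_inv_in] by (simp add: B_def V_def v0_def)

text \<open>The integral of \<open>Z t\<close> over \<open>{0..k_inv x}\<close> is computed twice:
  as that of \<open>w t / lam\<close>, by substituting \<open>k\<close>, and as the time integral of
  the space primitives of \<open>z\<close>. As \<open>V 1 s = 0\<close>, the right-hand integrand is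
  also \<open>B 1 s - B x s\<close>.\<close>

lemma integral_identity:
  assumes t: "t \<ge> 0" and x: "x \<in> {0..1}"
  shows "T *\<^sub>R integral {x..1} (\<lambda>y. B y t + v0 y) = integral {0..t} (\<lambda>s. V x s)"
proof -
  have X: "k_inv x \<in> {0..1}" by (rule k_inv_in[OF x])
  let ?h = "\<lambda>y. w t (k_inv y)"
  have sub: "{x..1} \<subseteq> {0..1}" using x by auto
  have "continuous_on {0..1} (\<lambda>y. B y t + v0 y)"
    unfolding B_def by (intro continuous_intros continuous_on_V t continuous_on_v0)
  then have "continuous_on {x..1} (\<lambda>y. B y t + v0 y)" by (rule continuous_on_subset[OF _ sub])
  then have "continuous_on {x..1} ?h"
    by (rule continuous_on_eq) (use w_k_inv[OF t] sub in auto)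
  then have "?h absolutely_integrable_on {k (k_inv x)..k 0}"
    using x by (simp add: absolutely_integrable_continuous_real)
  from change_of_variables(2)[OF _ _ _ this] X x
  have "T *\<^sub>R integral {x..1} ?h = integral {0..k_inv x} (\<lambda>y. inverse (lam y) *\<^sub>R ?h (k y))" by simp
  also have "\<dots> = integral {0..k_inv x} (Z t)"
  proof (rule integral_spike[OF negligible_Un[OF negligible_bad wZ[OF t]]])
    fix y assume y: "y \<in> {0..k_inv x} - (bad \<union> {x \<in> {0..1}. w t x \<noteq> lam x *\<^sub>R Z t x})"
    then have y1: "y \<in> {0..1}" using X by auto
    then have "w t y = lam y *\<^sub>R Z t y" "lam y > 0" using y not_bad(3)[of y] by auto
    then show "Z t y = inverse (lam y) *\<^sub>R ?h (k y)" using y1 by simp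
  qed
  also have "\<dots> = integral {0..t} (\<lambda>s. V x s)"
    using has_L2_integral_window[OF sq_z Z[OF t], of 0 "k_inv x"] X by (simp add: integral_unique V_def prim_def)
  finally show ?thesis
    using integral_cong[of "{x..1}" ?h "\<lambda>y. B y t + v0 y"] w_k_inv[OF t] sub by (auto simp: subset_iff)
qed

text \<open>Nothing is assumed about how \<open>w t 0\<close> depends on \<open>t\<close>. The
  integral identity at \<open>x = 0\<close>, solved for \<open>w t 0\<close>, expresses it through
  \<open>V\<close> and \<open>v0\<close>, and \<open>V\<close> varies continuously with
  \<open>t\<close>.\<close>

lemma continuous_on_boundary_value: "continuous_on {0..} (\<lambda>t. w t 0)"
proof -
  have V0: "continuous_on {0..} (\<lambda>s. V 0 s)"
    unfolding continuous_on_iff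
  proof (intro ballI allI impI)
    fix t e :: real assume t: "t \<in> {0..}" and e: "0 < e"
    obtain \<delta> where "\<delta> > 0" "\<forall>s\<in>{0..}. \<bar>s - t\<bar> < \<delta> \<longrightarrow> (\<forall>x\<in>{0..1}. norm (V x s - V x t) \<le> e / 2)"
      using V_uniform[of t "e / 2"] t e by auto
    then show "\<exists>\<delta>>0. \<forall>s\<in>{0..}. dist s t < \<delta> \<longrightarrow> dist (V 0 s) (V 0 t) < e"
      using e by (intro exI[of _ \<delta>]) (force simp: dist_norm)
  qed
  define J where "J t = integral {0..1} (\<lambda>y. V y t)" for t
  have iV: "(\<lambda>y. V y t) integrable_on {0..1}" if "t \<ge> 0" for t
    by (rule integrable_continuous_interval[OF continuous_on_V[OF that]])
  have J: "continuous_on {0..} J"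
    unfolding continuous_on_iff
  proof (intro ballI allI impI)
    fix t e :: real assume t: "t \<in> {0..}" and e: "0 < e"
    obtain \<delta> where \<delta>: "\<delta> > 0" "\<forall>s\<in>{0..}. \<bar>s - t\<bar> < \<delta> \<longrightarrow> (\<forall>x\<in>{0..1}. norm (V x s - V x t) \<le> e / 2)"
      using V_uniform[of t "e / 2"] t e by auto
    show "\<exists>\<delta>>0. \<forall>s\<in>{0..}. dist s t < \<delta> \<longrightarrow> dist (J s) (J t) < e"
    proof (intro exI[of _ \<delta>] conjI ballI impI)
      fix s assume s: "s \<in> {0..}" "dist s t < \<delta>"
      have "J s - J t = integral {0..1} (\<lambda>y. V y s - V y t)"
        unfolding J_def by (rule integral_diff[symmetric]) (use s t iV in auto)
      also have "norm \<dots> \<le> integral {0..1} (\<lambda>y::real. e / 2)"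
        using \<delta>(2) s t by (intro integral_norm_bound_integral integrable_diff iV) (auto simp: dist_real_def)
      finally show "dist (J s) (J t) < e" using e by (simp add: dist_norm)
    qed (rule \<delta>)
  qed
  have w0: "w t 0 = (1 / T) *\<^sub>R integral {0..t} (\<lambda>s. V 0 s) + J t - integral {0..1} v0" if t: "t \<ge> 0" for t
  proof -
    have "integral {0..1} (\<lambda>y. B y t + v0 y) = w t 0 - J t + integral {0..1} v0"
      unfolding B_def J_def using iV[OF t] integrable_continuous_interval[OF continuous_on_v0]
      by (subst integral_add integral_diff; auto intro!: integrable_diff)+
    then have "T *\<^sub>R (w t 0 - J t + integral {0..1} v0) = integral {0..t} (\<lambda>s. V 0 s)"
      using integral_identity[OF t, of 0] by simp
    from this[symmetric] have "(1 / T) *\<^sub>R integral {0..t} (\<lambda>s. V 0 s) = (1 / T) *\<^sub>R (T *\<^sub>R (w t 0 - J t + integral {0..1} v0))"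
      by (simp only:)
    also have "\<dots> = w t 0 - J t + integral {0..1} v0" using T_pos by simp
    finally show ?thesis by simp
  qed
  have "continuous_on {0..} (\<lambda>t. integral {0..t} (\<lambda>s. V 0 s))"
    unfolding continuous_on_eq_continuous_within
  proof
    fix t :: real assume t: "t \<in> {0..}"
    have "continuous_on {0..t + 1} (\<lambda>t. integral {0..t} (\<lambda>s. V 0 s))"
      by (intro indefinite_integral_continuous_1 integrable_continuous_interval continuous_on_subset[OF V0]) auto
    then have "continuous (at t within {0..t + 1}) (\<lambda>t. integral {0..t} (\<lambda>s. V 0 s))"
      using t by (simp add: continuous_on_eq_continuous_within)
    moreover have "at t within {0..t + 1} = at t within {0..}"
      by (rule at_within_nhd[of t "{..<t + 1}"]) (use t in auto)
    ultimately show "continuous (at t within {0..}) (\<lambda>t. integral {0..t} (\<lambda>s. V 0 s))" by simp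
  qed
  then have "continuous_on {0..} (\<lambda>t. (1 / T) *\<^sub>R integral {0..t} (\<lambda>s. V 0 s) + J t - integral {0..1} v0)"
    by (intro continuous_intros J)
  then show ?thesis by (rule continuous_on_eq) (simp add: w0)
qed

lemma B_initial: "x \<in> {0..1} \<Longrightarrow> B x 0 = - v0 x"
  and B_transport: "x \<in> {0..1} \<Longrightarrow> t \<ge> 0 \<Longrightarrow> h \<ge> 0 \<Longrightarrow> x - h / T \<in> {0..1} \<Longrightarrow> B (x - h / T) (t + h) = B x t"
proof -
  have cV: "continuous_on ({0..1} \<times> {0..}) (\<lambda>(x, t). V x t)"
    by (rule continuous_on_Times_uniform) (use continuous_on_V V_uniform in auto)
  have "continuous_on ({0..1::real} \<times> {0..}) (\<lambda>p. w (snd p) 0)"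
    by (rule continuous_on_compose2[OF continuous_on_boundary_value]) (auto intro: continuous_intros)
  then have "continuous_on ({0..1} \<times> {0..}) (\<lambda>(x, t). B x t)"
    using cV unfolding B_def split_def by (intro continuous_on_diff)
  note tr = transport_constant_on_characteristics[OF T_pos this continuous_on_v0]
  have eq: "T *\<^sub>R integral {x..1} (\<lambda>y. B y t + v0 y) = integral {0..t} (\<lambda>s. B 1 s - B x s)"
    if "x \<in> {0..1}" "t \<ge> 0" for x t
    using integral_identity[OF that(2,1)] by (simp add: B_def)
  show "x \<in> {0..1} \<Longrightarrow> B x 0 = - v0 x" by (rule tr(1)[OF eq])
  show "x \<in> {0..1} \<Longrightarrow> t \<ge> 0 \<Longrightarrow> h \<ge> 0 \<Longrightarrow> x - h / T \<in> {0..1} \<Longrightarrow> B (x - h / T) (t + h) = B x t"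
    by (rule tr(2)[OF eq])
qed

text \<open>At time \<open>j * T\<close> a wave displays exactly the stretch of its profile over
  \<open>[j, j + 1]\<close>, so this stretch is read off the state at that time. Only countably many
  states enter, and no boundary value of \<open>z\<close> is involved.\<close>

definition profile :: "real \<Rightarrow> 'a" where
  "profile x = (let j = of_int \<lfloor>x\<rfloor>; \<zeta> = k_inv (x - j) in lam \<zeta> *\<^sub>R z \<zeta> (j * T))"

lemma profile_eq: "x \<in> {0..<1} \<Longrightarrow> profile (x + real j) = lam (k_inv x) *\<^sub>R z (k_inv x) (real j * T)"
proof -
  assume "x \<in> {0..<1}"
  then have "\<lfloor>x + real j\<rfloor> = int j" by (simp add: floor_eq_iff)
  then show ?thesis by (simp add: profile_def Let_def)
qed

lemma sq_integrable_profile_unit: "sq_integrable (real j) (real j + 1) profile"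
proof -
  have "sq_integrable 0 1 (\<lambda>y. lam (k_inv y) *\<^sub>R z (k_inv y) (real j * T))"
    using T_pos by (intro sq_integrable_k_inv sq_z) auto
  \<comment> \<open>At \<open>y = 1\<close> the floor jumps and \<open>profile\<close> already
    refers to the state at the next multiple of \<open>T\<close>.\<close>
  moreover have "{y\<in>{0..1}. lam (k_inv y) *\<^sub>R z (k_inv y) (real j * T) \<noteq> profile (y + real j)} \<subseteq> {1}"
  proof
    fix y assume "y \<in> {y\<in>{0..1}. lam (k_inv y) *\<^sub>R z (k_inv y) (real j * T) \<noteq> profile (y + real j)}"
    then show "y \<in> {1}" using profile_eq[of y j] by (cases "y = 1") auto
  qed
  then have "negligible {y\<in>{0..1}. lam (k_inv y) *\<^sub>R z (k_inv y) (real j * T) \<noteq> profile (y + real j)}"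
    by (rule negligible_subset[rotated]) simp
  ultimately have s: "sq_integrable 0 1 (\<lambda>y. profile (y + real j))"
    by (rule sq_integrable_spike)
  show ?thesis using sq_integrable_shift[of "real j" "- real j" "real j + 1" "\<lambda>y. profile (y + real j)"] s by simp
qed

lemma sq_integrable_profile: "sq_integrable 0 X profile"
proof -
  have n: "sq_integrable 0 (real n) profile" for n
  proof (induction n)
    case 0
    show ?case using sq_integrable_subinterval[OF sq_integrable_profile_unit[of 0], of 0 0] by simp
  next
    case (Suc n)
    show ?case using sq_integrable_combine[OF Suc sq_integrable_profile_unit[of n]] by (simp add: add.commute)
  qed
  obtain n where "X \<le> real n" using real_arch_simple by blast
  then show ?thesis using sq_integrable_subinterval[OF n[of n], of 0 X] by simp
qed

lemma integral_profile_unit: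
  assumes y: "y \<in> {0..1}"
  shows "T *\<^sub>R integral {y + real j..1 + real j} profile = V y (real j * T)"
proof -
  let ?h = "\<lambda>x. lam (k_inv x) *\<^sub>R z (k_inv x) (real j * T)"
  have "sq_integrable 0 1 ?h" using T_pos by (intro sq_integrable_k_inv sq_z) auto
  then have h: "sq_integrable y 1 ?h" by (rule sq_integrable_subinterval) (use y in auto)
  then have ha: "?h absolutely_integrable_on {k (k_inv y)..k 0}"
    using y by (simp add: sq_integrable_absolutely_integrable)
  have "integral {y + real j..1 + real j} profile = integral {y..1} (\<lambda>x. profile (x + real j))"
    using has_integral_affine[of profile 1 y "real j" 1]
      sq_integrable_integrable[OF sq_integrable_subinterval[OF sq_integrable_profile[of "1 + real j"], of "y + real j" "1 + real j"]] y
    by (simp add: integral_unique)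
  also have "\<dots> = integral {y..1} ?h"
    by (rule integral_spike[of "{1}"]) (use y in \<open>auto simp: profile_eq\<close>)
  finally have eq: "integral {y + real j..1 + real j} profile = integral {y..1} ?h" .
  have "T *\<^sub>R integral {y..1} ?h = integral {0..k_inv y} (\<lambda>x. inverse (lam x) *\<^sub>R ?h (k x))"
    using change_of_variables(2)[OF _ _ _ ha] k_inv_in[OF y] y by (simp only: k_0 k_k_inv atLeastAtMost_iff order_refl simp_thms)
  also have "\<dots> = integral {0..k_inv y} (\<lambda>x. z x (real j * T))"
  proof (rule integral_spike[OF negligible_bad])
    fix x assume x: "x \<in> {0..k_inv y} - bad"
    then have "x \<in> {0..1} - bad" using k_inv_in[OF y] by auto
    then show "z x (real j * T) = inverse (lam x) *\<^sub>R ?h (k x)" using not_bad(3)[of x] by simp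
  qed
  finally show ?thesis unfolding eq V_def prim_def .
qed

text \<open>Each unit interval adds \<open>V 0 (real j * T)\<close>, which is the increment of
  \<open>B\<close> from 0 to 1 at that time. The transport law identifies the value at 1 with the
  value at 0 one period \<open>T\<close> later, so the sum telescopes.\<close>

lemma integral_profile_nat_plus:
  assumes y: "y \<in> {0..1}"
  shows "T *\<^sub>R integral {0..y + real j} profile = B y (real j * T) - B 0 0"
proof -
  have split: "integral {0..y + real j} profile + integral {y + real j..1 + real j} profile = integral {0..1 + real j} profile"
    if "y \<in> {0..1}" for y j
    using that by (intro Henstock_Kurzweil_Integration.integral_combine sq_integrable_integrable sq_integrable_profile) auto
  have step: "T *\<^sub>R integral {0..y + real j} profile = T *\<^sub>R integral {0..1 + real j} profile - V y (real j * T)"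
    if "y \<in> {0..1}" for y j
    unfolding split[OF that, symmetric] scaleR_add_right integral_profile_unit[OF that] by simp
  have nat: "T *\<^sub>R integral {0..real j} profile = B 0 (real j * T) - B 0 0" for j
  proof (induction j)
    case (Suc j)
    have "T *\<^sub>R integral {0..1 + real j} profile = T *\<^sub>R integral {0..real j} profile + V 0 (real j * T)"
      using step[of 0 j] by simp
    also have "\<dots> = B 1 (real j * T) - B 0 0" by (simp add: Suc B_def)
    also have "B 1 (real j * T) = B 0 (real (Suc j) * T)"
      using B_transport[of 1 "real j * T" T] T_pos by (simp add: algebra_simps)
    finally show ?case by (simp add: add.commute)
  qed simp
  have "T *\<^sub>R integral {0..1 + real j} profile = B 1 (real j * T) - B 0 0"
    using step[of 0 j] nat[of j] by (simp add: B_def algebra_simps)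
  then show ?thesis using step[OF y, of j] by (simp add: B_def)
qed

lemma integral_profile:
  assumes x: "x \<in> {0..1}" and t: "t \<ge> 0"
  shows "T *\<^sub>R integral {0..x + t / T} profile = B x t - B 0 0"
proof -
  define j where "j = nat \<lfloor>x + t / T\<rfloor>"
  define y where "y = x + t / T - real j"
  have "x + t / T \<ge> 0" using x t T_pos by simp
  then have y: "y \<in> {0..1}" "x + t / T = y + real j"
    unfolding y_def j_def by (auto simp: of_nat_nat le_floor_iff) linarith+
  have jT: "real j * T = t + (x - y) * T" using y(2) T_pos by (simp add: field_simps)
  \<comment> \<open>The points \<open>(x, t)\<close> and \<open>(y, real j * T)\<close> lie on one
    characteristic, since \<open>x + t / T = y + real j\<close>. The transport law runs forward in
    time, so the case split decides which point is the starting one.\<close>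
  have "B y (real j * T) = B x t"
  proof (cases "y \<le> x")
    case True
    then show ?thesis using B_transport[of x t "(x - y) * T"] x y t T_pos by (simp add: jT)
  next
    case False
    have "t = real j * T + (y - x) * T" using jT by (simp add: algebra_simps)
    then show ?thesis using B_transport[of y "real j * T" "(y - x) * T"] False x y t T_pos by simp
  qed
  then show ?thesis using integral_profile_nat_plus[OF y(1), of j] y(2) by simp
qed

text \<open>The flux is a difference of two primitives of the profile, so the constant
  \<open>B 0 0\<close> cancels; what remains is \<open>B (k x) t - B (k x) 0\<close>, and
  \<open>B_initial\<close> turns the last term into \<open>v0\<close>.\<close>

lemma w_eq_flux:
  assumes t: "t \<ge> 0" and x: "x \<in> {0..1}"
  shows "w t x = flux profile t x"
proof -
  have kx: "k x \<in> {0..1}" using k_in[OF x] .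
  have "flux profile t x = T *\<^sub>R integral {0..k x + t / T} profile - T *\<^sub>R integral {0..k x + 0 / T} profile"
    using flux_eq[OF sq_integrable_profile t x] by (simp add: scaleR_diff_right)
  also have "\<dots> = B (k x) t - B (k x) 0"
    unfolding integral_profile[OF kx t] integral_profile[OF kx order_refl] by simp
  also have "\<dots> = w t x" using B_initial[OF kx] w_k_inv[OF t kx] x by simp
  finally show ?thesis by simp
qed

text \<open>The flux vanishes at time 0, hence so does \<open>w 0\<close>, and \<open>w_eq\<close>
  makes the primitives of the two states equal.\<close>

lemma z_eq_initial: "negligible {x\<in>{0..1}. z x 0 \<noteq> z0 x}"
proof (rule negligible_neq_if_integral_eq)
  show "(\<lambda>x. z x 0) integrable_on {0..1}" "z0 integrable_on {0..1}"
    using sq_z[of 0] z0 by (auto intro: sq_integrable_integrable)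
  show "integral {0..x} (\<lambda>x. z x 0) = integral {0..x} z0" if x: "x \<in> {0..1}" for x
    using w_eq[of 0 x] w_eq_flux[of 0] x by (simp add: flux_def prim_def prim0_def)
qed

lemma profile_initial: "negligible {x\<in>{0..1}. lam x *\<^sub>R z0 x \<noteq> profile (k x)}"
\<comment> \<open>The point 0 is set aside because \<open>k 0 = 1\<close> already belongs to the
  next unit interval of the profile.\<close>
proof (rule negligible_subset[of "{x\<in>{0..1}. z x 0 \<noteq> z0 x} \<union> {0}"])
  show "negligible ({x\<in>{0..1}. z x 0 \<noteq> z0 x} \<union> {0})" by (intro negligible_Un z_eq_initial) simp
  have "profile (k x) = lam x *\<^sub>R z x 0" if "x \<in> {0..1}" "x \<noteq> 0" for x
  proof -
    have "k x \<in> {0..<1}" using k_strict[of 0 x] k_in[of x] that by auto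
    then show ?thesis using profile_eq[of "k x" 0] that by simp
  qed
  then show "{x\<in>{0..1}. lam x *\<^sub>R z0 x \<noteq> profile (k x)} \<subseteq> {x\<in>{0..1}. z x 0 \<noteq> z0 x} \<union> {0}" by auto
qed

text \<open>For \<open>t\<close> between multiples of \<open>T\<close> the profile was not built
  from \<open>z\<close>. The flux coincides with \<open>w t\<close>, and the derivative of each
  determines the state, so the primitives of \<open>z\<close> and of the wave agree.\<close>

lemma z_eq_wave:
  assumes t: "t \<ge> 0"
  shows "negligible {x\<in>{0..1}. z x t \<noteq> wave profile t x}"
proof (rule negligible_neq_if_integral_eq)
  note sw = sq_integrable_wave[OF sq_integrable_profile]
  show "(\<lambda>x. z x t) integrable_on {0..1}" "wave profile t integrable_on {0..1}"
    using sq_z[OF t] sw[OF t] by (auto intro: sq_integrable_integrable)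
  fix x :: real assume x: "x \<in> {0..1}"
  have sub: "{0..x} \<subseteq> {0..1}" using x by auto
  have "flux profile t x = flux profile t 0 + integral {0..x} (\<lambda>x. wave profile 0 x - wave profile t x)"
    using H1_flux[OF sq_integrable_profile t] x unfolding H1_with_derivative_iff by blast
  also have "integral {0..x} (\<lambda>x. wave profile 0 x - wave profile t x) = integral {0..x} (wave profile 0) - integral {0..x} (wave profile t)"
    using sw[OF t] sw[of 0] sub by (intro integral_diff) (auto intro: integrable_on_subinterval sq_integrable_integrable)
  also have "integral {0..x} (wave profile 0) = prim0 x"
    unfolding prim0_def
  proof (rule integral_spike[OF negligible_Un[OF negligible_bad profile_initial]])
    fix y assume y: "y \<in> {0..x} - (bad \<union> {x \<in> {0..1}. lam x *\<^sub>R z0 x \<noteq> profile (k x)})"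
    then have y1: "y \<in> {0..1}" using x by auto
    then have "profile (k y) = lam y *\<^sub>R z0 y" "lam y > 0" using y not_bad(3)[of y] by auto
    then show "z0 y = wave profile 0 y" by (simp add: wave_def)
  qed
  finally have "integral {0..x} (wave profile t) = prim0 x - w t x + w t 0"
    using w_eq_flux[OF t] x by (simp add: algebra_simps)
  then show "integral {0..x} (\<lambda>x. z x t) = integral {0..x} (wave profile t)"
    using w_eq[OF t x] by (simp add: prim_def)
qed

lemma mild_solution_is_wave:
  obtains f where "\<And>X. sq_integrable 0 X f" "\<And>t. t \<ge> 0 \<Longrightarrow> negligible {x\<in>{0..1}. z x t \<noteq> wave f t x}"
    "negligible {x\<in>{0..1}. lam x *\<^sub>R z0 x \<noteq> f (k x)}"
    "\<And>t x. t \<ge> 0 \<Longrightarrow> x \<in> {0..1} \<Longrightarrow> w t x = flux f t x"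
  using that sq_integrable_profile z_eq_wave profile_initial w_eq_flux by blast

end

end

section \<open>Boundary conditions and the discrete-time recursion\<close>

text \<open>Differentiating the primitive gives one direction. For the other, the exceptional sets
  of the unit intervals are moved back to their places and form a countable union of null
  sets.\<close>

lemma integral_eq_0_iff_negligible:
  fixes E :: "real \<Rightarrow> 'a::euclidean_space"
  assumes E: "\<And>X. sq_integrable 0 X E"
  shows "(\<forall>x\<ge>0. integral {0..x} E = 0) \<longleftrightarrow> (\<forall>j. negligible {s\<in>{0..1}. E (real j + s) \<noteq> 0})"
proof
  assume *: "\<forall>x\<ge>0. integral {0..x} E = 0"
  show "\<forall>j. negligible {s\<in>{0..1}. E (real j + s) \<noteq> 0}"
  proof
    fix j
    have "negligible {x\<in>{0..real j + 1}. E x \<noteq> (\<lambda>_. 0) x}"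
      using * by (intro negligible_neq_if_integral_eq sq_integrable_integrable E sq_integrable_const) auto
    then have "negligible {s\<in>{0..1}. real j + s \<in> {x\<in>{0..real j + 1}. E x \<noteq> 0}}"
      by (rule negligible_expansive_preimage[where C=1]) simp
    then show "negligible {s\<in>{0..1}. E (real j + s) \<noteq> 0}"
      by (rule negligible_subset) auto
  qed
next
  assume *: "\<forall>j. negligible {s\<in>{0..1}. E (real j + s) \<noteq> 0}"
  let ?N = "\<Union>j. (\<lambda>s. real j + s) ` {s\<in>{0..1}. E (real j + s) \<noteq> 0}"
  have "negligible ((\<lambda>s. real j + s) ` {s\<in>{0..1}. E (real j + s) \<noteq> 0})" for j
    using * by (intro negligible_Lipschitz_image[where C=1]) auto
  then have N: "negligible ?N" by (intro negligible_countable_Union) auto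
  show "\<forall>x\<ge>0. integral {0..x} E = 0"
  proof (intro allI impI)
    fix x :: real
    have "integral {0..x} E = integral {0..x} (\<lambda>x. 0)"
    proof (rule integral_spike[OF N])
      fix y assume y: "y \<in> {0..x} - ?N"
      define j where "j = nat \<lfloor>y\<rfloor>"
      have "y - real j \<in> {0..1}" using y unfolding j_def by (auto simp: of_nat_nat) linarith+
      then have "y \<in> (\<lambda>s. real j + s) ` {s\<in>{0..1}. E (real j + s) \<noteq> 0}" if "E y \<noteq> 0"
        using that by (intro image_eqI[of _ _ "y - real j"]) auto
      then show "0 = E y" using y by (cases "E y = 0") auto
    qed
    then show "integral {0..x} E = 0" by simp
  qed
qed

lemma bounded_linear_matrix_vector_mult_complex: "bounded_linear (\<lambda>x. (A :: complex^'n^'m) *v x)"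
proof -
  have "linear (\<lambda>x. A *v x)"
    by (rule linearI) (auto simp: matrix_vector_mult_def vec_eq_iff sum.distrib algebra_simps scaleR_sum_right)
  then show ?thesis by (simp add: linear_conv_bounded_linear)
qed

lemma matrix_vector_mult_uminus_left: "(- A :: complex^'n^'m) *v x = - (A *v x)"
  by (simp add: matrix_vector_mult_def vec_eq_iff sum_negf)

context wave_speed
begin

text \<open>Since \<open>k 0 = 1\<close> and \<open>k 1 = 0\<close>, the flux at the two ends
  integrates \<open>f (s + 1)\<close> and \<open>f s\<close> over \<open>{0..t / T}\<close>, up to
  the factor \<open>T\<close>; rescaling time does the same for \<open>g\<close>. The target
  dimension is arbitrary so that the lemma serves the input and, with \<open>G = mat 1\<close>, the
  output condition.\<close>

lemma boundary_condition_iff: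
  fixes f :: "real \<Rightarrow> complex^'n" and g :: "real \<Rightarrow> complex^'q"
    and G :: "complex^'q^'m" and K L :: "complex^'n^'m"
  assumes f: "\<And>X. sq_integrable 0 X f" and g: "\<And>X. sq_integrable 0 X g"
  shows "(\<forall>t\<ge>0. G *v integral {0..t} g = - (K *v flux f t 0) - L *v flux f t 1) \<longleftrightarrow>
    (\<forall>j. negligible {s\<in>{0..1}. G *v g ((real j + s) * T) + K *v f (real j + s + 1) + L *v f (real j + s) \<noteq> 0})"
proof -
  note bl = bounded_linear_matrix_vector_mult_complex
  let ?E = "\<lambda>s. G *v g (s * T) + K *v f (s + 1) + L *v f s"
  have g': "sq_integrable 0 X (\<lambda>s. g (s * T))" for X
    using sq_integrable_affine[of T 0 0 X g] g T_pos by (simp add: mult.commute)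
  have f': "sq_integrable 0 X (\<lambda>s. f (s + 1))" for X
    using sq_integrable_shift[of 0 1 X f] sq_integrable_subinterval[OF f[of "X + 1"], of 1 "X + 1"] by simp
  have E: "sq_integrable 0 X ?E" for X
    by (intro sq_integrable_add sq_integrable_linear[OF _ bl] f f' g')
  have eq: "G *v integral {0..t} g + K *v flux f t 0 + L *v flux f t 1 = T *\<^sub>R integral {0..t / T} ?E" if t: "t \<ge> 0" for t
  proof -
    note i = sq_integrable_integrable
    have "integral {0..t / T} ?E = G *v integral {0..t / T} (\<lambda>s. g (s * T)) + K *v integral {0..t / T} (\<lambda>s. f (s + 1)) + L *v integral {0..t / T} f"
      using integral_linear[OF i[OF g'[of "t / T"]] bl[of G]] integral_linear[OF i[OF f'[of "t / T"]] bl[of K]] integral_linear[OF i[OF f[of "t / T"]] bl[of L]]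
        i[OF sq_integrable_linear[OF g'[of "t / T"] bl[of G]]] i[OF sq_integrable_linear[OF f'[of "t / T"] bl[of K]]] i[OF sq_integrable_linear[OF f[of "t / T"] bl[of L]]]
      by (simp add: o_def integral_add integrable_add)
    moreover have "integral {0..t / T} (\<lambda>s. g (s * T)) = (1 / T) *\<^sub>R integral {0..t} g"
      using has_integral_affine[of g T 0 0 "t / T"] i[OF g[of t]] T_pos
      by (simp add: mult.commute integral_unique inverse_eq_divide)
    moreover have "integral {0..t / T} (\<lambda>s. f (s + 1)) = integral {1..1 + t / T} f"
      using has_integral_affine[of f 1 0 1 "t / T"] i[OF sq_integrable_subinterval[OF f[of "t / T + 1"], of 1 "t / T + 1"]]
      by (simp add: integral_unique add.commute)
    ultimately show ?thesis
      using T_pos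
      by (simp add: flux_def scaleR_add_right linear_cmul[OF bounded_linear.linear[OF bl]])
  qed
  have "(\<forall>t\<ge>0. G *v integral {0..t} g = - (K *v flux f t 0) - L *v flux f t 1) \<longleftrightarrow> (\<forall>t\<ge>0. integral {0..t / T} ?E = 0)"
  proof (intro all_cong imp_cong refl)
    fix t :: real assume "0 \<le> t"
    have "G *v integral {0..t} g = - (K *v flux f t 0) - L *v flux f t 1 \<longleftrightarrow>
        G *v integral {0..t} g + K *v flux f t 0 + L *v flux f t 1 = 0"
      by (auto simp: algebra_simps eq_neg_iff_add_eq_0)
    then show "G *v integral {0..t} g = - (K *v flux f t 0) - L *v flux f t 1 \<longleftrightarrow> integral {0..t / T} ?E = 0"
      unfolding eq[OF \<open>0 \<le> t\<close>] using T_pos by simp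
  qed
  also have "\<dots> \<longleftrightarrow> (\<forall>x\<ge>0. integral {0..x} ?E = 0)"
  proof safe
    fix x :: real assume "\<forall>t\<ge>0. integral {0..t / T} ?E = 0" "x \<ge> 0"
    then have "integral {0..(x * T) / T} ?E = 0" using T_pos by (meson mult_nonneg_nonneg less_imp_le)
    then show "integral {0..x} ?E = 0" using T_pos by simp
  qed (use T_pos in auto)
  also have "\<dots> \<longleftrightarrow> (\<forall>j. negligible {s\<in>{0..1}. ?E (real j + s) \<noteq> 0})"
    by (rule integral_eq_0_iff_negligible[OF E])
  finally show ?thesis .
qed

end

lemma state_equation_iff:
  fixes K L P :: "complex^'n^'n" and G :: "complex^'p^'n"
  assumes "invertible K"
  shows "G *v u + K *v x' + (L ** P) *v x = 0 \<longleftrightarrow>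
    x' = - (matrix_inv K ** L ** P) *v x + - (matrix_inv K ** G) *v u"
proof -
  have KK: "matrix_inv K ** K = mat 1" "K ** matrix_inv K = mat 1"
    using assms unfolding invertible_def matrix_inv_def by (auto intro: someI2_ex)
  show ?thesis
  proof
    assume "G *v u + K *v x' + (L ** P) *v x = 0"
    then have "K *v x' = - ((L ** P) *v x) - G *v u"
      by (metis add.commute add_diff_cancel_right' add_eq_0_iff)
    then have "matrix_inv K *v (K *v x') = matrix_inv K *v (- ((L ** P) *v x) - G *v u)" by simp
    moreover have "matrix_inv K *v (K *v x') = x'"
      by (simp only: matrix_vector_mul_assoc KK matrix_vector_mul_lid)
    ultimately show "x' = - (matrix_inv K ** L ** P) *v x + - (matrix_inv K ** G) *v u"
      by (simp add: matrix_vector_mult_uminus_left matrix_vector_mult_diff_distrib matrix_vector_mul_assoc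
         linear_neg[OF bounded_linear.linear[OF bounded_linear_matrix_vector_mult_complex]] matrix_mul_assoc)
  next
    assume x': "x' = - (matrix_inv K ** L ** P) *v x + - (matrix_inv K ** G) *v u"
    have "K *v x' = - ((K ** matrix_inv K ** L ** P) *v x) - (K ** matrix_inv K ** G) *v u"
      by (simp add: x' matrix_vector_mult_uminus_left matrix_vector_right_distrib matrix_vector_mult_diff_distrib matrix_vector_mul_assoc
         linear_neg[OF bounded_linear.linear[OF bounded_linear_matrix_vector_mult_complex]] matrix_mul_assoc)
    then show "G *v u + K *v x' + (L ** P) *v x = 0" by (simp add: KK)
  qed
qed

text \<open>The output condition involves the next state \<open>x'\<close>. Eliminating it by the
  state equation produces the feedthrough term and the product
  \<open>Ky ** matrix_inv K ** L\<close> in the output matrix.\<close>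

lemma output_equation_iff:
  fixes K L P :: "complex^'n^'n" and G :: "complex^'p^'n" and Ky Ly :: "complex^'n^'m"
  assumes "x' = - (matrix_inv K ** L ** P) *v x + - (matrix_inv K ** G) *v u"
  shows "y + Ky *v x' + (Ly ** P) *v x = 0 \<longleftrightarrow>
    y = ((Ky ** matrix_inv K ** L - Ly) ** P) *v x + (Ky ** matrix_inv K ** G) *v u"
proof -
  have 1: "Ky *v x' = - ((Ky ** matrix_inv K ** L ** P) *v x) - (Ky ** matrix_inv K ** G) *v u"
    by (simp add: assms matrix_vector_mult_uminus_left matrix_vector_right_distrib matrix_vector_mult_diff_distrib matrix_vector_mul_assoc
         linear_neg[OF bounded_linear.linear[OF bounded_linear_matrix_vector_mult_complex]] matrix_mul_assoc)
  have 2: "((Ky ** matrix_inv K ** L - Ly) ** P) *v x = (Ky ** matrix_inv K ** L ** P) *v x - (Ly ** P) *v x"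
    by (simp only: matrix_vector_mul_assoc[symmetric] matrix_vector_mult_diff_rdistrib)
  show ?thesis unfolding 1 2 by (auto simp: algebra_simps eq_neg_iff_add_eq_0 add_eq_0_iff)
qed

text \<open>Both sides are reduced to the existence of a locally square-integrable \<open>f\<close>
  satisfying \<open>wave_of f\<close> and \<open>recursion f\<close>, where the recursion is stated
  for \<open>f\<close> itself instead of for the three sequences.\<close>

theorem lemma3p1:
  fixes lam p k :: "real \<Rightarrow> real" and \<epsilon> :: real
    and M P :: "real \<Rightarrow> real ^ 'n::{finite,linorder} ^ 'n::{finite,linorder}"
    and P1 K L A\<^sub>d :: "complex ^ 'n::{finite,linorder} ^ 'n::{finite,linorder}"
    and K\<^sub>y L\<^sub>y C\<^sub>d :: "complex ^ 'n::{finite,linorder} ^ 'm"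
    and B\<^sub>d :: "complex ^ 'p::{finite,linorder} ^ 'n::{finite,linorder}"
    and D\<^sub>d :: "complex ^ 'p::{finite,linorder} ^ 'm"
    and z\<^sub>0 :: "real \<Rightarrow> complex ^ 'n::{finite,linorder}"
    and u :: "real \<Rightarrow> complex ^ 'p::{finite,linorder}"
    and y :: "real \<Rightarrow> complex ^ 'm"
    and z :: "real \<Rightarrow> real \<Rightarrow> complex ^ 'n::{finite,linorder}"
  assumes "CARD('p) \<le> CARD('n)"
    and "lam \<in> Linf_space {0<..<1}"
    and "\<epsilon> > 0" and "AE \<zeta> in lebesgue_on {0<..<1}. lam \<zeta> \<ge> \<epsilon>"
    and "M \<in> Linf_space {0<..<1}"
    and "fundamental_solution lam M P"
    and "P1 = map_matrix complex_of_real (P 1)"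
    and "invertible K"
    and "p = (\<lambda>\<zeta>. LINT \<eta>:{0..\<zeta>}|lebesgue. inverse (lam \<eta>))"
    and "k = (\<lambda>\<zeta>. 1 - p \<zeta> * inverse (p 1))"
    and "A\<^sub>d = - (matrix_inv K ** L ** P1)"
    and "B\<^sub>d = - (matrix_inv K ** lower_identity)"
    and "C\<^sub>d = (K\<^sub>y ** matrix_inv K ** L - L\<^sub>y) ** P1"
    and "D\<^sub>d = K\<^sub>y ** matrix_inv K ** lower_identity"
    and "z\<^sub>0 \<in> L2_space {0<..<1}"
    and "u \<in> L2_loc" and "y \<in> L2_loc"
  shows "continuous_time_solution lam P1 K L K\<^sub>y L\<^sub>y lower_identity z\<^sub>0 u y z \<longleftrightarrow>
    (\<exists>f \<in> L2_loc.
      (\<forall>t\<ge>0. AE \<zeta> in lebesgue_on {0<..<1}.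
        z \<zeta> t = inverse (lam \<zeta>) *\<^sub>R f (k \<zeta> + inverse (p 1) * t)) \<and>
      (AE \<zeta> in lebesgue_on {0<..<1}. lam \<zeta> *\<^sub>R z\<^sub>0 \<zeta> = f (k \<zeta>)) \<and>
      (\<exists>z\<^sub>d u\<^sub>d y\<^sub>d.
        (AE \<zeta> in lebesgue_on {0<..<1}. z\<^sub>d 0 (k \<zeta>) = lam \<zeta> *\<^sub>R z\<^sub>0 \<zeta>) \<and>
        (\<forall>j\<ge>1. \<forall>\<zeta>\<in>{0..1}. z\<^sub>d j \<zeta> = f (real j + \<zeta>)) \<and>
        (\<forall>j. \<forall>\<zeta>\<in>{0..1}. u\<^sub>d j \<zeta> = u ((real j + \<zeta>) * p 1)) \<and>
        (\<forall>j. \<forall>\<zeta>\<in>{0..1}. y\<^sub>d j \<zeta> = y ((real j + \<zeta>) * p 1)) \<and>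
        discrete_time_solution lam k A\<^sub>d B\<^sub>d C\<^sub>d D\<^sub>d z\<^sub>0 u\<^sub>d y\<^sub>d z\<^sub>d))"
    (is "?continuous \<longleftrightarrow> ?discrete")
proof -
  obtain C where C: "AE x in lebesgue_on {0<..<1}. norm (lam x) \<le> C" and lam: "lam \<in> borel_measurable (lebesgue_on {0..1})"
    using assms(2) by (auto simp: Linf_space_def borel_measurable_open_interval_iff)
  have "AE x in lebesgue_on {0<..<1}. \<epsilon> \<le> lam x \<and> lam x \<le> C"
    using assms(4) C by eventually_elim auto
  then have "negligible {x\<in>{0..1}. \<not> (\<epsilon> \<le> lam x \<and> lam x \<le> C)}"
    unfolding AE_open_interval_iff .
  with assms(3) lam interpret W: wave_speed lam \<epsilon> C
    by unfold_locales
  have p: "p x = W.travel x" if "x \<in> {0..1}" for x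
  proof -
    have "sq_integrable 0 x (\<lambda>x. inverse (lam x))"
      using sq_integrable_subinterval[OF W.sq_integrable_inverse_lam[OF sq_integrable_const[of 0 1 "1::real"]], of 0 x] that by simp
    then show ?thesis
      unfolding assms(9) W.travel_def by (intro set_lebesgue_integral_eq_integral(2) sq_integrable_absolutely_integrable)
  qed
  have p1: "p 1 = W.T" using p[of 1] by (simp add: W.T_def)
  have k: "k x = W.k x" if "x \<in> {0..1}" for x
    using p[OF that] p1 by (simp add: assms(10) W.k_def divide_inverse)
  have z0: "sq_integrable 0 1 z\<^sub>0" using assms(15) by (simp add: L2_space_iff)
  have u: "\<And>X. sq_integrable 0 X u" and y: "\<And>X. sq_integrable 0 X y"
    using assms(16,17) by (auto simp: L2_loc_iff)
  have set_int: "(LINT s:{0..t}|lebesgue. g s) = integral {0..t} g" if "\<And>X. sq_integrable 0 X g" for t and g :: "real \<Rightarrow> complex ^ 'q"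
    by (intro set_lebesgue_integral_eq_integral(2) sq_integrable_absolutely_integrable that)
  have neg_cong: "negligible {x\<in>{0..1}. P x} \<longleftrightarrow> negligible {x\<in>{0..1}. Q x}"
    if "\<And>x. x \<in> {0..1} \<Longrightarrow> P x \<longleftrightarrow> Q x" for P Q :: "real \<Rightarrow> bool"
    using that by (intro arg_cong[where f=negligible]) auto
  define wave_of where "wave_of f \<longleftrightarrow> (\<forall>t\<ge>0. negligible {x\<in>{0..1}. z x t \<noteq> W.wave f t x}) \<and>
    negligible {x\<in>{0..1}. lam x *\<^sub>R z\<^sub>0 x \<noteq> f (W.k x)}" for f
  define recursion where "recursion f \<longleftrightarrow> (\<forall>j.
     negligible {s\<in>{0..1}. f (real j + s + 1) \<noteq> A\<^sub>d *v f (real j + s) + B\<^sub>d *v u ((real j + s) * W.T)} \<and>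
     negligible {s\<in>{0..1}. y ((real j + s) * W.T) \<noteq> C\<^sub>d *v f (real j + s) + D\<^sub>d *v u ((real j + s) * W.T)})" for f
  have bc: "(\<forall>t\<ge>0. lower_identity *v integral {0..t} u = - (K *v W.flux f t 0) - (L ** P1) *v W.flux f t 1 \<and>
       integral {0..t} y = - (K\<^sub>y *v W.flux f t 0) - (L\<^sub>y ** P1) *v W.flux f t 1) \<longleftrightarrow> recursion f"
    if f: "\<And>X. sq_integrable 0 X f" for f
  proof -
    let ?x = "\<lambda>j s. f (real j + s)" and ?x' = "\<lambda>j s. f (real j + s + 1)"
      and ?u = "\<lambda>j s. u ((real j + s) * W.T)" and ?y = "\<lambda>j s. y ((real j + s) * W.T)"
    have 1: "(\<forall>t\<ge>0. lower_identity *v integral {0..t} u = - (K *v W.flux f t 0) - (L ** P1) *v W.flux f t 1) \<longleftrightarrow>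
        (\<forall>j. negligible {s\<in>{0..1}. ?x' j s \<noteq> A\<^sub>d *v ?x j s + B\<^sub>d *v ?u j s})"
      unfolding W.boundary_condition_iff[OF f u] state_equation_iff[OF assms(8)] assms(11,12) ..
    have 2: "(\<forall>t\<ge>0. integral {0..t} y = - (K\<^sub>y *v W.flux f t 0) - (L\<^sub>y ** P1) *v W.flux f t 1) \<longleftrightarrow>
        (\<forall>j. negligible {s\<in>{0..1}. ?y j s + K\<^sub>y *v ?x' j s + (L\<^sub>y ** P1) *v ?x j s \<noteq> 0})"
      using W.boundary_condition_iff[OF f y, of "mat 1" K\<^sub>y "L\<^sub>y ** P1"] by simp
    \<comment> \<open>The two forms of the output equation agree only where the state equation
      holds, so the exceptional set \<open>?N\<close> of the latter is added to either null
      set.\<close>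
    have 3: "negligible {s\<in>{0..1}. ?y j s + K\<^sub>y *v ?x' j s + (L\<^sub>y ** P1) *v ?x j s \<noteq> 0} \<longleftrightarrow>
        negligible {s\<in>{0..1}. ?y j s \<noteq> C\<^sub>d *v ?x j s + D\<^sub>d *v ?u j s}"
      if N: "negligible {s\<in>{0..1}. ?x' j s \<noteq> A\<^sub>d *v ?x j s + B\<^sub>d *v ?u j s}" (is "negligible ?N") for j
    proof -
      have pt: "?y j s + K\<^sub>y *v ?x' j s + (L\<^sub>y ** P1) *v ?x j s = 0 \<longleftrightarrow> ?y j s = C\<^sub>d *v ?x j s + D\<^sub>d *v ?u j s"
        if "s \<in> {0..1} - ?N" for s
        unfolding assms(13,14) by (rule output_equation_iff) (use that in \<open>auto simp: assms(11,12)\<close>)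
      show ?thesis
      proof
        assume "negligible {s\<in>{0..1}. ?y j s + K\<^sub>y *v ?x' j s + (L\<^sub>y ** P1) *v ?x j s \<noteq> 0}"
        from negligible_Un[OF N this] show "negligible {s\<in>{0..1}. ?y j s \<noteq> C\<^sub>d *v ?x j s + D\<^sub>d *v ?u j s}"
          by (rule negligible_subset) (use pt in blast)
      next
        assume "negligible {s\<in>{0..1}. ?y j s \<noteq> C\<^sub>d *v ?x j s + D\<^sub>d *v ?u j s}"
        from negligible_Un[OF N this] show "negligible {s\<in>{0..1}. ?y j s + K\<^sub>y *v ?x' j s + (L\<^sub>y ** P1) *v ?x j s \<noteq> 0}"
          by (rule negligible_subset) (use pt in blast)
      qed
    qed
    show ?thesis unfolding recursion_def using 1 2 3 by meson
  qed
  define mild where "mild t Zt w d \<longleftrightarrow> has_L2_integral z t Zt \<and>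
      negligible {x\<in>{0..1}. w x \<noteq> lam x *\<^sub>R Zt x} \<and> H1_with_derivative w d \<and>
      negligible {x\<in>{0..1}. z x t - z\<^sub>0 x \<noteq> - d x} \<and>
      lower_identity *v integral {0..t} u = - (K *v w 0) - (L ** P1) *v w 1 \<and>
      integral {0..t} y = - (K\<^sub>y *v w 0) - (L\<^sub>y ** P1) *v w 1" for t Zt w d
  have continuous_iff: "?continuous \<longleftrightarrow> continuous_L2_curve z \<and> (\<forall>t\<ge>0. \<exists>Zt w d. mild t Zt w d)"
    unfolding continuous_time_solution_def AE_open_interval_iff set_int[OF u] set_int[OF y] mild_def ..
  have continuous: "?continuous \<longleftrightarrow> (\<exists>f. (\<forall>X. sq_integrable 0 X f) \<and> wave_of f \<and> recursion f)" (is "_ \<longleftrightarrow> ?wave")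
  proof
    assume ?continuous
    then have curve: "continuous_L2_curve z" and ex: "\<And>t. t \<ge> 0 \<Longrightarrow> \<exists>Zt w d. mild t Zt w d"
      unfolding continuous_iff by blast+
    from ex obtain Z w d where "\<And>t. t \<ge> 0 \<Longrightarrow> mild t (Z t) (w t) (d t)" by metis
    note sol = this[unfolded mild_def]
    obtain f where f: "\<And>X. sq_integrable 0 X f" "\<And>t. t \<ge> 0 \<Longrightarrow> negligible {x\<in>{0..1}. z x t \<noteq> W.wave f t x}"
      "negligible {x\<in>{0..1}. lam x *\<^sub>R z\<^sub>0 x \<noteq> f (W.k x)}"
      and w: "\<And>t x. t \<ge> 0 \<Longrightarrow> x \<in> {0..1} \<Longrightarrow> w t x = W.flux f t x"
    proof (rule W.mild_solution_is_wave[OF curve z0])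
      show "has_L2_integral z t (Z t)" "negligible {x\<in>{0..1}. w t x \<noteq> lam x *\<^sub>R Z t x}"
        "H1_with_derivative (w t) (d t)" "negligible {x\<in>{0..1}. z x t - z\<^sub>0 x \<noteq> - d t x}" if "t \<ge> 0" for t
        using sol[OF that] by blast+
    qed blast
    have "lower_identity *v integral {0..t} u = - (K *v W.flux f t 0) - (L ** P1) *v W.flux f t 1 \<and>
        integral {0..t} y = - (K\<^sub>y *v W.flux f t 0) - (L\<^sub>y ** P1) *v W.flux f t 1" if t: "t \<ge> 0" for t
      using sol[OF t] w[OF t, of 0] w[OF t, of 1] by simp
    then have "recursion f" unfolding bc[OF f(1), symmetric] by blast
    then show ?wave using f by (auto simp: wave_of_def)
  next
    assume ?wave
    then obtain f where f: "\<And>X. sq_integrable 0 X f" and "wave_of f" and rec: "recursion f" by blast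
    then have zw: "\<And>t. t \<ge> 0 \<Longrightarrow> negligible {x\<in>{0..1}. z x t \<noteq> W.wave f t x}"
      and init: "negligible {x\<in>{0..1}. lam x *\<^sub>R z\<^sub>0 x \<noteq> f (W.k x)}" by (auto simp: wave_of_def)
    have "\<exists>Zt w d. mild t Zt w d" if t: "t \<ge> 0" for t
      unfolding mild_def
    proof (intro exI conjI)
      show "has_L2_integral z t (\<lambda>x. inverse (lam x) *\<^sub>R W.flux f t x)" by (rule W.wave_is_solution(2)[OF f zw t])
      show "H1_with_derivative (W.flux f t) (\<lambda>x. W.wave f 0 x - W.wave f t x)" by (rule W.H1_flux[OF f t])
      have pos: "lam x > 0" if "x \<in> {0..1} - W.bad" for x using W.not_bad(3)[OF that] .
      show "negligible {x \<in> {0..1}. W.flux f t x \<noteq> lam x *\<^sub>R inverse (lam x) *\<^sub>R W.flux f t x}"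
        by (rule negligible_subset[OF W.negligible_bad]) (use pos in force)
      show "negligible {x \<in> {0..1}. z x t - z\<^sub>0 x \<noteq> - (W.wave f 0 x - W.wave f t x)}" (is "negligible ?M")
      proof (rule negligible_subset[OF negligible_Un[OF W.negligible_bad negligible_Un[OF zw[OF t] init]]], rule subsetI, rule ccontr)
        fix x assume x: "x \<in> ?M" "x \<notin> W.bad \<union> ({x \<in> {0..1}. z x t \<noteq> W.wave f t x} \<union> {x \<in> {0..1}. lam x *\<^sub>R z\<^sub>0 x \<noteq> f (W.k x)})"
        then have "f (W.k x) = lam x *\<^sub>R z\<^sub>0 x" "lam x > 0" "z x t = W.wave f t x" using pos[of x] by auto
        then have "z x t - z\<^sub>0 x = - (W.wave f 0 x - W.wave f t x)" by (simp add: W.wave_def)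
        then show False using x by simp
      qed
      show "lower_identity *v integral {0..t} u = - (K *v W.flux f t 0) - (L ** P1) *v W.flux f t 1"
        "integral {0..t} y = - (K\<^sub>y *v W.flux f t 0) - (L\<^sub>y ** P1) *v W.flux f t 1"
        using rec t unfolding bc[OF f, symmetric] by blast+
    qed
    then show ?continuous
      unfolding continuous_iff using W.wave_is_solution(1)[OF f zw] by blast
  qed
  have wave_iff: "(\<forall>t\<ge>0. AE x in lebesgue_on {0<..<1}. z x t = inverse (lam x) *\<^sub>R f (k x + inverse (p 1) * t)) \<and>
      (AE x in lebesgue_on {0<..<1}. lam x *\<^sub>R z\<^sub>0 x = f (k x)) \<longleftrightarrow> wave_of f" for f
  proof -
    have "negligible {x\<in>{0..1}. z x t \<noteq> inverse (lam x) *\<^sub>R f (k x + inverse (p 1) * t)} \<longleftrightarrow>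
        negligible {x\<in>{0..1}. z x t \<noteq> W.wave f t x}" for t
      by (rule neg_cong) (simp add: W.wave_def k p1 divide_inverse mult.commute)
    moreover have "negligible {x\<in>{0..1}. lam x *\<^sub>R z\<^sub>0 x \<noteq> f (k x)} \<longleftrightarrow> negligible {x\<in>{0..1}. lam x *\<^sub>R z\<^sub>0 x \<noteq> f (W.k x)}"
      by (rule neg_cong) (simp add: k)
    ultimately show ?thesis by (simp add: wave_of_def AE_open_interval_iff)
  qed
  have discrete: "(\<exists>z\<^sub>d u\<^sub>d y\<^sub>d.
        (AE \<zeta> in lebesgue_on {0<..<1}. z\<^sub>d 0 (k \<zeta>) = lam \<zeta> *\<^sub>R z\<^sub>0 \<zeta>) \<and>
        (\<forall>j\<ge>1. \<forall>\<zeta>\<in>{0..1}. z\<^sub>d j \<zeta> = f (real j + \<zeta>)) \<and>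
        (\<forall>j. \<forall>\<zeta>\<in>{0..1}. u\<^sub>d j \<zeta> = u ((real j + \<zeta>) * p 1)) \<and>
        (\<forall>j. \<forall>\<zeta>\<in>{0..1}. y\<^sub>d j \<zeta> = y ((real j + \<zeta>) * p 1)) \<and>
        discrete_time_solution lam k A\<^sub>d B\<^sub>d C\<^sub>d D\<^sub>d z\<^sub>0 u\<^sub>d y\<^sub>d z\<^sub>d) \<longleftrightarrow> recursion f" (is "?D \<longleftrightarrow> _")
    if f: "\<And>X. sq_integrable 0 X f" and init: "negligible {x\<in>{0..1}. lam x *\<^sub>R z\<^sub>0 x \<noteq> f (W.k x)}" for f
  proof
    assume ?D
    then show "recursion f"
      unfolding discrete_time_solution_def AE_open_interval_iff
    proof (elim exE conjE)
      fix z\<^sub>d u\<^sub>d y\<^sub>d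
      assume zd0: "negligible {x\<in>{0..1}. z\<^sub>d 0 (k x) \<noteq> lam x *\<^sub>R z\<^sub>0 x}"
        and zd: "\<forall>j\<ge>1. \<forall>x\<in>{0..1}. z\<^sub>d j x = f (real j + x)"
        and ud: "\<forall>j. \<forall>x\<in>{0..1}. u\<^sub>d j x = u ((real j + x) * p 1)"
        and yd: "\<forall>j. \<forall>x\<in>{0..1}. y\<^sub>d j x = y ((real j + x) * p 1)"
        and state: "\<forall>j. negligible {x\<in>{0..1}. z\<^sub>d (j + 1) x \<noteq> A\<^sub>d *v z\<^sub>d j x + B\<^sub>d *v u\<^sub>d j x}"
        and out: "\<forall>j. negligible {x\<in>{0..1}. y\<^sub>d j x \<noteq> C\<^sub>d *v z\<^sub>d j x + D\<^sub>d *v u\<^sub>d j x}"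
      \<comment> \<open>The case \<open>j = 0\<close> differs: the first state is prescribed only
        through its composite with \<open>k\<close>, almost everywhere. The exceptional set is
        carried along by \<open>W.k\<close>, which preserves null sets.\<close>
      have zf: "negligible {x\<in>{0..1}. z\<^sub>d j x \<noteq> f (real j + x)}" for j
      proof (cases "j = 0")
        case True
        let ?N = "{x\<in>{0..1}. z\<^sub>d 0 (k x) \<noteq> lam x *\<^sub>R z\<^sub>0 x} \<union> {x\<in>{0..1}. lam x *\<^sub>R z\<^sub>0 x \<noteq> f (W.k x)}"
        have "negligible (W.k ` ?N)"
          by (rule W.negligible_k_image[OF negligible_Un[OF zd0 init]]) auto
        moreover have "{x\<in>{0..1}. z\<^sub>d j x \<noteq> f (real j + x)} \<subseteq> W.k ` ?N"
        proof
          fix x assume x: "x \<in> {x\<in>{0..1}. z\<^sub>d j x \<noteq> f (real j + x)}"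
          then have x1: "x \<in> {0..1}" by blast
          define c where "c = W.k_inv x"
          have c: "c \<in> {0..1}" "W.k c = x" using W.k_inv_in[OF x1] W.k_k_inv[OF x1] by (simp_all add: c_def)
          have "c \<in> ?N"
          proof (rule ccontr)
            assume "c \<notin> ?N"
            then have "z\<^sub>d 0 (k c) = lam c *\<^sub>R z\<^sub>0 c" "lam c *\<^sub>R z\<^sub>0 c = f (W.k c)" using c(1) by blast+
            then have "z\<^sub>d 0 x = f x" using k[OF c(1)] c(2) by simp
            then show False using x True by simp
          qed
          then show "x \<in> W.k ` ?N" using c(2) by blast
        qed
        ultimately show ?thesis by (rule negligible_subset)
      next
        case False
        then show ?thesis using zd by (intro negligible_subset[OF negligible_empty]) auto
      qed
      show "recursion f"
        unfolding recursion_def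
      proof (intro allI conjI)
        fix j
        have *: "f (real j + s + 1) = z\<^sub>d (j + 1) s" if "s \<in> {0..1}" for s
          using zd[rule_format, of "j + 1" s] that by (simp add: algebra_simps)
        show "negligible {s\<in>{0..1}. f (real j + s + 1) \<noteq> A\<^sub>d *v f (real j + s) + B\<^sub>d *v u ((real j + s) * W.T)}"
          by (rule negligible_subset[OF negligible_Un[OF zf[of j] state[rule_format, of j]]]) (use ud * p1 in auto)
        show "negligible {s\<in>{0..1}. y ((real j + s) * W.T) \<noteq> C\<^sub>d *v f (real j + s) + D\<^sub>d *v u ((real j + s) * W.T)}"
          by (rule negligible_subset[OF negligible_Un[OF zf[of j] out[rule_format, of j]]]) (use ud yd p1 in auto)
      qed
    qed
  next
    assume rec: "recursion f"
    \<comment> \<open>The formula for the states is used for \<open>j = 0\<close> as well; there the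
      prescribed initial condition is the relation \<open>init\<close> between \<open>f\<close> and
      the initial state.\<close>
    let ?z = "\<lambda>j x. f (real j + x)" and ?u = "\<lambda>j x. u ((real j + x) * p 1)" and ?y = "\<lambda>j x. y ((real j + x) * p 1)"
    have i0: "negligible {x\<in>{0..1}. ?z 0 (k x) \<noteq> lam x *\<^sub>R z\<^sub>0 x}"
      by (rule negligible_subset[OF init]) (auto simp: k)
    have sq: "sq_integrable 0 1 (\<lambda>x. g ((real j + x) * m))" if "\<And>X. sq_integrable 0 X g" "m > 0" for g :: "real \<Rightarrow> complex ^ 'q" and m j
    proof -
      have "sq_integrable (m * 0 + m * real j) (m * 1 + m * real j) g"
        by (rule sq_integrable_subinterval[OF that(1)[of "m * 1 + m * real j"]]) (use that(2) in auto)
      from sq_integrable_affine[OF this that(2)] show ?thesis by (simp add: algebra_simps)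
    qed
    have "discrete_time_solution lam k A\<^sub>d B\<^sub>d C\<^sub>d D\<^sub>d z\<^sub>0 ?u ?y ?z"
      unfolding discrete_time_solution_def AE_open_interval_iff L2_space_iff
      using sq[OF f, of 1] sq[OF u W.T_pos] sq[OF y W.T_pos] i0 rec
      by (simp add: recursion_def p1 add_ac)
    with i0 show ?D by (intro exI[of _ ?z] exI[of _ ?u] exI[of _ ?y]) (simp add: AE_open_interval_iff)
  qed
  have "?discrete \<longleftrightarrow> (\<exists>f. (\<forall>X. sq_integrable 0 X f) \<and> wave_of f \<and> recursion f)"
  proof -
    have "?discrete \<longleftrightarrow> (\<exists>f. (\<forall>X. sq_integrable 0 X f) \<and> wave_of f \<and> (\<exists>z\<^sub>d u\<^sub>d y\<^sub>d.
        (AE \<zeta> in lebesgue_on {0<..<1}. z\<^sub>d 0 (k \<zeta>) = lam \<zeta> *\<^sub>R z\<^sub>0 \<zeta>) \<and>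
        (\<forall>j\<ge>1. \<forall>\<zeta>\<in>{0..1}. z\<^sub>d j \<zeta> = f (real j + \<zeta>)) \<and>
        (\<forall>j. \<forall>\<zeta>\<in>{0..1}. u\<^sub>d j \<zeta> = u ((real j + \<zeta>) * p 1)) \<and>
        (\<forall>j. \<forall>\<zeta>\<in>{0..1}. y\<^sub>d j \<zeta> = y ((real j + \<zeta>) * p 1)) \<and>
        discrete_time_solution lam k A\<^sub>d B\<^sub>d C\<^sub>d D\<^sub>d z\<^sub>0 u\<^sub>d y\<^sub>d z\<^sub>d))"
      unfolding wave_iff[symmetric] L2_loc_iff[symmetric] by blast
    also have "\<dots> \<longleftrightarrow> (\<exists>f. (\<forall>X. sq_integrable 0 X f) \<and> wave_of f \<and> recursion f)"
    \<comment> \<open>The congruence is nested because \<open>discrete\<close> depends on the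
      initial identity contained in \<open>wave_of f\<close>.\<close>
    proof (intro iff_exI conj_cong refl discrete)
      show "sq_integrable 0 X f" if "\<forall>X. sq_integrable 0 X f" for f :: "real \<Rightarrow> complex ^ 'n::{finite,linorder}" and X using that by blast
      show "negligible {x\<in>{0..1}. lam x *\<^sub>R z\<^sub>0 x \<noteq> f (W.k x)}" if "wave_of f" for f
        using that by (simp add: wave_of_def)
    qed
    finally show ?thesis .
  qed
  with continuous show ?thesis by (rule trans[OF _ sym])
qed

end
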